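(* Every left 1-MacWilliams ring which is left or right noetherian is quasi-Frobenius.
   Context: Rings are associative with identity and modules are unital. For $n\ge 1$, the Hamming weight $wt(x)$ of $x=(x_1,\ldots,x_n)\in R^n$ is the number of non-zero entries $x_i$ of $x$. A homomorphism $f:L\to R^n$ from a left submodule $L$ of $R^n$ is Hamming weight preserving if $wt(f(x))=wt(x)$ for all $x\in L$. A ring $R$ is left $n$-MacWilliams if every Hamming weight preserving homomorphism $f:L\to R^n$ of left $R$-modules from a left submodule $L$ of $R^n$ extends to an automorphism of the left $R$-module $R^n$. Thus $R$ is left 1-MacWilliams if every monomorphism $f:I\to R$ of left $R$-modules from a left ideal $I$ of $R$ extends to an automorphism of ${}_RR$. A ring $R$ is quasi-Frobenius if it is left and right artinian and left and right self-injective (i.e. ${}_RR$ and $R_R$ are injective modules). *)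

theory Defs
  imports "HOL-Algebra.Module"
begin

section \<open>Modules over noncommutative rings\<close>

text \<open>
  The locale \<^locale>\<open>module\<close> requires a commutative ring of scalars. The following is the same
  notion over an arbitrary ring with identity. As for \<^locale>\<open>module\<close>, the multiplication and
  unit fields of the module record play no role.
\<close>

locale left_module = R?: ring R + M?: abelian_group M for R (structure) and M (structure) +
  assumes smult_closed [simp, intro]:
      "\<lbrakk>a \<in> carrier R; x \<in> carrier M\<rbrakk> \<Longrightarrow> a \<odot>\<^bsub>M\<^esub> x \<in> carrier M"
    and smult_l_distr:
      "\<lbrakk>a \<in> carrier R; b \<in> carrier R; x \<in> carrier M\<rbrakk> \<Longrightarrow>
        (a \<oplus> b) \<odot>\<^bsub>M\<^esub> x = a \<odot>\<^bsub>M\<^esub> x \<oplus>\<^bsub>M\<^esub> b \<odot>\<^bsub>M\<^esub> x"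
    and smult_r_distr:
      "\<lbrakk>a \<in> carrier R; x \<in> carrier M; y \<in> carrier M\<rbrakk> \<Longrightarrow>
        a \<odot>\<^bsub>M\<^esub> (x \<oplus>\<^bsub>M\<^esub> y) = a \<odot>\<^bsub>M\<^esub> x \<oplus>\<^bsub>M\<^esub> a \<odot>\<^bsub>M\<^esub> y"
    and smult_assoc1:
      "\<lbrakk>a \<in> carrier R; b \<in> carrier R; x \<in> carrier M\<rbrakk> \<Longrightarrow>
        (a \<otimes> b) \<odot>\<^bsub>M\<^esub> x = a \<odot>\<^bsub>M\<^esub> (b \<odot>\<^bsub>M\<^esub> x)"
    and smult_one [simp]:
      "x \<in> carrier M \<Longrightarrow> \<one> \<odot>\<^bsub>M\<^esub> x = x"

lemma module_iff_left_module: "module R M \<longleftrightarrow> cring R \<and> left_module R M"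
  unfolding module_def module_axioms_def left_module_def left_module_axioms_def
  by (auto dest: cring.axioms)

definition lmodule_hom ::
  "('a, 'm) ring_scheme \<Rightarrow> ('a, 'b, 'k) module_scheme \<Rightarrow> ('a, 'c, 'l) module_scheme \<Rightarrow> ('b \<Rightarrow> 'c) set"
  where "lmodule_hom R M N =
    {f \<in> carrier M \<rightarrow> carrier N.
      (\<forall>x\<in>carrier M. \<forall>y\<in>carrier M. f (x \<oplus>\<^bsub>M\<^esub> y) = f x \<oplus>\<^bsub>N\<^esub> f y) \<and>
      (\<forall>a\<in>carrier R. \<forall>x\<in>carrier M. f (a \<odot>\<^bsub>M\<^esub> x) = a \<odot>\<^bsub>N\<^esub> f x)}"

definition lmodule_auto :: "('a, 'm) ring_scheme \<Rightarrow> ('a, 'b, 'k) module_scheme \<Rightarrow> ('b \<Rightarrow> 'b) set"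
  where "lmodule_auto R M = {f \<in> lmodule_hom R M M. bij_betw f (carrier M) (carrier M)}"

text \<open>Right \<open>R\<close>-modules are the left modules over the opposite ring of \<open>R\<close>.\<close>

definition opposite_ring :: "('a, 'm) ring_scheme \<Rightarrow> ('a, 'm) ring_scheme"
  where "opposite_ring R = R\<lparr>mult := \<lambda>x y. y \<otimes>\<^bsub>R\<^esub> x\<rparr>"

definition regular_module :: "('a, 'm) ring_scheme \<Rightarrow> ('a, 'a) module"
  where "regular_module R =
    \<lparr>carrier = carrier R, mult = mult R, one = one R, zero = zero R, add = add R, smult = mult R\<rparr>"

lemma opposite_ring_simps [simp]:
  "carrier (opposite_ring R) = carrier R"
  "x \<otimes>\<^bsub>opposite_ring R\<^esub> y = y \<otimes>\<^bsub>R\<^esub> x"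
  "\<one>\<^bsub>opposite_ring R\<^esub> = \<one>\<^bsub>R\<^esub>"
  "\<zero>\<^bsub>opposite_ring R\<^esub> = \<zero>\<^bsub>R\<^esub>"
  "x \<oplus>\<^bsub>opposite_ring R\<^esub> y = x \<oplus>\<^bsub>R\<^esub> y"
  by (simp_all add: opposite_ring_def)

lemma regular_module_simps [simp]:
  "carrier (regular_module R) = carrier R"
  "\<zero>\<^bsub>regular_module R\<^esub> = \<zero>\<^bsub>R\<^esub>"
  "x \<oplus>\<^bsub>regular_module R\<^esub> y = x \<oplus>\<^bsub>R\<^esub> y"
  "a \<odot>\<^bsub>regular_module R\<^esub> x = a \<otimes>\<^bsub>R\<^esub> x"
  by (simp_all add: regular_module_def)

lemma (in ring) ring_opposite_ring: "ring (opposite_ring R)"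
proof (rule ringI)
  show "abelian_group (opposite_ring R)"
    by (rule abelian_groupI) (auto simp: a_ac intro: bexI[of _ "\<ominus> _"] l_neg)
  show "Group.monoid (opposite_ring R)"
    by (rule monoidI) (auto simp: m_assoc)
qed (auto simp: l_distr r_distr)

lemma (in ring) left_module_regular_module: "left_module R (regular_module R)"
proof (intro left_module.intro left_module_axioms.intro)
  show "abelian_group (regular_module R)"
    by (rule abelian_groupI) (auto simp: a_ac intro: bexI[of _ "\<ominus> _"] l_neg)
qed (auto simp: ring_axioms l_distr r_distr m_assoc)


section \<open>Chain conditions and injectivity\<close>

definition noetherian_module :: "('a, 'm) ring_scheme \<Rightarrow> ('a, 'b, 'k) module_scheme \<Rightarrow> bool"
  where "noetherian_module R M \<longleftrightarrow>
    (\<forall>N :: nat \<Rightarrow> 'b set.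
      (\<forall>i. submodule (N i) R M) \<and> (\<forall>i. N i \<subseteq> N (Suc i)) \<longrightarrow> (\<exists>k. \<forall>i\<ge>k. N i = N k))"

definition artinian_module :: "('a, 'm) ring_scheme \<Rightarrow> ('a, 'b, 'k) module_scheme \<Rightarrow> bool"
  where "artinian_module R M \<longleftrightarrow>
    (\<forall>N :: nat \<Rightarrow> 'b set.
      (\<forall>i. submodule (N i) R M) \<and> (\<forall>i. N (Suc i) \<subseteq> N i) \<longrightarrow> (\<exists>k. \<forall>i\<ge>k. N i = N k))"

text \<open>
  Injectivity of \<open>M\<close>: for every monomorphism \<open>j : A \<rightarrow> B\<close>, every homomorphism \<open>A \<rightarrow> M\<close> factors
  through \<open>j\<close>. A formula can only quantify over the modules \<open>A\<close> and \<open>B\<close> whose elements belong to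
  given types, so these types are parameters. In the conclusion of a theorem they should be
  arbitrary type variables, which gives the statement for all modules \<open>A\<close> and \<open>B\<close>.
\<close>

definition injective_module ::
  "'b itself \<Rightarrow> 'c itself \<Rightarrow> ('a, 'm) ring_scheme \<Rightarrow> ('a, 'd, 'k) module_scheme \<Rightarrow> bool"
  where "injective_module TA TB R M \<longleftrightarrow>
    left_module R M \<and>
    (\<forall>(A :: ('a, 'b) module) (B :: ('a, 'c) module) j f.
      left_module R A \<and> left_module R B \<and>
      j \<in> lmodule_hom R A B \<and> inj_on j (carrier A) \<and> f \<in> lmodule_hom R A M \<longrightarrow>
      (\<exists>h \<in> lmodule_hom R B M. \<forall>x\<in>carrier A. h (j x) = f x))"

definition left_noetherian :: "('a, 'm) ring_scheme \<Rightarrow> bool"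
  where "left_noetherian R \<longleftrightarrow> noetherian_module R (regular_module R)"

definition right_noetherian :: "('a, 'm) ring_scheme \<Rightarrow> bool"
  where "right_noetherian R \<longleftrightarrow> left_noetherian (opposite_ring R)"

definition left_artinian :: "('a, 'm) ring_scheme \<Rightarrow> bool"
  where "left_artinian R \<longleftrightarrow> artinian_module R (regular_module R)"

definition right_artinian :: "('a, 'm) ring_scheme \<Rightarrow> bool"
  where "right_artinian R \<longleftrightarrow> left_artinian (opposite_ring R)"

definition left_self_injective :: "'b itself \<Rightarrow> 'c itself \<Rightarrow> ('a, 'm) ring_scheme \<Rightarrow> bool"
  where "left_self_injective TA TB R \<longleftrightarrow> injective_module TA TB R (regular_module R)"

definition right_self_injective :: "'b itself \<Rightarrow> 'c itself \<Rightarrow> ('a, 'm) ring_scheme \<Rightarrow> bool"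
  where "right_self_injective TA TB R \<longleftrightarrow> left_self_injective TA TB (opposite_ring R)"

definition quasi_frobenius :: "'b itself \<Rightarrow> 'c itself \<Rightarrow> ('a, 'm) ring_scheme \<Rightarrow> bool"
  where "quasi_frobenius TA TB R \<longleftrightarrow>
    left_artinian R \<and> right_artinian R \<and>
    left_self_injective TA TB R \<and> right_self_injective TA TB R"


section \<open>Hamming weight and MacWilliams rings\<close>

text \<open>The left module \<open>R\<^sup>n\<close>; an \<open>n\<close>-tuple is an extensional function on \<open>{..<n}\<close>.\<close>

definition power_module :: "('a, 'm) ring_scheme \<Rightarrow> nat \<Rightarrow> ('a, nat \<Rightarrow> 'a) module"
  where "power_module R n =
    \<lparr>carrier = {..<n} \<rightarrow>\<^sub>E carrier R,
     mult = (\<lambda>x y. \<lambda>i\<in>{..<n}. x i \<otimes>\<^bsub>R\<^esub> y i),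
     one = (\<lambda>i\<in>{..<n}. \<one>\<^bsub>R\<^esub>),
     zero = (\<lambda>i\<in>{..<n}. \<zero>\<^bsub>R\<^esub>),
     add = (\<lambda>x y. \<lambda>i\<in>{..<n}. x i \<oplus>\<^bsub>R\<^esub> y i),
     smult = (\<lambda>a x. \<lambda>i\<in>{..<n}. a \<otimes>\<^bsub>R\<^esub> x i)\<rparr>"

lemma power_module_simps [simp]:
  "carrier (power_module R n) = {..<n} \<rightarrow>\<^sub>E carrier R"
  "\<zero>\<^bsub>power_module R n\<^esub> = (\<lambda>i\<in>{..<n}. \<zero>\<^bsub>R\<^esub>)"
  "x \<oplus>\<^bsub>power_module R n\<^esub> y = (\<lambda>i\<in>{..<n}. x i \<oplus>\<^bsub>R\<^esub> y i)"
  "a \<odot>\<^bsub>power_module R n\<^esub> x = (\<lambda>i\<in>{..<n}. a \<otimes>\<^bsub>R\<^esub> x i)"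
  by (simp_all add: power_module_def)

lemma (in ring) left_module_power_module: "left_module R (power_module R n)"
proof (intro left_module.intro left_module_axioms.intro)
  show "abelian_group (power_module R n)"
  proof (rule abelian_groupI)
    fix x assume x: "x \<in> carrier (power_module R n)"
    show "\<exists>y\<in>carrier (power_module R n). y \<oplus>\<^bsub>power_module R n\<^esub> x = \<zero>\<^bsub>power_module R n\<^esub>"
      by (rule bexI[of _ "\<lambda>i\<in>{..<n}. \<ominus> x i"])
        (use x in \<open>auto simp: PiE_iff l_neg intro!: restrict_ext\<close>)
  next
    fix x assume "x \<in> carrier (power_module R n)"
    then show "\<zero>\<^bsub>power_module R n\<^esub> \<oplus>\<^bsub>power_module R n\<^esub> x = x"
      by (intro ext) (auto simp: PiE_iff extensional_def)
  qed (auto simp: PiE_iff a_ac intro!: restrict_ext)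
next
  fix x assume "x \<in> carrier (power_module R n)"
  then show "\<one> \<odot>\<^bsub>power_module R n\<^esub> x = x"
    by (intro ext) (auto simp: PiE_iff extensional_def)
qed (auto simp: ring_axioms PiE_iff l_distr r_distr m_assoc intro!: restrict_ext)

definition hamming_weight :: "('a, 'm) ring_scheme \<Rightarrow> nat \<Rightarrow> (nat \<Rightarrow> 'a) \<Rightarrow> nat"
  where "hamming_weight R n x = card {i \<in> {..<n}. x i \<noteq> \<zero>\<^bsub>R\<^esub>}"

definition left_macwilliams :: "nat \<Rightarrow> ('a, 'm) ring_scheme \<Rightarrow> bool"
  where "left_macwilliams n R \<longleftrightarrow>
    (\<forall>L f.
      submodule L R (power_module R n) \<and>
      f \<in> lmodule_hom R ((power_module R n)\<lparr>carrier := L\<rparr>) (power_module R n) \<and>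
      (\<forall>x\<in>L. hamming_weight R n (f x) = hamming_weight R n x) \<longrightarrow>
      (\<exists>g \<in> lmodule_auto R (power_module R n). \<forall>x\<in>L. g x = f x))"

end

(*
  Let R be left 1-MacWilliams, so that every monomorphism from a left ideal to R is the right
  multiplication by a unit, and let Z be the left singular ideal. If C is a complement of the left
  annihilator of a, then a acts on C as a unit u, and a(1/u)a - a is singular; hence R/Z is regular.
  With a chain condition, R/Z is semisimple and Z is nilpotent, so R is semiprimary and artinian
  on one side.

  The dual Hom(S, R) of a simple left module S is zero or simple, since any two of its non-zero
  elements differ by a unit. As Z is in the radical, every simple right module is such a dual, and
  counting the isomorphism classes on both sides shows that duality is a bijection between them.
  With this bijection homomorphisms from semisimple left ideals to R extend to R: if f kills N and
  sends x to y, use an automorphism n + ax -> n + a(x + w) when N contains a copy Rw of Rx, and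
  otherwise separate Rx from N by its dual. Given any f on a left ideal I, subtract a multiplication
  that agrees with f on the socle; the identity plus the difference is then injective, hence extends.

  So R is left self-injective and all simple left modules embed into R. This makes all one-sided
  ideals annihilators, which exchanges the chain conditions of both sides and yields right
  self-injectivity.
*)
theory Submission
  imports Defs "HOL-Algebra.QuotRing" "HOL-Algebra.Multiplicative_Group"
begin

section \<open>Left ideals, annihilators and chain conditions\<close>

text \<open>The hypothesis speaks of monomorphisms, self-injectivity of arbitrary homomorphisms.
  Adding the identity bridges the gap only for a homomorphism that is controlled on the socle, and
  there lies the obstacle: a simple left module could have zero dual, and two non-isomorphic ones
  could have isomorphic duals. Singularity directly excludes only that a simple right module is
  missed. But the list \<open>es\<close> labels the simple modules of both sides by the same
  finitely many classes, so surjectivity implies bijectivity. As the side of the chain condition is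
  unspecified, its main use is in a symmetric form: the annihilator of a set is that of a finite
  subset. This follows from the minimum condition on one side or the maximum condition on the other,
  so both are collected on one side before any homomorphism is extended. Nilpotency of Z needs a
  separate argument for each side. The MacWilliams condition says nothing about right ideals; right
  self-injectivity rests on the annihilator identities of both sides and the maximum condition on
  right ideals.\<close>

definition left_ideal :: "('a, 'm) ring_scheme \<Rightarrow> 'a set \<Rightarrow> bool"
  where "left_ideal R I \<longleftrightarrow> I \<subseteq> carrier R \<and> \<zero>\<^bsub>R\<^esub> \<in> I \<and>
    (\<forall>x\<in>I. \<forall>y\<in>I. x \<oplus>\<^bsub>R\<^esub> y \<in> I) \<and> (\<forall>a\<in>carrier R. \<forall>x\<in>I. a \<otimes>\<^bsub>R\<^esub> x \<in> I)"

definition left_linear :: "('a, 'm) ring_scheme \<Rightarrow> 'a set \<Rightarrow> ('a \<Rightarrow> 'a) \<Rightarrow> bool"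
  where "left_linear R I f \<longleftrightarrow> (\<forall>x\<in>I. f x \<in> carrier R) \<and>
    (\<forall>x\<in>I. \<forall>y\<in>I. f (x \<oplus>\<^bsub>R\<^esub> y) = f x \<oplus>\<^bsub>R\<^esub> f y) \<and>
    (\<forall>a\<in>carrier R. \<forall>x\<in>I. f (a \<otimes>\<^bsub>R\<^esub> x) = a \<otimes>\<^bsub>R\<^esub> f x)"

definition lann :: "('a, 'm) ring_scheme \<Rightarrow> 'a set \<Rightarrow> 'a set"
  where "lann R X = {r \<in> carrier R. \<forall>x\<in>X. r \<otimes>\<^bsub>R\<^esub> x = \<zero>\<^bsub>R\<^esub>}"

definition rann :: "('a, 'm) ring_scheme \<Rightarrow> 'a set \<Rightarrow> 'a set"
  where "rann R X = {r \<in> carrier R. \<forall>x\<in>X. x \<otimes>\<^bsub>R\<^esub> r = \<zero>\<^bsub>R\<^esub>}"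

lemma lannD: "r \<in> lann R X \<Longrightarrow> x \<in> X \<Longrightarrow> r \<otimes>\<^bsub>R\<^esub> x = \<zero>\<^bsub>R\<^esub>"
  by (simp add: lann_def)

lemma lannI: "r \<in> carrier R \<Longrightarrow> (\<And>x. x \<in> X \<Longrightarrow> r \<otimes>\<^bsub>R\<^esub> x = \<zero>\<^bsub>R\<^esub>) \<Longrightarrow> r \<in> lann R X"
  by (simp add: lann_def)

lemma opposite_opposite_ring [simp]: "opposite_ring (opposite_ring R) = R"
  by (simp add: opposite_ring_def)

lemma opposite_ring_a_inv [simp]: "\<ominus>\<^bsub>opposite_ring R\<^esub> x = \<ominus>\<^bsub>R\<^esub> x"
  by (simp add: a_inv_def opposite_ring_def)

lemma opposite_ring_a_minus [simp]: "x \<ominus>\<^bsub>opposite_ring R\<^esub> y = x \<ominus>\<^bsub>R\<^esub> y"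
  by (simp add: a_minus_def)

lemma lann_opposite_ring [simp]: "lann (opposite_ring R) X = rann R X"
  by (simp add: lann_def rann_def)

lemma rann_opposite_ring [simp]: "rann (opposite_ring R) X = lann R X"
  by (simp add: lann_def rann_def)

lemma rann_antimono: "X \<subseteq> Y \<Longrightarrow> rann R Y \<subseteq> rann R X"
  by (auto simp: rann_def)

lemma lann_antimono: "X \<subseteq> Y \<Longrightarrow> lann R Y \<subseteq> lann R X"
  by (auto simp: lann_def)

lemma subset_rann_lann: "X \<subseteq> carrier R \<Longrightarrow> X \<subseteq> rann R (lann R X)"
  by (auto simp: lann_def rann_def)

lemma subset_lann_rann: "X \<subseteq> carrier R \<Longrightarrow> X \<subseteq> lann R (rann R X)"
  by (auto simp: lann_def rann_def)

lemma lann_rann_lann: "X \<subseteq> carrier R \<Longrightarrow> lann R (rann R (lann R X)) = lann R X"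
  by (auto simp: lann_def rann_def)

section \<open>Maximum and minimum conditions on left ideals\<close>

definition left_acc :: "('a, 'm) ring_scheme \<Rightarrow> bool"
  where "left_acc R \<longleftrightarrow>
    (\<forall>\<S>. \<S> \<noteq> {} \<and> (\<forall>I\<in>\<S>. left_ideal R I) \<longrightarrow> (\<exists>I\<in>\<S>. \<forall>K\<in>\<S>. I \<subseteq> K \<longrightarrow> K = I))"

definition left_dcc :: "('a, 'm) ring_scheme \<Rightarrow> bool"
  where "left_dcc R \<longleftrightarrow>
    (\<forall>\<S>. \<S> \<noteq> {} \<and> (\<forall>I\<in>\<S>. left_ideal R I) \<longrightarrow> (\<exists>I\<in>\<S>. \<forall>K\<in>\<S>. K \<subseteq> I \<longrightarrow> K = I))"

lemma left_accE:
  assumes "left_acc R" "P I" "\<And>I. P I \<Longrightarrow> left_ideal R I"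
  obtains I where "P I" "\<And>K. P K \<Longrightarrow> I \<subseteq> K \<Longrightarrow> K = I"
proof -
  have "Collect P \<noteq> {}" "\<forall>I\<in>Collect P. left_ideal R I" using assms by auto
  then obtain I where "I\<in>Collect P" "\<forall>K\<in>Collect P. I \<subseteq> K \<longrightarrow> K = I"
    using assms(1)[unfolded left_acc_def] by meson
  then show thesis using that by blast
qed

lemma left_dccE:
  assumes "left_dcc R" "P I" "\<And>I. P I \<Longrightarrow> left_ideal R I"
  obtains I where "P I" "\<And>K. P K \<Longrightarrow> K \<subseteq> I \<Longrightarrow> K = I"
proof -
  have "Collect P \<noteq> {}" "\<forall>I\<in>Collect P. left_ideal R I" using assms by auto
  then obtain I where "I\<in>Collect P" "\<forall>K\<in>Collect P. K \<subseteq> I \<longrightarrow> K = I"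
    using assms(1)[unfolded left_dcc_def] by meson
  then show thesis using that by blast
qed

context ring
begin

lemma left_idealD:
  assumes "left_ideal R I"
  shows "\<And>x. x \<in> I \<Longrightarrow> x \<in> carrier R" "\<zero> \<in> I" "\<And>x y. x \<in> I \<Longrightarrow> y \<in> I \<Longrightarrow> x \<oplus> y \<in> I"
    "\<And>a x. a \<in> carrier R \<Longrightarrow> x \<in> I \<Longrightarrow> a \<otimes> x \<in> I"
    "\<And>x. x \<in> I \<Longrightarrow> \<ominus> x \<in> I" "\<And>x y. x \<in> I \<Longrightarrow> y \<in> I \<Longrightarrow> x \<ominus> y \<in> I"
proof -
  show 1: "\<And>x. x \<in> I \<Longrightarrow> x \<in> carrier R" and "\<zero> \<in> I" and 3: "\<And>x y. x \<in> I \<Longrightarrow> y \<in> I \<Longrightarrow> x \<oplus> y \<in> I"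
    and 4: "\<And>a x. a \<in> carrier R \<Longrightarrow> x \<in> I \<Longrightarrow> a \<otimes> x \<in> I"
    using assms by (auto simp: left_ideal_def)
  show 5: "\<ominus> x \<in> I" if "x \<in> I" for x
    using 4[of "\<ominus> \<one>" x] 1[OF that] that by (simp add: l_minus)
  show "\<And>x y. x \<in> I \<Longrightarrow> y \<in> I \<Longrightarrow> x \<ominus> y \<in> I" using 3 5 by (simp add: minus_eq)
qed

lemma left_ideal_iff_submodule: "left_ideal R I \<longleftrightarrow> submodule I R (regular_module R)"
proof
  interpret M: left_module R "regular_module R" by (rule left_module_regular_module)
  have minus: "\<ominus>\<^bsub>regular_module R\<^esub> x = \<ominus> x" for x
    by (simp add: a_inv_def m_inv_def regular_module_def)
  show "submodule I R (regular_module R)" if I: "left_ideal R I"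
  proof (intro submodule.intro submodule_axioms.intro)
    show "subgroup I (add_monoid (regular_module R))"
      by (rule M.add.subgroupI)
        (use left_idealD[OF I] minus in \<open>auto simp flip: a_inv_def\<close>)
  qed (use left_idealD[OF I] in auto)
  assume "submodule I R (regular_module R)"
  then interpret submodule I R "regular_module R" .
  show "left_ideal R I"
    unfolding left_ideal_def using subset one_closed m_closed smult_closed by auto
qed

lemma left_noetherian_imp_acc: "left_noetherian R \<Longrightarrow> left_acc R"
  unfolding left_acc_def
proof (intro allI impI, elim conjE)
  fix \<S> assume noeth: "left_noetherian R" and ne: "\<S> \<noteq> {}" and id: "\<forall>I\<in>\<S>. left_ideal R I"
  let ?r = "{(K, I). K \<in> \<S> \<and> I \<in> \<S> \<and> I \<subset> K}"
  have "wf ?r"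
    unfolding wf_iff_no_infinite_down_chain
  proof clarify
    fix N assume N: "\<forall>i. (N (Suc i), N i) \<in> ?r"
    then have "(\<forall>i. submodule (N i) R (regular_module R)) \<and> (\<forall>i. N i \<subseteq> N (Suc i))"
      using id by (auto simp: left_ideal_iff_submodule)
    then obtain k where k: "\<forall>i\<ge>k. N i = N k"
      using noeth unfolding left_noetherian_def noetherian_module_def by meson
    have "N (Suc k) = N k" by (rule k[rule_format]) simp
    moreover have "N k \<subset> N (Suc k)" using N by simp
    ultimately show False by simp
  qed
  then obtain I where "I \<in> \<S>" "\<And>K. (K, I) \<in> ?r \<Longrightarrow> K \<notin> \<S>"
    by (rule wfE_min'[OF _ ne]) blast
  then show "\<exists>I\<in>\<S>. \<forall>K\<in>\<S>. I \<subseteq> K \<longrightarrow> K = I" by blast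
qed

lemma left_dcc_imp_artinian: "left_dcc R \<Longrightarrow> left_artinian R"
  unfolding left_artinian_def artinian_module_def left_ideal_iff_submodule[symmetric]
proof (intro allI impI, elim conjE)
  fix N :: "nat \<Rightarrow> 'a set"
  assume dcc: "left_dcc R" and id: "\<forall>i. left_ideal R (N i)" and N: "\<forall>i. N (Suc i) \<subseteq> N i"
  obtain I where I: "I \<in> range N" "\<And>K. K \<in> range N \<Longrightarrow> K \<subseteq> I \<Longrightarrow> K = I"
    using left_dccE[OF dcc, of "\<lambda>I. I \<in> range N" "N 0"] id by auto
  then obtain k where "I = N k" by auto
  moreover have "N i \<subseteq> N k" if "i \<ge> k" for i
    by (rule lift_Suc_antimono_le[of N, OF _ that]) (rule N[rule_format])
  ultimately show "\<exists>k. \<forall>i\<ge>k. N i = N k" using I(2)[OF rangeI] by (intro exI[of _ k]) simp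
qed

lemma left_ideal_lann: "X \<subseteq> carrier R \<Longrightarrow> left_ideal R (lann R X)"
  by (auto simp: left_ideal_def lann_def l_distr m_assoc subset_iff)

text \<open>Right ideals appear throughout as left ideals of \<open>opposite_ring R\<close>, so that
  each one-sided result serves both sides.\<close>

lemma left_ideal_opposite_rann: "X \<subseteq> carrier R \<Longrightarrow> left_ideal (opposite_ring R) (rann R X)"
  by (auto simp: left_ideal_def rann_def r_distr m_assoc[symmetric] subset_iff)

lemma left_ideal_transporter:
  "left_ideal R I \<Longrightarrow> y \<in> carrier R \<Longrightarrow> left_ideal R {x \<in> carrier R. x \<otimes> y \<in> I}"
  by (auto simp: left_ideal_def l_distr m_assoc)

lemma left_ideal_add_principal:
  assumes "left_ideal R I" "y \<in> carrier R"
  shows "left_ideal R {n \<oplus> a \<otimes> y | n a. n \<in> I \<and> a \<in> carrier R}"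
  unfolding left_ideal_def
proof (intro conjI subsetI ballI)
  note I = left_idealD[OF assms(1)]
  show "x \<in> carrier R" if "x \<in> {n \<oplus> a \<otimes> y | n a. n \<in> I \<and> a \<in> carrier R}" for x
    using that assms(2) I by auto
  show "\<zero> \<in> {n \<oplus> a \<otimes> y | n a. n \<in> I \<and> a \<in> carrier R}"
    using I assms(2) by (force intro!: exI[of _ \<zero>])
  fix x assume "x \<in> {n \<oplus> a \<otimes> y | n a. n \<in> I \<and> a \<in> carrier R}"
  then obtain n a where x: "x = n \<oplus> a \<otimes> y" "n \<in> I" "a \<in> carrier R" by auto
  show "b \<otimes> x \<in> {n \<oplus> a \<otimes> y | n a. n \<in> I \<and> a \<in> carrier R}" if "b \<in> carrier R" for b
  proof -
    have "b \<otimes> x = b \<otimes> n \<oplus> (b \<otimes> a) \<otimes> y"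
      using x that I(1) assms(2) by algebra
    then show ?thesis using that x I(4) by blast
  qed
  fix x' assume "x' \<in> {n \<oplus> a \<otimes> y | n a. n \<in> I \<and> a \<in> carrier R}"
  then obtain n' a' where x': "x' = n' \<oplus> a' \<otimes> y" "n' \<in> I" "a' \<in> carrier R" by auto
  have "x \<oplus> x' = (n \<oplus> n') \<oplus> (a \<oplus> a') \<otimes> y"
    using x x' I(1) assms(2) by algebra
  then show "x \<oplus> x' \<in> {n \<oplus> a \<otimes> y | n a. n \<in> I \<and> a \<in> carrier R}"
    using x x' I by blast
qed

lemma left_linearD:
  assumes "left_linear R I f" "left_ideal R I"
  shows "\<And>x. x \<in> I \<Longrightarrow> f x \<in> carrier R" "\<And>x y. x \<in> I \<Longrightarrow> y \<in> I \<Longrightarrow> f (x \<oplus> y) = f x \<oplus> f y"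
    "\<And>a x. a \<in> carrier R \<Longrightarrow> x \<in> I \<Longrightarrow> f (a \<otimes> x) = a \<otimes> f x" "f \<zero> = \<zero>"
    "\<And>x y. x \<in> I \<Longrightarrow> y \<in> I \<Longrightarrow> f (x \<ominus> y) = f x \<ominus> f y"
proof -
  note I = left_idealD[OF assms(2)]
  show 1: "\<And>x. x \<in> I \<Longrightarrow> f x \<in> carrier R"
    and 2: "\<And>x y. x \<in> I \<Longrightarrow> y \<in> I \<Longrightarrow> f (x \<oplus> y) = f x \<oplus> f y"
    and 3: "\<And>a x. a \<in> carrier R \<Longrightarrow> x \<in> I \<Longrightarrow> f (a \<otimes> x) = a \<otimes> f x"
    using assms by (auto simp: left_linear_def)
  show "f \<zero> = \<zero>" using 3[of \<zero> \<zero>] I(2) 1 by simp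
  have 4: "f (\<ominus> x) = \<ominus> f x" if "x \<in> I" for x
    using 3[of "\<ominus> \<one>" x] that I(1) 1 by (simp add: l_minus)
  show "f (x \<ominus> y) = f x \<ominus> f y" if "x \<in> I" "y \<in> I" for x y
    using 2[of x "\<ominus> y"] 4 that I by (simp add: minus_eq)
qed

lemma left_ideal_kernel:
  assumes "left_linear R I f" "left_ideal R I"
  shows "left_ideal R {x \<in> I. f x = \<zero>}"
  using left_linearD[OF assms] left_idealD[OF assms(2)] by (auto simp: left_ideal_def)

lemma left_linear_diff_mult:
  assumes "left_linear R I f" "left_ideal R I" "r \<in> carrier R"
  shows "left_linear R I (\<lambda>x. f x \<ominus> x \<otimes> r)"
  unfolding left_linear_def
proof (intro conjI ballI)
  note f = left_linearD[OF assms(1,2)] and I = left_idealD[OF assms(2)]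
  show "f x \<ominus> x \<otimes> r \<in> carrier R" if "x \<in> I" for x using that f I assms by auto
  show "f (x \<oplus> y) \<ominus> (x \<oplus> y) \<otimes> r = (f x \<ominus> x \<otimes> r) \<oplus> (f y \<ominus> y \<otimes> r)" if "x \<in> I" "y \<in> I" for x y
    unfolding f(2)[OF that] using that f(1)[OF that(1)] f(1)[OF that(2)] I(1)[OF that(1)] I(1)[OF that(2)] assms(3) by algebra
  show "f (a \<otimes> x) \<ominus> (a \<otimes> x) \<otimes> r = a \<otimes> (f x \<ominus> x \<otimes> r)" if "a \<in> carrier R" "x \<in> I" for a x
    unfolding f(3)[OF that] using that f(1)[OF that(2)] I(1)[OF that(2)] assms(3) by algebra
qed

text \<open>Homomorphisms from left ideals are mostly defined through their graphs, which are
  submodules of \<open>R\<^sup>2\<close>.\<close>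

definition linear_graph :: "('a \<times> 'a) set \<Rightarrow> bool"
  where "linear_graph G \<longleftrightarrow> G \<subseteq> carrier R \<times> carrier R \<and> (\<zero>, \<zero>) \<in> G \<and>
    (\<forall>x v y w. (x, v) \<in> G \<longrightarrow> (y, w) \<in> G \<longrightarrow> (x \<oplus> y, v \<oplus> w) \<in> G) \<and>
    (\<forall>a\<in>carrier R. \<forall>x v. (x, v) \<in> G \<longrightarrow> (a \<otimes> x, a \<otimes> v) \<in> G)"

text \<open>Two values over the same \<open>x\<close> differ by a value over \<open>\<zero>\<close>.
  Hence a trivial fibre over \<open>\<zero>\<close> is all that has to be checked when a
  homomorphism is given by its graph.\<close>

lemma linear_graph_fun:
  assumes G: "linear_graph G" and z: "\<And>v. (\<zero>, v) \<in> G \<Longrightarrow> v = \<zero>"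
  obtains f where "left_ideal R (Domain G)" "left_linear R (Domain G) f"
    "\<And>x v. (x, v) \<in> G \<Longrightarrow> f x = v"
proof -
  have car: "x \<in> carrier R" "v \<in> carrier R" if "(x, v) \<in> G" for x v
    using G that by (auto simp: linear_graph_def)
  have add: "(x \<oplus> y, v \<oplus> w) \<in> G" if "(x, v) \<in> G" "(y, w) \<in> G" for x v y w
    using G that by (auto simp: linear_graph_def)
  have smult: "(a \<otimes> x, a \<otimes> v) \<in> G" if "(x, v) \<in> G" "a \<in> carrier R" for x v a
    using G that by (auto simp: linear_graph_def)
  have zero: "(\<zero>, \<zero>) \<in> G" using G by (auto simp: linear_graph_def)
  have uniq: "v = w" if "(x, v) \<in> G" "(x, w) \<in> G" for x v w
  proof -
    have "(x \<oplus> \<ominus> \<one> \<otimes> x, v \<oplus> \<ominus> \<one> \<otimes> w) \<in> G" using add smult that by auto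
    then have "(\<zero>, v \<ominus> w) \<in> G" using car that by (simp add: l_minus minus_eq r_neg)
    then show "v = w" using z[of "v \<ominus> w"] car that by simp
  qed
  define f where "f x = (THE v. (x, v) \<in> G)" for x
  have f: "f x = v" if "(x, v) \<in> G" for x v
    unfolding f_def using that uniq by blast
  have 1: "left_ideal R (Domain G)"
    unfolding left_ideal_def
    by (intro conjI ballI subsetI; (elim DomainE)?) (blast intro: car add smult zero)+
  have 2: "left_linear R (Domain G) f"
    unfolding left_linear_def
  proof (intro conjI ballI; elim DomainE)
    fix x v assume 1: "(x, v) \<in> G"
    show "f x \<in> carrier R" using f[OF 1] car[OF 1] by simp
    show "f (a \<otimes> x) = a \<otimes> f x" if "a \<in> carrier R" for a
      using f[OF 1] f[OF smult[OF 1 that]] by simp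
    fix y w assume 2: "(y, w) \<in> G"
    show "f (x \<oplus> y) = f x \<oplus> f y" using f[OF 1] f[OF 2] f[OF add[OF 1 2]] by simp
  qed
  show thesis by (rule that[OF 1 2 f])
qed

text \<open>Every chain \<open>I \<subseteq> D \<subseteq> I + Ry\<close> is trivial if \<open>(I : y)\<close> is maximal; this forces the
  chain condition to pass from \<open>R/(I + Ry)\<close> to \<open>R/I\<close>.\<close>

lemma acc_imp_artinian:
  assumes acc: "left_acc R"
    and cover: "\<And>I. left_ideal R I \<Longrightarrow> I \<noteq> carrier R \<Longrightarrow>
      \<exists>y\<in>carrier R - I. \<forall>x\<in>carrier R. x \<otimes> y \<notin> I \<longrightarrow> (\<exists>s\<in>carrier R. (\<one> \<ominus> s \<otimes> x) \<otimes> y \<in> I)"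
  shows "left_artinian R"
proof (rule ccontr)
  \<comment> \<open>\<open>bad B\<close> says that R/B is not artinian. For a maximal such B and the
    y supplied by \<open>cover\<close>, R/(B + Ry) is artinian.\<close>
  define bad where "bad B \<longleftrightarrow> left_ideal R B \<and> (\<exists>N::nat \<Rightarrow> 'a set. (\<forall>i. left_ideal R (N i)) \<and>
    (\<forall>i. N (Suc i) \<subseteq> N i) \<and> (\<forall>i. B \<subseteq> N i) \<and> (\<nexists>k. \<forall>i\<ge>k. N i = N k))" for B
  assume "\<not> left_artinian R"
  then have "bad {\<zero>}"
    unfolding left_artinian_def artinian_module_def left_ideal_iff_submodule[symmetric] bad_def
    by (auto simp: left_ideal_def[of _ "{\<zero>}"] dest: left_idealD(2))
  then obtain B where B: "bad B" and max: "\<And>K. bad K \<Longrightarrow> B \<subseteq> K \<Longrightarrow> K = B"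
    by (rule left_accE[OF acc]) (auto simp: bad_def)
  then obtain N where lB: "left_ideal R B" and N: "\<And>i. left_ideal R (N i)" "\<And>i. N (Suc i) \<subseteq> N i"
    "\<And>i. B \<subseteq> N i" "\<nexists>k. \<forall>i\<ge>k. N i = N k"
    unfolding bad_def by blast
  note B' = left_idealD[OF lB]
  have "B \<noteq> carrier R"
  proof
    assume "B = carrier R"
    then have "N i = carrier R" for i using N(3)[of i] left_idealD(1)[OF N(1)[of i]] by blast
    then show False using N(4) by simp
  qed
  then obtain y where y: "y \<in> carrier R" "y \<notin> B"
    and ymax: "\<And>x. x\<in>carrier R \<Longrightarrow> x \<otimes> y \<notin> B \<Longrightarrow> \<exists>s\<in>carrier R. (\<one> \<ominus> s \<otimes> x) \<otimes> y \<in> B"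
    using cover[OF lB] by blast
  define C where "C K = {n \<oplus> a \<otimes> y | n a. n \<in> K \<and> a \<in> carrier R}" for K
  have C: "left_ideal R (C K)" if "left_ideal R K" for K
    unfolding C_def using left_ideal_add_principal that y by blast
  have CI: "n \<oplus> a \<otimes> y \<in> C K" if "n \<in> K" "a \<in> carrier R" for n a K
    unfolding C_def using that by blast
  have subC: "K \<subseteq> C K" if "left_ideal R K" for K
    using CI[of _ K \<zero>] y left_idealD(1)[OF that] by auto
  have "y \<in> C B" using CI[of \<zero> B \<one>] B'(2) y by auto
  then have nbad: "\<not> bad (C B)" using max subC[OF lB] y by blast
  have Cmono: "C K \<subseteq> C L" if "K \<subseteq> L" for K L using that unfolding C_def by blast
  have "\<exists>k. \<forall>i\<ge>k. C (N i) = C (N k)"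
  proof (rule ccontr)
    assume "\<not> ?thesis"
    then have "bad (C B)"
      unfolding bad_def using C[OF lB] C[OF N(1)] Cmono[OF N(2)] Cmono[OF N(3)]
      by (intro conjI exI[of _ "\<lambda>i. C (N i)"] allI)
    then show False using nbad by simp
  qed
  then obtain k where k: "\<And>i. i \<ge> k \<Longrightarrow> C (N i) = C (N k)" by blast
  have anti: "N j \<subseteq> N i" if "i \<le> j" for i j using N(2) that by (rule lift_Suc_antimono_le)
  \<comment> \<open>Membership of y in the decreasing chain is constant from some m on. Terms with
    the same sum with Ry can differ only in multiples ay outside B; from such a multiple y is
    recovered modulo B, so y itself would have to leave the chain.\<close>
  obtain m where m: "m \<ge> k" "\<And>i. i \<ge> m \<Longrightarrow> (y \<in> N i \<longleftrightarrow> y \<in> N m)"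
  proof (cases "\<exists>m\<ge>k. y \<notin> N m")
    case True
    then obtain m where "m \<ge> k" "y \<notin> N m" by blast
    then show thesis using that[of m] anti[of m] by blast
  next
    case False then show thesis using that[of k] by auto
  qed
  have "N i = N m" if i: "i \<ge> m" for i
  proof
    show "N i \<subseteq> N m" using anti i .
    note Ni = left_idealD[OF N(1)[of i]] and Nm = left_idealD[OF N(1)[of m]]
    show "N m \<subseteq> N i"
    proof (rule subsetI)
      fix z assume z: "z \<in> N m"
      then have "z \<in> C (N i)" using k[of i] k[of m] m(1) i subC[OF N(1)[of m]] by auto
      then obtain n a where na: "z = n \<oplus> a \<otimes> y" "n \<in> N i" "a \<in> carrier R" unfolding C_def by blast
      have nm: "n \<in> N m" using na(2) anti[OF i] by blast
      have "a \<otimes> y = z \<ominus> n" using na Ni(1)[OF na(2)] y(1) by algebra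
      then have ay: "a \<otimes> y \<in> N m" using Nm(6)[OF z nm] by simp
      have "a \<otimes> y \<in> N i"
      proof (cases "a \<otimes> y \<in> B")
        case False
        then obtain s where s: "s \<in> carrier R" "(\<one> \<ominus> s \<otimes> a) \<otimes> y \<in> B" using ymax na by blast
        have "y = (\<one> \<ominus> s \<otimes> a) \<otimes> y \<oplus> s \<otimes> (a \<otimes> y)" using s y na(3) by algebra
        moreover have "\<dots> \<in> N m" using Nm(3)[OF _ Nm(4)[OF s(1) ay]] s(2) N(3)[of m] by auto
        ultimately have "y \<in> N m" by simp
        then have "y \<in> N i" using m(2)[OF i] by simp
        then show ?thesis using Ni(4)[OF na(3)] by simp
      qed (use N(3)[of i] in blast)
      then show "z \<in> N i" unfolding na(1) by (rule Ni(3)[OF na(2)])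
    qed
  qed
  then show False using N(4) by blast
qed

end

section \<open>Idempotents and semiprimary rings\<close>

definition idempotent :: "('a, 'm) ring_scheme \<Rightarrow> 'a \<Rightarrow> bool"
  where "idempotent R e \<longleftrightarrow> e \<in> carrier R \<and> e \<otimes>\<^bsub>R\<^esub> e = e"

definition primitive_idempotent :: "('a, 'm) ring_scheme \<Rightarrow> 'a \<Rightarrow> bool"
  where "primitive_idempotent R e \<longleftrightarrow> idempotent R e \<and> e \<noteq> \<zero>\<^bsub>R\<^esub> \<and>
    (\<forall>f. idempotent R f \<and> e \<otimes>\<^bsub>R\<^esub> f = f \<and> f \<otimes>\<^bsub>R\<^esub> e = f \<longrightarrow> f = \<zero>\<^bsub>R\<^esub> \<or> f = e)"

text \<open>Regularity in the sense of von Neumann.\<close>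

definition regular_ring :: "('a, 'm) ring_scheme \<Rightarrow> bool"
  where "regular_ring R \<longleftrightarrow>
    (\<forall>a\<in>carrier R. \<exists>b\<in>carrier R. a \<otimes>\<^bsub>R\<^esub> b \<otimes>\<^bsub>R\<^esub> a = a)"

lemma idempotent_opposite [simp]: "idempotent (opposite_ring R) e \<longleftrightarrow> idempotent R e"
  by (simp add: idempotent_def)

lemma primitive_idempotent_opposite [simp]:
  "primitive_idempotent (opposite_ring R) e \<longleftrightarrow> primitive_idempotent R e"
  by (auto simp: primitive_idempotent_def)

lemma (in ring) regular_ring_opposite: "regular_ring R \<Longrightarrow> regular_ring (opposite_ring R)"
  by (simp add: regular_ring_def m_assoc)

section \<open>Idempotents in rings with a one-sided chain condition\<close>

context ring
begin

text \<open>The left ideal \<open>S e\<close> is Re. If e lies below f and Re = Rf, then f = fe = e,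
  so the maximum condition on left ideals passes to the natural order of the idempotents.\<close>

lemma idempotent_max_aux:
  assumes "left_acc R" "P e0" "\<And>e. P e \<Longrightarrow> idempotent R e"
  shows "\<exists>e. P e \<and> (\<forall>f. P f \<and> e \<otimes> f = e \<and> f \<otimes> e = e \<longrightarrow> f = e)"
proof -
  define S where "S e = {x \<in> carrier R. x \<otimes> e = x}" for e
  have E: "e \<in> carrier R" "e \<otimes> e = e" if "P e" for e using assms(3)[OF that] by (auto simp: idempotent_def)
  have "left_ideal R (S e)" if "P e" for e
    using E[OF that] by (auto simp: left_ideal_def S_def l_distr m_assoc)
  then have S: "left_ideal R I" if "\<exists>e. P e \<and> I = S e" for I using that by blast
  have "\<exists>e. P e \<and> S e0 = S e" using assms(2) by blast
  then obtain I where I: "\<exists>e. P e \<and> I = S e" and max: "\<And>K. \<exists>e. P e \<and> K = S e \<Longrightarrow> I \<subseteq> K \<Longrightarrow> K = I"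
    using left_accE[where P = "\<lambda>I. \<exists>e. P e \<and> I = S e" and I = "S e0", OF assms(1) _ S] by metis
  from I obtain e where e: "P e" "I = S e" by blast
  have "f = e" if f: "P f" "e \<otimes> f = e" "f \<otimes> e = e" for f
  proof -
    have "S e \<subseteq> S f"
    proof
      fix x assume "x \<in> S e"
      then have x: "x \<in> carrier R" "x \<otimes> e = x" by (auto simp: S_def)
      then have "x \<otimes> f = (x \<otimes> e) \<otimes> f" by simp
      also have "\<dots> = x \<otimes> (e \<otimes> f)" using x E[OF e(1)] E[OF f(1)] by (intro m_assoc) auto
      also have "\<dots> = x" using x f(2) by simp
      finally show "x \<in> S f" using x by (simp add: S_def)
    qed
    then have "S f = S e" using max[of "S f"] f(1) e by blast
    moreover have "f \<in> S f" using E[OF f(1)] by (simp add: S_def)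
    ultimately show "f = e" using f(3) by (simp add: S_def)
  qed
  then show ?thesis using e(1) by blast
qed

text \<open>Idempotents and their order are the same in the opposite ring, so the side of the chain
  condition is irrelevant here.\<close>

lemma idempotent_max:
  assumes "left_acc R \<or> left_acc (opposite_ring R)" "P e0" "\<And>e. P e \<Longrightarrow> idempotent R e"
  obtains e where "P e" "\<And>f. P f \<Longrightarrow> e \<otimes> f = e \<Longrightarrow> f \<otimes> e = e \<Longrightarrow> f = e"
proof -
  have "\<exists>e. P e \<and> (\<forall>f. P f \<and> e \<otimes> f = e \<and> f \<otimes> e = e \<longrightarrow> f = e)"
    using assms(1)
  proof
    assume "left_acc (opposite_ring R)"
    from ring.idempotent_max_aux[OF ring_opposite_ring this, of P e0] assms(2,3)
    show ?thesis by auto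
  qed (rule idempotent_max_aux, use assms in auto)
  then show thesis using that by blast
qed

lemma idempotent_complement: "idempotent R e \<Longrightarrow> idempotent R (\<one> \<ominus> e)"
  unfolding idempotent_def
proof safe
  assume e: "e \<in> carrier R" "e \<otimes> e = e"
  have "(\<one> \<ominus> e) \<otimes> (\<one> \<ominus> e) = \<one> \<ominus> e \<ominus> e \<oplus> e \<otimes> e" using e(1) by (simp add: ring_simprules)
  also have "\<dots> = \<one> \<ominus> e" unfolding e(2) using e(1) by algebra
  finally show "(\<one> \<ominus> e) \<otimes> (\<one> \<ominus> e) = \<one> \<ominus> e" .
qed simp

text \<open>Passing to the complement \<open>\<one> \<ominus> e\<close> reverses the order, which
  turns maximal idempotents into minimal ones.\<close>

lemma idempotent_min:
  assumes "left_acc R \<or> left_acc (opposite_ring R)" "P e0" "\<And>e. P e \<Longrightarrow> idempotent R e"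
  obtains e where "P e" "\<And>f. P f \<Longrightarrow> e \<otimes> f = f \<Longrightarrow> f \<otimes> e = f \<Longrightarrow> f = e"
proof -
  have c: "\<one> \<ominus> (\<one> \<ominus> e) = e" if "e \<in> carrier R" for e using that by algebra
  have P: "e \<in> carrier R" if "P e" for e using assms(3)[OF that] by (simp add: idempotent_def)
  have "\<exists>e'. P e' \<and> \<one> \<ominus> e0 = \<one> \<ominus> e'" using assms(2) by blast
  moreover have "idempotent R g" if "\<exists>e. P e \<and> g = \<one> \<ominus> e" for g
    using that idempotent_complement[OF assms(3)] by blast
  ultimately obtain g where g: "\<exists>e. P e \<and> g = \<one> \<ominus> e"
    and max: "\<And>h. \<exists>e. P e \<and> h = \<one> \<ominus> e \<Longrightarrow> g \<otimes> h = g \<Longrightarrow> h \<otimes> g = g \<Longrightarrow> h = g"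
    using idempotent_max[where P = "\<lambda>g. \<exists>e. P e \<and> g = \<one> \<ominus> e" and ?e0.0 = "\<one> \<ominus> e0", OF assms(1)] by metis
  from g obtain e where e: "P e" "g = \<one> \<ominus> e" by blast
  show thesis
  proof (rule that[OF e(1)])
    fix f assume f: "P f" "e \<otimes> f = f" "f \<otimes> e = f"
    have ce: "e \<in> carrier R" and cf: "f \<in> carrier R" using P e f by auto
    have "g \<otimes> (\<one> \<ominus> f) = \<one> \<ominus> e \<ominus> f \<oplus> e \<otimes> f" unfolding e(2) using ce cf by (simp add: ring_simprules)
    also have "\<dots> = g" unfolding f(2) e(2) using ce cf by algebra
    finally have 1: "g \<otimes> (\<one> \<ominus> f) = g" .
    have "(\<one> \<ominus> f) \<otimes> g = \<one> \<ominus> e \<ominus> f \<oplus> f \<otimes> e" unfolding e(2) using ce cf by (simp add: ring_simprules)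
    also have "\<dots> = g" unfolding f(3) e(2) using ce cf by algebra
    finally have 2: "(\<one> \<ominus> f) \<otimes> g = g" .
    have "\<exists>e. P e \<and> \<one> \<ominus> f = \<one> \<ominus> e" by (rule exI[of _ f]) (simp add: f(1))
    then have "\<one> \<ominus> f = g" using max 1 2 by metis
    then have "f = \<one> \<ominus> g" using c[OF cf] by metis
    then show "f = e" unfolding e(2) c[OF ce] .
  qed
qed

text \<open>This is the minimality of Re. If b is a quasi-inverse of xe, then f = bxe is idempotent
  with fe = f, and ef is an idempotent below e. It is non-zero because f(ef) = f, so it equals e by
  primitivity, and eb is the required factor.\<close>

lemma primitive_idempotent_left_minimal:
  assumes reg: "regular_ring R" and e: "primitive_idempotent R e" and x: "x \<in> carrier R" "x \<otimes> e \<noteq> \<zero>"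
  shows "\<exists>y\<in>carrier R. y \<otimes> x \<otimes> e = e"
proof -
  have ce: "e \<in> carrier R" "e \<otimes> e = e" using e by (auto simp: primitive_idempotent_def idempotent_def)
  obtain b where b: "b \<in> carrier R" "(x \<otimes> e) \<otimes> b \<otimes> (x \<otimes> e) = x \<otimes> e"
    using reg x(1) ce(1) unfolding regular_ring_def by (meson m_closed)
  define f where "f = b \<otimes> (x \<otimes> e)"
  have cf: "f \<in> carrier R" using b x ce by (simp add: f_def)
  have fe: "f \<otimes> e = f" using b(1) x ce by (simp add: f_def m_assoc)
  have "f \<otimes> f = b \<otimes> ((x \<otimes> e) \<otimes> b \<otimes> (x \<otimes> e))"
    unfolding f_def using b(1) x(1) ce(1) by algebra
  then have ff: "f \<otimes> f = f" unfolding b(2) f_def .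
  have fef: "f \<otimes> (e \<otimes> f) = f" using fe ff cf ce(1) by (metis m_assoc)
  have f0: "f \<noteq> \<zero>"
  proof
    assume "f = \<zero>"
    then have "(x \<otimes> e) \<otimes> f = \<zero>" using x ce by simp
    then show False using b x ce by (simp add: f_def m_assoc)
  qed
  have "idempotent R (e \<otimes> f)"
    unfolding idempotent_def using fef cf ce(1) by (metis m_assoc m_closed)
  moreover have "e \<otimes> (e \<otimes> f) = e \<otimes> f" using ce cf by (metis m_assoc)
  moreover have "(e \<otimes> f) \<otimes> e = e \<otimes> f" using fe ce cf by (metis m_assoc)
  ultimately have "e \<otimes> f = \<zero> \<or> e \<otimes> f = e" using e unfolding primitive_idempotent_def by blast
  moreover have "e \<otimes> f \<noteq> \<zero>" using fef f0 cf by auto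
  ultimately have "e \<otimes> f = e" by blast
  then have "(e \<otimes> b) \<otimes> x \<otimes> e = e" unfolding f_def using ce(1) b(1) x(1) by (simp add: m_assoc)
  then show ?thesis using ce b by blast
qed

lemma primitive_idempotent_right_minimal:
  assumes "regular_ring R" "primitive_idempotent R e" "x \<in> carrier R" "e \<otimes> x \<noteq> \<zero>"
  shows "\<exists>y\<in>carrier R. e \<otimes> x \<otimes> y = e"
proof -
  have "e \<in> carrier R" using assms by (auto simp: primitive_idempotent_def idempotent_def)
  then show ?thesis
    using ring.primitive_idempotent_left_minimal[OF ring_opposite_ring regular_ring_opposite, of e x] assms
    by (auto simp: m_assoc)
qed

lemma idempotent_add_orthogonal:
  assumes "idempotent R e" "idempotent R g" "e \<otimes> g = \<zero>" "g \<otimes> e = \<zero>"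
  shows "idempotent R (e \<oplus> g)" "g \<otimes> (e \<oplus> g) = g" "(e \<oplus> g) \<otimes> g = g"
  using assms by (auto simp: idempotent_def l_distr r_distr)

text \<open>Take an idempotent g that is maximal among the sums of primitive ones. If g were not
  \<open>\<one>\<close>, a minimal non-zero idempotent below \<open>\<one> \<ominus> g\<close> would
  be primitive and orthogonal to g, and adding it would enlarge g.\<close>

lemma one_eq_sum_primitive_idempotents:
  assumes acc: "left_acc R \<or> left_acc (opposite_ring R)"
  obtains es where "\<forall>e\<in>set es. primitive_idempotent R e" "foldr (\<oplus>) es \<zero> = \<one>"
proof -
  define P where "P g \<longleftrightarrow> idempotent R g \<and>
    (\<exists>es. (\<forall>e\<in>set es. primitive_idempotent R e) \<and> g = foldr (\<oplus>) es \<zero>)" for g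
  have "P \<zero>" unfolding P_def by (auto simp: idempotent_def intro!: exI[of _ "[]"])
  then obtain g where g: "P g" and max: "\<And>f. P f \<Longrightarrow> g \<otimes> f = g \<Longrightarrow> f \<otimes> g = g \<Longrightarrow> f = g"
    by (rule idempotent_max[where P = P, OF acc]) (auto simp: P_def)
  from g obtain es where es: "\<forall>e\<in>set es. primitive_idempotent R e" "g = foldr (\<oplus>) es \<zero>"
    and ig: "idempotent R g" unfolding P_def by blast
  have cg: "g \<in> carrier R" "g \<otimes> g = g" using ig by (auto simp: idempotent_def)
  have "g = \<one>"
  proof (rule ccontr)
    assume "g \<noteq> \<one>"
    define c where "c = \<one> \<ominus> g"
    have ic: "idempotent R c" unfolding c_def by (rule idempotent_complement[OF ig])
    then have cc: "c \<in> carrier R" "c \<otimes> c = c" by (auto simp: idempotent_def)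
    have "g = \<one> \<ominus> c" unfolding c_def using cg by algebra
    then have c0: "c \<noteq> \<zero>" using \<open>g \<noteq> \<one>\<close> by (auto simp: minus_eq)
    have gc: "g \<otimes> c = \<zero>" "c \<otimes> g = \<zero>"
      using cg by (simp_all add: c_def minus_eq r_distr l_distr r_minus l_minus r_neg)
    define Q where "Q e \<longleftrightarrow> idempotent R e \<and> e \<noteq> \<zero> \<and> c \<otimes> e = e \<and> e \<otimes> c = e" for e
    have "Q c" using ic c0 cc by (simp add: Q_def)
    then obtain e where e: "Q e" and min: "\<And>f. Q f \<Longrightarrow> e \<otimes> f = f \<Longrightarrow> f \<otimes> e = f \<Longrightarrow> f = e"
      by (rule idempotent_min[where P = Q, OF acc]) (auto simp: Q_def)
    have ie: "idempotent R e" and ce: "e \<in> carrier R" and e0: "e \<noteq> \<zero>" and ec: "c \<otimes> e = e" "e \<otimes> c = e"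
      using e by (auto simp: Q_def idempotent_def)
    have "f = \<zero> \<or> f = e" if f: "idempotent R f" "e \<otimes> f = f" "f \<otimes> e = f" for f
    proof -
      have cf: "f \<in> carrier R" using f by (simp add: idempotent_def)
      have "c \<otimes> f = f" "f \<otimes> c = f" using f ec cf ce cc by (metis m_assoc)+
      then show ?thesis using min f by (auto simp: Q_def)
    qed
    then have pe: "primitive_idempotent R e" using ie e0 by (auto simp: primitive_idempotent_def)
    have ge: "e \<otimes> g = \<zero>" "g \<otimes> e = \<zero>"
    proof -
      have "e \<otimes> g = e \<otimes> (c \<otimes> g)" using ec cc ce cg by (metis m_assoc)
      then show "e \<otimes> g = \<zero>" using gc ce by simp
      have "g \<otimes> e = (g \<otimes> c) \<otimes> e" using ec cc ce cg by (metis m_assoc)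
      then show "g \<otimes> e = \<zero>" using gc ce by simp
    qed
    note add = idempotent_add_orthogonal[OF ie ig ge]
    have "P (e \<oplus> g)"
      unfolding P_def using add(1) pe es by (auto intro!: exI[of _ "e # es"])
    from max[OF this add(2,3)] have "e = \<zero>" using ce cg by simp
    then show False using e0 by simp
  qed
  from this es(2) have "foldr (\<oplus>) es \<zero> = \<one>" by (rule back_subst[of "\<lambda>x. x = \<one>"])
  then show thesis by (rule that[OF es(1)])
qed

end

section \<open>Lifting a semisimple decomposition from a quotient\<close>

lemma left_acc_surj_hom:
  assumes "ring R" "ring Q" and h: "h \<in> ring_hom R Q" and surj: "h ` carrier R = carrier Q"
    and acc: "left_acc R"
  shows "left_acc Q"
  unfolding left_acc_def
proof (intro allI impI, elim conjE)
  interpret R: ring R by fact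
  interpret Q: ring Q by fact
  interpret h: ring_hom_ring R Q h by (rule ring_hom_ringI2[OF assms(1,2) h])
  fix \<S> assume ne: "\<S> \<noteq> {}" and id: "\<forall>I\<in>\<S>. left_ideal Q I"
  define pre where "pre I = {x \<in> carrier R. h x \<in> I}" for I
  have pre: "left_ideal R (pre I)" "h ` pre I = I" if "I \<in> \<S>" for I
  proof -
    note I = Q.left_idealD[OF id[rule_format, OF that]]
    show "left_ideal R (pre I)" unfolding left_ideal_def pre_def
    proof (intro conjI ballI subsetI CollectI; (elim CollectE conjE)?)
      fix x y assume x: "x \<in> carrier R" "h x \<in> I" and y: "y \<in> carrier R" "h y \<in> I"
      show "h (x \<oplus>\<^bsub>R\<^esub> y) \<in> I" using I(3)[OF x(2) y(2)] x y by simp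
    next
      fix a x assume a: "a \<in> carrier R" and x: "x \<in> carrier R" "h x \<in> I"
      show "h (a \<otimes>\<^bsub>R\<^esub> x) \<in> I" using I(4)[OF h.hom_closed[OF a] x(2)] a x by simp
    qed (use I(2) in simp_all)
    show "h ` pre I = I"
    proof
      show "I \<subseteq> h ` pre I"
      proof
        fix y assume y: "y \<in> I"
        then have "y \<in> h ` carrier R" using I(1)[OF y] surj by simp
        then show "y \<in> h ` pre I" using y by (auto simp: pre_def)
      qed
    qed (auto simp: pre_def)
  qed
  obtain I0 where "I0 \<in> \<S>" using ne by blast
  then have "pre I0 \<in> pre ` \<S>" by blast
  then obtain K where K: "K \<in> pre ` \<S>" "\<And>L. L \<in> pre ` \<S> \<Longrightarrow> K \<subseteq> L \<Longrightarrow> L = K"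
    using left_accE[where P = "\<lambda>K. K \<in> pre ` \<S>" and I = "pre I0", OF acc] pre(1) by (metis imageE)
  then obtain I where I: "I \<in> \<S>" "K = pre I" by blast
  show "\<exists>I\<in>\<S>. \<forall>K\<in>\<S>. I \<subseteq> K \<longrightarrow> K = I"
  proof (intro bexI[OF _ I(1)] ballI impI)
    fix L assume L: "L \<in> \<S>" "I \<subseteq> L"
    have "pre I \<subseteq> pre L" using L(2) by (auto simp: pre_def)
    then have "pre L = pre I" using K(2)[OF imageI[OF L(1)]] unfolding I(2) by blast
    then show "L = I" using pre(2)[OF L(1)] pre(2)[OF I(1)] by metis
  qed
qed

text \<open>The identity is decomposed in \<open>R Quot Z\<close>, which is von Neumann regular, and
  \<open>es\<close> consists of arbitrary preimages. All conclusions are congruences modulo Z, so no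
  lifting of idempotents to idempotents is involved.\<close>

lemma (in ring) semisimple_modulo_ideal:
  assumes "ideal Z R" and acc: "left_acc R \<or> left_acc (opposite_ring R)"
    and reg: "\<And>a. a \<in> carrier R \<Longrightarrow> \<exists>b\<in>carrier R. a \<otimes> b \<otimes> a \<ominus> a \<in> Z"
  obtains es where "set es \<subseteq> carrier R - Z" "\<one> \<ominus> foldr (\<oplus>) es \<zero> \<in> Z"
    "\<And>e. e \<in> set es \<Longrightarrow> e \<otimes> e \<ominus> e \<in> Z"
    "\<And>e x. e \<in> set es \<Longrightarrow> x \<in> carrier R \<Longrightarrow> x \<otimes> e \<notin> Z \<Longrightarrow> \<exists>y\<in>carrier R. y \<otimes> x \<otimes> e \<ominus> e \<in> Z"
    "\<And>e x. e \<in> set es \<Longrightarrow> x \<in> carrier R \<Longrightarrow> e \<otimes> x \<notin> Z \<Longrightarrow> \<exists>y\<in>carrier R. e \<otimes> x \<otimes> y \<ominus> e \<in> Z"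
proof -
  interpret Z: ideal Z R by fact
  define Q where "Q = R Quot Z"
  define h where "h = (+>) Z"
  have Qr: "ring Q" unfolding Q_def by (rule Z.quotient_is_ring)
  interpret Q: ring Q by fact
  have hom: "h \<in> ring_hom R Q" unfolding Q_def h_def by (rule Z.rcos_ring_hom)
  interpret h: ring_hom_ring R Q h by (rule ring_hom_ringI2[OF ring_axioms Qr hom])
  have surj: "h ` carrier R = carrier Q"
    by (auto simp: Q_def h_def FactRing_def A_RCOSETS_def')
  have eq: "h x = h y \<longleftrightarrow> x \<ominus> y \<in> Z" if "x \<in> carrier R" "y \<in> carrier R" for x y
    unfolding h_def using quotient_eq_iff_same_a_r_cos[OF assms(1) that] by simp
  have hz: "h x = \<zero>\<^bsub>Q\<^esub> \<longleftrightarrow> x \<in> Z" if "x \<in> carrier R" for x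
    using eq[OF that, of \<zero>] that by (simp add: minus_eq)
  have hom': "h \<in> ring_hom (opposite_ring R) (opposite_ring Q)"
    by (rule ring_hom_memI) (use h.hom_closed in auto)
  have acc': "left_acc Q \<or> left_acc (opposite_ring Q)"
    using acc left_acc_surj_hom[OF ring_axioms Qr hom surj]
      left_acc_surj_hom[OF ring_opposite_ring Q.ring_opposite_ring hom'] surj by auto
  have reg': "regular_ring Q"
    unfolding regular_ring_def
  proof
    fix a' assume "a' \<in> carrier Q"
    then obtain a where a: "a \<in> carrier R" "a' = h a" using surj by blast
    then obtain b where b: "b \<in> carrier R" "a \<otimes> b \<otimes> a \<ominus> a \<in> Z" using reg by blast
    then have "h (a \<otimes> b \<otimes> a) = h a" by (intro iffD2[OF eq]) (use a b in simp_all)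
    moreover have "h (a \<otimes> b \<otimes> a) = h a \<otimes>\<^bsub>Q\<^esub> h b \<otimes>\<^bsub>Q\<^esub> h a" using a b by simp
    ultimately show "\<exists>b\<in>carrier Q. a' \<otimes>\<^bsub>Q\<^esub> b \<otimes>\<^bsub>Q\<^esub> a' = a'"
      unfolding a(2) by (metis h.hom_closed b(1))
  qed
  obtain es' where es': "\<forall>e\<in>set es'. primitive_idempotent Q e" "foldr (\<oplus>\<^bsub>Q\<^esub>) es' \<zero>\<^bsub>Q\<^esub> = \<one>\<^bsub>Q\<^esub>"
    by (rule Q.one_eq_sum_primitive_idempotents[OF acc'])
  have onto: "\<exists>x\<in>carrier R. y = h x" if "y \<in> carrier Q" for y
    using that by (simp flip: surj add: image_iff)
  have "\<forall>e\<in>set es'. \<exists>x\<in>carrier R. e = h x"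
    using es'(1) by (intro ballI onto) (simp add: primitive_idempotent_def idempotent_def)
  then obtain g where g: "\<And>e. e \<in> set es' \<Longrightarrow> g e \<in> carrier R \<and> h (g e) = e" by metis
  define es where "es = map g es'"
  have car: "e \<in> carrier R" and prim: "primitive_idempotent Q (h e)" if "e \<in> set es" for e
    using that g es' by (auto simp: es_def)
  have "foldr (\<oplus>) (map g xs) \<zero> \<in> carrier R \<and> h (foldr (\<oplus>) (map g xs) \<zero>) = foldr (\<oplus>\<^bsub>Q\<^esub>) xs \<zero>\<^bsub>Q\<^esub>"
    if "set xs \<subseteq> set es'" for xs
    using that g by (induction xs) auto
  from this[of es'] have sum: "foldr (\<oplus>) es \<zero> \<in> carrier R" "h (foldr (\<oplus>) es \<zero>) = h \<one>"
    using es' by (auto simp: es_def)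
  show thesis
  proof (rule that)
    show "set es \<subseteq> carrier R - Z" using car prim hz by (auto simp: primitive_idempotent_def)
    show "\<one> \<ominus> foldr (\<oplus>) es \<zero> \<in> Z" using eq[of \<one> "foldr (\<oplus>) es \<zero>"] sum by simp
    fix e assume e: "e \<in> set es"
    note ce = car[OF e] and pe = prim[OF e]
    show "e \<otimes> e \<ominus> e \<in> Z" using eq[of "e \<otimes> e" e] ce pe by (simp add: primitive_idempotent_def idempotent_def)
    fix x assume x: "x \<in> carrier R"
    show "\<exists>y\<in>carrier R. y \<otimes> x \<otimes> e \<ominus> e \<in> Z" if "x \<otimes> e \<notin> Z"
    proof -
      have "h x \<otimes>\<^bsub>Q\<^esub> h e \<noteq> \<zero>\<^bsub>Q\<^esub>" using hz[of "x \<otimes> e"] x ce that by simp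
      from Q.primitive_idempotent_left_minimal[OF reg' pe _ this]
      obtain y' where y': "y' \<in> carrier Q" "y' \<otimes>\<^bsub>Q\<^esub> h x \<otimes>\<^bsub>Q\<^esub> h e = h e" using x by auto
      then obtain y where "y \<in> carrier R" "y' = h y" using onto by blast
      then show ?thesis using y' x ce eq[of "y \<otimes> x \<otimes> e" e] by auto
    qed
    show "\<exists>y\<in>carrier R. e \<otimes> x \<otimes> y \<ominus> e \<in> Z" if "e \<otimes> x \<notin> Z"
    proof -
      have "h e \<otimes>\<^bsub>Q\<^esub> h x \<noteq> \<zero>\<^bsub>Q\<^esub>" using hz[of "e \<otimes> x"] x ce that by simp
      from Q.primitive_idempotent_right_minimal[OF reg' pe _ this]
      obtain y' where y': "y' \<in> carrier Q" "h e \<otimes>\<^bsub>Q\<^esub> h x \<otimes>\<^bsub>Q\<^esub> y' = h e" using x by auto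
      then obtain y where "y \<in> carrier R" "y' = h y" using onto by blast
      then show ?thesis using y' x ce eq[of "e \<otimes> x \<otimes> y" e] by auto
    qed
  qed
qed

text \<open>Only the products of n factors from Z, not their sums: the additive span, which is the
  n-th power of Z, has the same annihilators and vanishes at the same time.\<close>

primrec ideal_products :: "('a, 'm) ring_scheme \<Rightarrow> 'a set \<Rightarrow> nat \<Rightarrow> 'a set"
  where "ideal_products R Z 0 = {\<one>\<^bsub>R\<^esub>}"
  | "ideal_products R Z (Suc n) = {z \<otimes>\<^bsub>R\<^esub> p | z p. z \<in> Z \<and> p \<in> ideal_products R Z n}"

lemma (in ring) ideal_products_closed:
  "Z \<subseteq> carrier R \<Longrightarrow> ideal_products R Z n \<subseteq> carrier R"
  by (induction n) auto

lemma (in ring) ideal_products_Suc_right: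
  assumes "Z \<subseteq> carrier R"
  shows "ideal_products R Z (Suc n) = {p \<otimes> z | p z. p \<in> ideal_products R Z n \<and> z \<in> Z}"
proof (induction n)
  case 0
  have "z \<otimes> \<one> = z" "\<one> \<otimes> z = z" if "z \<in> Z" for z using assms that by auto
  then show ?case by force
next
  case (Suc n)
  have "ideal_products R Z (Suc (Suc n)) =
      {z \<otimes> q | z q. z \<in> Z \<and> q \<in> {p \<otimes> z | p z. p \<in> ideal_products R Z n \<and> z \<in> Z}}"
    unfolding Suc[symmetric] by (rule ideal_products.simps(2))
  also have "\<dots> = {z \<otimes> (p \<otimes> z') | z p z'. z \<in> Z \<and> p \<in> ideal_products R Z n \<and> z' \<in> Z}" by blast
  also have "\<dots> = {z \<otimes> p \<otimes> z' | z p z'. z \<in> Z \<and> p \<in> ideal_products R Z n \<and> z' \<in> Z}"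
  proof -
    have "z \<otimes> (p \<otimes> z') = z \<otimes> p \<otimes> z'" if "z \<in> Z" "p \<in> ideal_products R Z n" "z' \<in> Z" for z p z'
      using assms ideal_products_closed[OF assms, of n] that by (intro m_assoc[symmetric]) auto
    then show ?thesis by (intro Collect_cong iff_exI) auto
  qed
  also have "\<dots> = {p \<otimes> z | p z. p \<in> ideal_products R Z (Suc n) \<and> z \<in> Z}" by auto
  finally show ?case .
qed

lemma (in ring) ideal_products_opposite:
  assumes "Z \<subseteq> carrier R"
  shows "ideal_products (opposite_ring R) Z n = ideal_products R Z n"
proof (induction n)
  case (Suc n)
  show ?case unfolding ideal_products_Suc_right[OF assms] using Suc by auto
qed simp

text \<open>\<open>R/Z\<close> is semisimple and \<open>Z\<close> is nilpotent. The list \<open>es\<close> lifts a decomposition of the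
  identity of \<open>R/Z\<close> into primitive idempotents, so that, for \<open>e\<close> in \<open>es\<close>, the left ideals
  \<open>{x. xe \<in> Z}\<close> and the right ideals \<open>{x. ex \<in> Z}\<close> are maximal.\<close>

locale semiprimary_ring = ring R for R (structure) +
  fixes Z :: "'a set" and es :: "'a list"
  assumes Z: "ideal Z R"
    and nilpotent: "\<exists>n. ideal_products R Z n \<subseteq> {\<zero>}"
    and es: "set es \<subseteq> carrier R - Z"
    and sum_es: "\<one> \<ominus> foldr (\<oplus>) es \<zero> \<in> Z"
    and idem: "e \<in> set es \<Longrightarrow> e \<otimes> e \<ominus> e \<in> Z"
    and left_min: "e \<in> set es \<Longrightarrow> x \<in> carrier R \<Longrightarrow> x \<otimes> e \<notin> Z \<Longrightarrow>
      \<exists>y\<in>carrier R. y \<otimes> x \<otimes> e \<ominus> e \<in> Z"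
    and right_min: "e \<in> set es \<Longrightarrow> x \<in> carrier R \<Longrightarrow> e \<otimes> x \<notin> Z \<Longrightarrow>
      \<exists>y\<in>carrier R. e \<otimes> x \<otimes> y \<ominus> e \<in> Z"
begin

sublocale Z: ideal Z R by (rule Z)

text \<open>\<open>left_min\<close> and \<open>right_min\<close> change places. This makes the
  one-sided consequences below available for right ideals.\<close>

lemma semiprimary_opposite: "semiprimary_ring (opposite_ring R) Z es"
proof (intro semiprimary_ring.intro semiprimary_ring_axioms.intro)
  interpret op: ring "opposite_ring R" by (rule ring_opposite_ring)
  show "ideal Z (opposite_ring R)"
  proof (rule idealI)
    show "subgroup Z (add_monoid (opposite_ring R))"
      using Z.a_subgroup by (simp add: opposite_ring_def)
  qed (use Z.I_l_closed Z.I_r_closed op.ring_axioms in auto)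
next
  have [simp]: "add (opposite_ring R) = add R" by (simp add: opposite_ring_def)
  show "\<one>\<^bsub>opposite_ring R\<^esub> \<ominus>\<^bsub>opposite_ring R\<^esub>
      foldr (\<oplus>\<^bsub>opposite_ring R\<^esub>) es \<zero>\<^bsub>opposite_ring R\<^esub> \<in> Z"
    using sum_es by simp
next
  fix e x assume e: "e \<in> set es" and x: "x \<in> carrier (opposite_ring R)"
  have ce: "e \<in> carrier R" using es e by auto
  show "\<exists>y\<in>carrier (opposite_ring R). y \<otimes>\<^bsub>opposite_ring R\<^esub> x \<otimes>\<^bsub>opposite_ring R\<^esub> e
      \<ominus>\<^bsub>opposite_ring R\<^esub> e \<in> Z" if "x \<otimes>\<^bsub>opposite_ring R\<^esub> e \<notin> Z"
    using right_min[OF e, of x] x that ce by (auto simp: m_assoc)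
  show "\<exists>y\<in>carrier (opposite_ring R). e \<otimes>\<^bsub>opposite_ring R\<^esub> x \<otimes>\<^bsub>opposite_ring R\<^esub> y
      \<ominus>\<^bsub>opposite_ring R\<^esub> e \<in> Z" if "e \<otimes>\<^bsub>opposite_ring R\<^esub> x \<notin> Z"
    using left_min[OF e, of x] x that ce by (auto simp: m_assoc)
qed (use nilpotent ideal_products_opposite[OF Z.a_subset] es idem ring_opposite_ring in simp_all)

lemma es_carrier: "e \<in> set es \<Longrightarrow> e \<in> carrier R"
  using es by auto

text \<open>Split y as (1 - s)y + sy, where s is the sum of \<open>es\<close>; the first summand has
  its left factor in Z.\<close>

lemma sum_mult_mem:
  assumes I: "left_ideal R I" and y: "y \<in> carrier R" and Zy: "\<And>z. z \<in> Z \<Longrightarrow> z \<otimes> y \<in> I"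
    and ey: "\<And>e. e \<in> set es \<Longrightarrow> e \<otimes> y \<in> I"
  shows "y \<in> I"
proof -
  note I' = left_idealD[OF I]
  have "foldr (\<oplus>) xs \<zero> \<in> carrier R \<and> foldr (\<oplus>) xs \<zero> \<otimes> y \<in> I" if "set xs \<subseteq> set es" for xs
    using that by (induction xs) (use es_carrier ey I' y in \<open>auto simp: l_distr\<close>)
  then have s: "foldr (\<oplus>) es \<zero> \<in> carrier R" "foldr (\<oplus>) es \<zero> \<otimes> y \<in> I" by auto
  have "(\<one> \<ominus> foldr (\<oplus>) es \<zero>) \<otimes> y \<oplus> foldr (\<oplus>) es \<zero> \<otimes> y \<in> I"
    by (intro I'(3) s(2) Zy sum_es)
  also have "(\<one> \<ominus> foldr (\<oplus>) es \<zero>) \<otimes> y \<oplus> foldr (\<oplus>) es \<zero> \<otimes> y = y"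
    using s(1) y by algebra
  finally show ?thesis .
qed

text \<open>Every non-zero cyclic module R/I has a simple submodule: the class of \<open>r\<close>
  is non-zero and is killed by the maximal left ideal of all a with ae in Z. To find it, take a
  product y of maximal length outside I; then Zy lies in I, and some ey does not.\<close>

lemma simple_submodule:
  assumes I: "left_ideal R I" and ne: "\<one> \<notin> I"
  obtains e r where "e \<in> set es" "r \<in> carrier R" "r \<notin> I"
    "\<And>a. a \<in> carrier R \<Longrightarrow> a \<otimes> e \<in> Z \<Longrightarrow> a \<otimes> r \<in> I"
proof -
  note I' = left_idealD[OF I]
  obtain N where "ideal_products R Z N \<subseteq> I" using nilpotent I'(2) by blast
  then obtain n where n: "ideal_products R Z n \<subseteq> I" and min: "\<And>m. m < n \<Longrightarrow> \<not> ideal_products R Z m \<subseteq> I"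
    using exists_least_iff[of "\<lambda>n. ideal_products R Z n \<subseteq> I"] by blast
  have "n \<noteq> 0" using n ne by (auto intro: gr0I)
  then obtain m where m: "n = Suc m" using not0_implies_Suc by blast
  then obtain y where y: "y \<in> ideal_products R Z m" "y \<notin> I" using min by blast
  have yc: "y \<in> carrier R" using y ideal_products_closed[OF Z.a_subset] by blast
  have Zy: "z \<otimes> y \<in> I" if "z \<in> Z" for z using n m y(1) that by auto
  then obtain e where e: "e \<in> set es" "e \<otimes> y \<notin> I" using sum_mult_mem[OF I yc] y(2) by blast
  show thesis
  proof (rule that[OF e(1) _ e(2)])
    show "e \<otimes> y \<in> carrier R" using es_carrier[OF e(1)] yc by simp
    fix a assume a: "a \<in> carrier R" "a \<otimes> e \<in> Z"
    then show "a \<otimes> (e \<otimes> y) \<in> I" using Zy[OF a(2)] es_carrier[OF e(1)] yc by (simp add: m_assoc)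
  qed
qed

text \<open>The Hopkins-Levitzki theorem: the generator \<open>r\<close> of a simple submodule of
  R/I is the element required by \<open>acc_imp_artinian\<close>, since \<open>left_min\<close>
  inverts x modulo the maximal left ideal that annihilates r.\<close>

lemma acc_imp_left_artinian:
  assumes "left_acc R"
  shows "left_artinian R"
proof (rule acc_imp_artinian[OF assms])
  fix I assume I: "left_ideal R I" "I \<noteq> carrier R"
  note I' = left_idealD[OF I(1)]
  have "\<one> \<notin> I" using I(2) I'(1) I'(4)[of _ \<one>] by auto
  then obtain e r where e: "e \<in> set es" and r: "r \<in> carrier R" "r \<notin> I"
    and er: "\<And>a. a \<in> carrier R \<Longrightarrow> a \<otimes> e \<in> Z \<Longrightarrow> a \<otimes> r \<in> I"
    using simple_submodule[OF I(1)] by blast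
  have "\<exists>s\<in>carrier R. (\<one> \<ominus> s \<otimes> x) \<otimes> r \<in> I" if x: "x \<in> carrier R" "x \<otimes> r \<notin> I" for x
  proof -
    obtain y where y: "y \<in> carrier R" "y \<otimes> x \<otimes> e \<ominus> e \<in> Z"
      using left_min[OF e x(1)] er x by blast
    have "(\<one> \<ominus> y \<otimes> x) \<otimes> e = \<ominus> (y \<otimes> x \<otimes> e \<ominus> e)" using y(1) x(1) es_carrier[OF e] by algebra
    then have "(\<one> \<ominus> y \<otimes> x) \<otimes> e \<in> Z" using y(2) Z.a_inv_closed by simp
    then show ?thesis using er[of "\<one> \<ominus> y \<otimes> x"] y(1) x(1) by auto
  qed
  then show "\<exists>y\<in>carrier R - I. \<forall>x\<in>carrier R. x \<otimes> y \<notin> I \<longrightarrow> (\<exists>s\<in>carrier R. (\<one> \<ominus> s \<otimes> x) \<otimes> y \<in> I)"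
    using r by blast
qed

end

section \<open>The singular ideal\<close>

context ring
begin

text \<open>Choose F such that further elements of X do not shrink its left annihilator. The minimum
  condition on left ideals gives this directly; the maximum condition on right ideals gives it
  through r(l(F)), from which l(F) is recovered as a triple annihilator.\<close>

lemma finite_lann:
  assumes acc: "left_dcc R \<or> left_acc (opposite_ring R)" and X: "X \<subseteq> carrier R"
  obtains F where "finite F" "F \<subseteq> X" "lann R F \<subseteq> lann R X"
proof -
  have "\<exists>F. finite F \<and> F \<subseteq> X \<and> (\<forall>G. finite G \<and> G \<subseteq> X \<and> F \<subseteq> G \<longrightarrow> lann R G = lann R F)"
    using acc
  proof
    assume dcc: "left_dcc R"
    let ?P = "\<lambda>I. \<exists>F. finite F \<and> F \<subseteq> X \<and> I = lann R F"
    have "?P (lann R {})" by blast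
    moreover have "\<And>I. ?P I \<Longrightarrow> left_ideal R I" using X left_ideal_lann by blast
    ultimately obtain I where I: "?P I" "\<And>K. ?P K \<Longrightarrow> K \<subseteq> I \<Longrightarrow> K = I"
      using left_dccE[where P = ?P, OF dcc] by metis
    then obtain F where F: "finite F" "F \<subseteq> X" "I = lann R F" by blast
    have "lann R G = lann R F" if "finite G" "G \<subseteq> X" "F \<subseteq> G" for G
      using I(2)[of "lann R G"] lann_antimono[OF that(3)] that F(3) by blast
    then show ?thesis using F by blast
  next
    assume acc: "left_acc (opposite_ring R)"
    let ?P = "\<lambda>I. \<exists>F. finite F \<and> F \<subseteq> X \<and> I = rann R (lann R F)"
    have l: "lann R F \<subseteq> carrier R" for F by (auto simp: lann_def)
    have "?P (rann R (lann R {}))" by blast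
    moreover have "\<And>I. ?P I \<Longrightarrow> left_ideal (opposite_ring R) I"
      using left_ideal_opposite_rann[OF l] by blast
    ultimately obtain I where I: "?P I" "\<And>K. ?P K \<Longrightarrow> I \<subseteq> K \<Longrightarrow> K = I"
      using left_accE[where P = ?P, OF acc] by metis
    then obtain F where F: "finite F" "F \<subseteq> X" "I = rann R (lann R F)" by blast
    have "lann R G = lann R F" if G: "finite G" "G \<subseteq> X" "F \<subseteq> G" for G
    proof -
      have "rann R (lann R G) = rann R (lann R F)"
        using I(2)[of "rann R (lann R G)"] rann_antimono[OF lann_antimono[OF G(3)]] G F(3) by blast
      then show ?thesis using lann_rann_lann[of F R] lann_rann_lann[of G R] F(2) G(2) X by (metis order_trans)
    qed
    then show ?thesis using F by blast
  qed
  then obtain F where F: "finite F" "F \<subseteq> X"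
    and stable: "\<And>G. finite G \<Longrightarrow> G \<subseteq> X \<Longrightarrow> F \<subseteq> G \<Longrightarrow> lann R G = lann R F" by metis
  have "lann R F \<subseteq> lann R X"
  proof
    fix r assume r: "r \<in> lann R F"
    have "r \<otimes> x = \<zero>" if "x \<in> X" for x
    proof -
      have "lann R (insert x F) = lann R F" using F that by (intro stable) auto
      then have "r \<in> lann R (insert x F)" using r by blast
      then show ?thesis by (simp add: lann_def)
    qed
    then show "r \<in> lann R X" using r by (simp add: lann_def)
  qed
  then show thesis by (rule that[OF F])
qed

text \<open>Extends a homomorphism by prescribing the value \<open>w\<close> at \<open>x\<close>.
  Whether the result is still single-valued is a separate question, answered where the graph is
  used.\<close>

lemma linear_graph_add_principal:
  assumes G: "linear_graph G" and x: "x \<in> carrier R" and w: "w \<in> carrier R"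
  shows "linear_graph {(m \<oplus> a \<otimes> x, v \<oplus> a \<otimes> w) | m v a. (m, v) \<in> G \<and> a \<in> carrier R}"
    (is "linear_graph ?H")
  unfolding linear_graph_def
proof (intro conjI allI impI ballI)
  have car: "m \<in> carrier R" "v \<in> carrier R" if "(m, v) \<in> G" for m v
    using G that by (auto simp: linear_graph_def)
  show "?H \<subseteq> carrier R \<times> carrier R" using car x w by auto
  have "(\<zero>, \<zero>) \<in> G" using G by (simp add: linear_graph_def)
  then have "(\<zero> \<oplus> \<zero> \<otimes> x, \<zero> \<oplus> \<zero> \<otimes> w) \<in> ?H" by blast
  then show "(\<zero>, \<zero>) \<in> ?H" using x w by simp
  fix y1 v1 assume "(y1, v1) \<in> ?H"
  then obtain m1 n1 a1 where 1: "y1 = m1 \<oplus> a1 \<otimes> x" "v1 = n1 \<oplus> a1 \<otimes> w" "(m1, n1) \<in> G" "a1 \<in> carrier R"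
    by blast
  note c1 = car[OF 1(3)]
  {
    fix y2 v2 assume "(y2, v2) \<in> ?H"
    then obtain m2 n2 a2 where 2: "y2 = m2 \<oplus> a2 \<otimes> x" "v2 = n2 \<oplus> a2 \<otimes> w" "(m2, n2) \<in> G" "a2 \<in> carrier R"
      by blast
    note c2 = car[OF 2(3)]
    have "(m1 \<oplus> m2, n1 \<oplus> n2) \<in> G" using G 1 2 by (simp add: linear_graph_def)
    moreover have "y1 \<oplus> y2 = (m1 \<oplus> m2) \<oplus> (a1 \<oplus> a2) \<otimes> x" "v1 \<oplus> v2 = (n1 \<oplus> n2) \<oplus> (a1 \<oplus> a2) \<otimes> w"
      unfolding 1(1,2) 2(1,2) using c1 c2 1(4) 2(4) x w by algebra+
    ultimately show "(y1 \<oplus> y2, v1 \<oplus> v2) \<in> ?H" using 1(4) 2(4) by blast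
  }
  fix b assume b: "b \<in> carrier R"
  have "(b \<otimes> m1, b \<otimes> n1) \<in> G" using G 1 b by (simp add: linear_graph_def)
  moreover have "b \<otimes> y1 = b \<otimes> m1 \<oplus> (b \<otimes> a1) \<otimes> x" "b \<otimes> v1 = b \<otimes> n1 \<oplus> (b \<otimes> a1) \<otimes> w"
    unfolding 1(1,2) using c1 b 1(4) x w by algebra+
  ultimately show "(b \<otimes> y1, b \<otimes> v1) \<in> ?H" using b 1(4) by blast
qed

text \<open>With \<open>x\<close> equal to \<open>\<one>\<close> this is right multiplication by
  \<open>y\<close> on I, in particular the inclusion or the zero map; with I equal to R it is the
  correspondence ax to ay on Rx.\<close>

lemma linear_graph_mult:
  assumes "left_ideal R I" "x \<in> carrier R" "y \<in> carrier R"
  shows "linear_graph {(a \<otimes> x, a \<otimes> y) | a. a \<in> I}"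
  unfolding linear_graph_def
proof (intro conjI allI impI ballI)
  note I = left_idealD[OF assms(1)]
  show "{(a \<otimes> x, a \<otimes> y) | a. a \<in> I} \<subseteq> carrier R \<times> carrier R" using I(1) assms by auto
  show "(\<zero>, \<zero>) \<in> {(a \<otimes> x, a \<otimes> y) | a. a \<in> I}" using I(2) assms by force
  fix p q assume "(p, q) \<in> {(a \<otimes> x, a \<otimes> y) | a. a \<in> I}"
  then obtain a where a: "p = a \<otimes> x" "q = a \<otimes> y" "a \<in> I" by blast
  show "(b \<otimes> p, b \<otimes> q) \<in> {(a \<otimes> x, a \<otimes> y) | a. a \<in> I}" if b: "b \<in> carrier R" for b
  proof -
    have "b \<otimes> p = (b \<otimes> a) \<otimes> x" "b \<otimes> q = (b \<otimes> a) \<otimes> y"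
      using a I(1)[OF a(3)] b assms by (simp_all add: m_assoc)
    then show ?thesis using I(4)[OF b a(3)] by blast
  qed
  fix p' q' assume "(p', q') \<in> {(a \<otimes> x, a \<otimes> y) | a. a \<in> I}"
  then obtain a' where a': "p' = a' \<otimes> x" "q' = a' \<otimes> y" "a' \<in> I" by blast
  have "p \<oplus> p' = (a \<oplus> a') \<otimes> x" "q \<oplus> q' = (a \<oplus> a') \<otimes> y"
    using a a' I(1)[OF a(3)] I(1)[OF a'(3)] assms by (simp_all add: l_distr)
  then show "(p \<oplus> p', q \<oplus> q') \<in> {(a \<otimes> x, a \<otimes> y) | a. a \<in> I}" using I(3)[OF a(3) a'(3)] by blast
qed

end

text \<open>The condition on z says that its left annihilator is an essential left ideal: every
  non-zero x has a non-zero left multiple in it.\<close>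

definition left_singular :: "('a, 'm) ring_scheme \<Rightarrow> 'a set"
  where "left_singular R = {z \<in> carrier R. \<forall>x\<in>carrier R. x \<noteq> \<zero>\<^bsub>R\<^esub> \<longrightarrow>
    (\<exists>r\<in>carrier R. r \<otimes>\<^bsub>R\<^esub> x \<noteq> \<zero>\<^bsub>R\<^esub> \<and> r \<otimes>\<^bsub>R\<^esub> x \<otimes>\<^bsub>R\<^esub> z = \<zero>\<^bsub>R\<^esub>)}"

context ring
begin

lemma left_singularE:
  assumes "z \<in> left_singular R" "x \<in> carrier R" "x \<noteq> \<zero>"
  obtains r where "r \<in> carrier R" "r \<otimes> x \<noteq> \<zero>" "r \<otimes> x \<otimes> z = \<zero>"
  using assms unfolding left_singular_def by blast

lemma left_singularI:
  assumes "z \<in> carrier R"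
    and "\<And>x. x \<in> carrier R \<Longrightarrow> x \<noteq> \<zero> \<Longrightarrow> \<exists>r\<in>carrier R. r \<otimes> x \<noteq> \<zero> \<and> r \<otimes> x \<otimes> z = \<zero>"
  shows "z \<in> left_singular R"
  using assms unfolding left_singular_def by blast

lemma left_singular_closed: "z \<in> left_singular R \<Longrightarrow> z \<in> carrier R"
  by (simp add: left_singular_def)

text \<open>Finite intersections of essential left ideals are essential.\<close>

lemma left_singular_common:
  assumes "finite F" "F \<subseteq> left_singular R" "x \<in> carrier R" "x \<noteq> \<zero>"
  shows "\<exists>r\<in>carrier R. r \<otimes> x \<noteq> \<zero> \<and> (\<forall>z\<in>F. r \<otimes> x \<otimes> z = \<zero>)"
  using assms
proof (induction F rule: finite_induct)
  case empty
  then show ?case by (intro bexI[of _ \<one>]) auto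
next
  case (insert z F)
  then obtain r where r: "r \<in> carrier R" "r \<otimes> x \<noteq> \<zero>" "\<forall>z\<in>F. r \<otimes> x \<otimes> z = \<zero>" by auto
  obtain s where s: "s \<in> carrier R" "s \<otimes> (r \<otimes> x) \<noteq> \<zero>" "s \<otimes> (r \<otimes> x) \<otimes> z = \<zero>"
    using left_singularE[of z "r \<otimes> x"] insert r by auto
  have eq: "s \<otimes> r \<otimes> x = s \<otimes> (r \<otimes> x)" using s(1) r(1) insert by (simp add: m_assoc)
  have "s \<otimes> r \<otimes> x \<otimes> y = \<zero>" if y: "y \<in> F" for y
  proof -
    have "y \<in> carrier R" using y insert left_singular_closed by blast
    then have "s \<otimes> r \<otimes> x \<otimes> y = s \<otimes> (r \<otimes> x \<otimes> y)" using s(1) r(1) insert by (simp add: m_assoc)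
    then show ?thesis using r(3) y s(1) by simp
  qed
  moreover have "s \<otimes> r \<otimes> x \<otimes> z = \<zero>" "s \<otimes> r \<otimes> x \<noteq> \<zero>" using s unfolding eq by auto
  ultimately show ?case using s(1) r(1) by (intro bexI[of _ "s \<otimes> r"]) auto
qed

lemma ideal_left_singular: "ideal (left_singular R) R"
proof (rule idealI)
  have car: "left_singular R \<subseteq> carrier R" using left_singular_closed by blast
  show 1: "x \<otimes> a \<in> left_singular R" if a: "a \<in> left_singular R" and x: "x \<in> carrier R" for a x
  proof (rule left_singularI)
    note ca = left_singular_closed[OF a]
    then show "x \<otimes> a \<in> carrier R" using x by simp
    fix y assume y: "y \<in> carrier R" "y \<noteq> \<zero>"
    show "\<exists>r\<in>carrier R. r \<otimes> y \<noteq> \<zero> \<and> r \<otimes> y \<otimes> (x \<otimes> a) = \<zero>"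
    proof (cases "y \<otimes> x = \<zero>")
      case True
      then have "y \<otimes> (x \<otimes> a) = \<zero>" using y x ca by (simp flip: m_assoc)
      then show ?thesis using y by (intro bexI[of _ \<one>]) auto
    next
      case False
      then obtain r where r: "r \<in> carrier R" "r \<otimes> (y \<otimes> x) \<noteq> \<zero>" "r \<otimes> (y \<otimes> x) \<otimes> a = \<zero>"
        using left_singularE[OF a, of "y \<otimes> x"] y x by auto
      moreover have "r \<otimes> y \<noteq> \<zero>"
      proof
        assume "r \<otimes> y = \<zero>"
        then have "r \<otimes> (y \<otimes> x) = \<zero>" using r(1) y x by (simp flip: m_assoc)
        then show False using r by simp
      qed
      moreover have "r \<otimes> y \<otimes> (x \<otimes> a) = r \<otimes> (y \<otimes> x) \<otimes> a" using r(1) y x ca by (simp add: m_assoc)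
      ultimately show ?thesis by (intro bexI[of _ r]) auto
    qed
  qed
  show "a \<otimes> x \<in> left_singular R" if a: "a \<in> left_singular R" and x: "x \<in> carrier R" for a x
  proof (rule left_singularI)
    note ca = left_singular_closed[OF a]
    then show "a \<otimes> x \<in> carrier R" using x by simp
    fix y assume y: "y \<in> carrier R" "y \<noteq> \<zero>"
    then obtain r where r: "r \<in> carrier R" "r \<otimes> y \<noteq> \<zero>" "r \<otimes> y \<otimes> a = \<zero>" using left_singularE[OF a] by blast
    then have "r \<otimes> y \<otimes> (a \<otimes> x) = \<zero>" using y x ca by (simp flip: m_assoc)
    then show "\<exists>r\<in>carrier R. r \<otimes> y \<noteq> \<zero> \<and> r \<otimes> y \<otimes> (a \<otimes> x) = \<zero>" using r by blast
  qed
  show "subgroup (left_singular R) (add_monoid R)"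
  proof (rule add.subgroupI)
    show "left_singular R \<noteq> {}" 
    proof -
      have "\<exists>r\<in>carrier R. r \<otimes> x \<noteq> \<zero>" if "x \<in> carrier R" "x \<noteq> \<zero>" for x
        using that by (intro bexI[of _ \<one>]) auto
      then show ?thesis using left_singularI[of \<zero>] by auto
    qed
    show "\<ominus> a \<in> left_singular R" if a: "a \<in> left_singular R" for a
      using 1[OF a, of "\<ominus> \<one>"] left_singular_closed[OF a] by (simp add: l_minus)
    show "a \<oplus> b \<in> left_singular R" if a: "a \<in> left_singular R" and b: "b \<in> left_singular R" for a b
    proof (rule left_singularI)
      note ca = left_singular_closed[OF a] and cb = left_singular_closed[OF b]
      show "a \<oplus> b \<in> carrier R" using ca cb by simp
      fix y assume y: "y \<in> carrier R" "y \<noteq> \<zero>"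
      obtain r where "r \<in> carrier R" "r \<otimes> y \<noteq> \<zero>" "\<forall>z\<in>{a, b}. r \<otimes> y \<otimes> z = \<zero>"
        using left_singular_common[of "{a, b}" y] a b y by auto
      then show "\<exists>r\<in>carrier R. r \<otimes> y \<noteq> \<zero> \<and> r \<otimes> y \<otimes> (a \<oplus> b) = \<zero>"
        using y ca cb by (intro bexI[of _ r]) (simp_all add: r_distr)
    qed
  qed (use car in auto)
qed (rule ring_axioms)

section \<open>Nilpotency of the singular ideal\<close>

lemma ideal_products_add:
  assumes "Z \<subseteq> carrier R" "q \<in> ideal_products R Z (m + n)"
  shows "\<exists>p\<in>ideal_products R Z m. \<exists>p'\<in>ideal_products R Z n. q = p \<otimes> p'"
  using assms(2)
proof (induction m arbitrary: q)
  case 0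
  then show ?case using ideal_products_closed[OF assms(1), of n] by (auto intro!: bexI[of _ q])
next
  case (Suc m)
  then obtain z q' where q: "q = z \<otimes> q'" "z \<in> Z" "q' \<in> ideal_products R Z (m + n)" by auto
  obtain p p' where p: "p \<in> ideal_products R Z m" "p' \<in> ideal_products R Z n" "q' = p \<otimes> p'"
    using Suc.IH[OF q(3)] by blast
  have "q = (z \<otimes> p) \<otimes> p'" 
    using p q(1,2) assms(1) ideal_products_closed[OF assms(1), of m] ideal_products_closed[OF assms(1), of n]
    by (simp add: m_assoc subset_iff)
  moreover have "z \<otimes> p \<in> ideal_products R Z (Suc m)" using q p by auto
  ultimately show ?case using p by blast
qed

text \<open>The factor r is absorbed by the first factor from Z, which requires positive length: the
  empty product only gives \<open>\<one>\<close>.\<close>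

lemma ideal_products_mult_left:
  assumes "ideal Z R" "p \<in> ideal_products R Z (Suc n)" "r \<in> carrier R"
  shows "r \<otimes> p \<in> ideal_products R Z (Suc n)"
proof -
  interpret Z: ideal Z R by fact
  obtain z p' where p: "p = z \<otimes> p'" "z \<in> Z" "p' \<in> ideal_products R Z n" using assms(2) by auto
  have "r \<otimes> p = (r \<otimes> z) \<otimes> p'"
    using p assms(3) Z.a_subset ideal_products_closed[OF Z.a_subset, of n] by (simp add: m_assoc subset_iff)
  moreover have "r \<otimes> z \<in> Z" using Z.I_l_closed p assms(3) by blast
  ultimately show ?thesis using p(3) by auto
qed

lemma lann_ideal_products_mono:
  assumes "Z \<subseteq> carrier R"
  shows "lann R (ideal_products R Z n) \<subseteq> lann R (ideal_products R Z (n + k))"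
proof
  fix a assume a: "a \<in> lann R (ideal_products R Z n)"
  have "a \<otimes> q = \<zero>" if q: "q \<in> ideal_products R Z (n + k)" for q
  proof -
    obtain p p' where p: "p \<in> ideal_products R Z n" "p' \<in> ideal_products R Z k" "q = p \<otimes> p'"
      using ideal_products_add[OF assms q] by blast
    have "a \<in> carrier R" "p \<in> carrier R" "p' \<in> carrier R"
      using a p ideal_products_closed[OF assms] by (auto simp: lann_def)
    then have "a \<otimes> q = (a \<otimes> p) \<otimes> p'" unfolding p(3) by (rule m_assoc[symmetric])
    also have "\<dots> = \<zero>" using a p ideal_products_closed[OF assms, of k] by (auto simp: lann_def)
    finally show ?thesis .
  qed
  then show "a \<in> lann R (ideal_products R Z (n + k))" using a by (simp add: lann_def)
qed

text \<open>Let \<open>A n\<close> be the stable annihilator of the powers of Z, and let a outside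
  it have maximal l(a). If az were also outside, then l(az) = l(a), but Ra meets the essential left
  ideal l(z). So aZ lies in \<open>A n\<close>, which puts a into \<open>A (Suc n)\<close>, a
  contradiction.\<close>

lemma left_singular_nilpotent_left_acc:
  assumes acc: "left_acc R"
  shows "\<exists>n. ideal_products R (left_singular R) n \<subseteq> {\<zero>}"
proof -
  define Z where "Z = left_singular R"
  define A where "A n = lann R (ideal_products R Z n)" for n
  have Z: "Z \<subseteq> carrier R" unfolding Z_def using left_singular_closed by blast
  have cl: "ideal_products R Z n \<subseteq> carrier R" for n by (rule ideal_products_closed[OF Z])
  have idA: "left_ideal R (A n)" for n unfolding A_def by (rule left_ideal_lann[OF cl])
  obtain I where I: "I \<in> range A" "\<And>K. K \<in> range A \<Longrightarrow> I \<subseteq> K \<Longrightarrow> K = I"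
    using left_accE[where P = "\<lambda>I. I \<in> range A", OF acc rangeI] idA by (metis rangeE)
  then obtain n where n: "I = A n" by blast
  have stable: "A (Suc n) = A n"
  proof -
    have "A n \<subseteq> A (Suc n)" using lann_ideal_products_mono[OF Z, of n 1] unfolding A_def by (simp only: Suc_eq_plus1)
    then show ?thesis using I(2)[OF rangeI] unfolding n by blast
  qed
  have "A n = carrier R"
  proof (rule ccontr)
    assume "A n \<noteq> carrier R"
    then obtain a0 where a0: "a0 \<in> carrier R - A n" using left_idealD(1)[OF idA] by blast
    let ?P = "\<lambda>K. \<exists>a\<in>carrier R - A n. K = lann R {a}"
    have "?P (lann R {a0})" using a0 by blast
    moreover have "\<And>K. ?P K \<Longrightarrow> left_ideal R K" using left_ideal_lann by blast
    ultimately obtain K where K: "?P K" "\<And>L. ?P L \<Longrightarrow> K \<subseteq> L \<Longrightarrow> L = K"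
      using left_accE[where P = ?P, OF acc] by metis
    then obtain a where a: "a \<in> carrier R" "a \<notin> A n" "K = lann R {a}" by blast
    have a0: "a \<noteq> \<zero>" using a(2) left_idealD(2)[OF idA] by blast
    have az: "a \<otimes> z \<in> A n" if z: "z \<in> Z" for z
    proof (rule ccontr)
      assume "a \<otimes> z \<notin> A n"
      moreover have cz: "z \<in> carrier R" using z Z by blast
      moreover have "K \<subseteq> lann R {a \<otimes> z}" unfolding a(3) using a(1) cz by (auto simp: lann_def simp flip: m_assoc)
      ultimately have eq: "lann R {a \<otimes> z} = K" using K(2)[of "lann R {a \<otimes> z}"] a(1) by blast
      obtain r where r: "r \<in> carrier R" "r \<otimes> a \<noteq> \<zero>" "r \<otimes> a \<otimes> z = \<zero>"
        using left_singularE[OF z[unfolded Z_def] a(1) a0] by blast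
      then have "r \<in> lann R {a \<otimes> z}" using a(1) cz by (simp add: lann_def m_assoc)
      then show False using r(2) unfolding eq a(3) by (simp add: lann_def)
    qed
    have "a \<otimes> q = \<zero>" if q: "q \<in> ideal_products R Z (Suc n)" for q
    proof -
      obtain z p where p: "q = z \<otimes> p" "z \<in> Z" "p \<in> ideal_products R Z n" using q by auto
      have "a \<otimes> q = a \<otimes> z \<otimes> p" using p a(1) Z cl[of n] by (simp add: m_assoc subset_iff)
      then show ?thesis using az[OF p(2)] p(3) unfolding A_def by (simp add: lann_def)
    qed
    then have "a \<in> A (Suc n)" using a(1) unfolding A_def by (simp add: lann_def)
    then show False using stable a(2) by simp
  qed
  then have "\<one> \<in> A n" by simp
  then have "p = \<zero>" if p: "p \<in> ideal_products R Z n" for p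
  proof -
    have "p \<in> carrier R" using p cl by blast
    then have "p = \<one> \<otimes> p" by simp
    also have "\<dots> = \<zero>" using lannD[OF \<open>\<one> \<in> A n\<close>[unfolded A_def] p] .
    finally show ?thesis .
  qed
  then show ?thesis unfolding Z_def by blast
qed

text \<open>An essential left ideal stays essential in finite direct powers: the vector of the
  products ay has a non-zero multiple with all entries in A. Entries already in A stay there under
  further left multiplication, so they can be treated one after the other.\<close>

lemma essential_simultaneous:
  assumes A: "left_ideal R A"
    and ess: "\<And>x. x \<in> carrier R \<Longrightarrow> x \<noteq> \<zero> \<Longrightarrow> \<exists>r\<in>carrier R. r \<otimes> x \<noteq> \<zero> \<and> r \<otimes> x \<in> A"
    and "finite F" "F \<subseteq> carrier R" "a \<in> carrier R" "\<exists>y\<in>F. a \<otimes> y \<noteq> \<zero>"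
  shows "\<exists>r\<in>carrier R. (\<forall>y\<in>F. r \<otimes> a \<otimes> y \<in> A) \<and> (\<exists>y\<in>F. r \<otimes> a \<otimes> y \<noteq> \<zero>)"
  using assms(3-6)
proof (induction F rule: finite_induct)
  case (insert y F)
  note A' = left_idealD[OF A]
  have y: "y \<in> carrier R" and F: "F \<subseteq> carrier R" and a: "a \<in> carrier R" using insert by auto
  show ?case
  proof (cases "\<exists>y\<in>F. a \<otimes> y \<noteq> \<zero>")
    case True
    then obtain r where r: "r \<in> carrier R" "\<forall>y\<in>F. r \<otimes> a \<otimes> y \<in> A" "\<exists>y\<in>F. r \<otimes> a \<otimes> y \<noteq> \<zero>"
      using insert.IH F a by blast
    show ?thesis
    proof (cases "r \<otimes> a \<otimes> y = \<zero>")
      case True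
      then show ?thesis using r A'(2) by (intro bexI[of _ r]) auto
    next
      case False
      then obtain s where s: "s \<in> carrier R" "s \<otimes> (r \<otimes> a \<otimes> y) \<noteq> \<zero>" "s \<otimes> (r \<otimes> a \<otimes> y) \<in> A"
        using ess[of "r \<otimes> a \<otimes> y"] r(1) a y by auto
      have eq: "s \<otimes> r \<otimes> a \<otimes> x = s \<otimes> (r \<otimes> a \<otimes> x)" if "x \<in> carrier R" for x
        using s(1) r(1) a that by (simp add: m_assoc)
      have "s \<otimes> r \<otimes> a \<otimes> x \<in> A" if "x \<in> F" for x
        using eq[of x] A'(4)[OF s(1)] r(2) that F by (metis subsetD)
      then show ?thesis using s eq[OF y] r(1) by (intro bexI[of _ "s \<otimes> r"]) auto
    qed
  next
    case False
    then have "a \<otimes> y \<noteq> \<zero>" using insert.prems(3) by auto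
    then obtain r where r: "r \<in> carrier R" "r \<otimes> (a \<otimes> y) \<noteq> \<zero>" "r \<otimes> (a \<otimes> y) \<in> A"
      using ess[of "a \<otimes> y"] a y by auto
    have "r \<otimes> a \<otimes> x \<in> A" if x: "x \<in> F" for x
    proof -
      have "r \<otimes> a \<otimes> x = r \<otimes> (a \<otimes> x)" using r(1) a x F by (intro m_assoc) auto
      then show ?thesis using False x r(1) A'(2) by simp
    qed
    moreover have "r \<otimes> a \<otimes> y = r \<otimes> (a \<otimes> y)" using r(1) a y by (intro m_assoc) auto
    ultimately show ?thesis using r by (intro bexI[of _ r]) auto
  qed
qed simp

text \<open>The annihilator \<open>A\<close> of the powers \<open>Z\<^sup>m\<close> with \<open>m\<close> large is essential, as \<open>Z\<close> is finitely
  generated. If \<open>a \<notin> A\<close>, then essentiality, applied to finitely many generators of \<open>aZ\<^sup>m\<close> at once,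
  gives \<open>r\<close> with \<open>raZ\<^sup>m \<noteq> 0\<close> and \<open>raZ\<^sup>2\<^sup>m = 0\<close>.\<close>

lemma left_singular_nilpotent_right_acc:
  assumes acc: "left_acc (opposite_ring R)"
  shows "\<exists>n. ideal_products R (left_singular R) n \<subseteq> {\<zero>}"
proof -
  define Z where "Z = left_singular R"
  define A where "A n = lann R (ideal_products R Z n)" for n
  have idZ: "ideal Z R" unfolding Z_def by (rule ideal_left_singular)
  have Z: "Z \<subseteq> carrier R" unfolding Z_def using left_singular_closed by blast
  have cl: "ideal_products R Z n \<subseteq> carrier R" for n by (rule ideal_products_closed[OF Z])
  have idA: "left_ideal R (A n)" for n unfolding A_def by (rule left_ideal_lann[OF cl])
  \<comment> \<open>These annihilators are two-sided, as left multiples of products of positive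
    length are again such products. So the chain condition on right ideals applies to them.\<close>
  have idA': "left_ideal (opposite_ring R) (A (Suc n))" for n
    unfolding left_ideal_def
  proof (intro conjI ballI subsetI; simp)
    note I = left_idealD[OF idA[of "Suc n"]]
    show "\<And>x. x \<in> A (Suc n) \<Longrightarrow> x \<in> carrier R" "\<zero> \<in> A (Suc n)"
      "\<And>x y. x \<in> A (Suc n) \<Longrightarrow> y \<in> A (Suc n) \<Longrightarrow> x \<oplus> y \<in> A (Suc n)" using I by blast+
    fix r x assume r: "r \<in> carrier R" and x: "x \<in> A (Suc n)"
    have "x \<otimes> r \<otimes> p = \<zero>" if p: "p \<in> ideal_products R Z (Suc n)" for p
    proof -
      have "p \<in> carrier R" using p cl by blast
      then have "x \<otimes> r \<otimes> p = x \<otimes> (r \<otimes> p)" using r I(1)[OF x] by (intro m_assoc)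
      moreover have "\<forall>q\<in>ideal_products R Z (Suc n). x \<otimes> q = \<zero>"
        using lannD[OF x[unfolded A_def]] by blast
      ultimately show ?thesis using ideal_products_mult_left[OF idZ p r] by metis
    qed
    then show "x \<otimes> r \<in> A (Suc n)" using I(1)[OF x] r unfolding A_def by (intro lannI m_closed)
  qed
  let ?P = "\<lambda>I. \<exists>n. I = A (Suc n)"
  have "?P (A (Suc 0))" by blast
  then obtain I where I: "?P I" "\<And>K. ?P K \<Longrightarrow> I \<subseteq> K \<Longrightarrow> K = I"
    using left_accE[where P = ?P, OF acc] idA' by metis
  then obtain n where n: "I = A (Suc n)" by blast
  define m where "m = Suc n"
  have stable: "A (m + m) = A m"
  proof -
    have "A m \<subseteq> A (m + m)" unfolding A_def by (rule lann_ideal_products_mono[OF Z])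
    moreover have "\<exists>k. A (m + m) = A (Suc k)" unfolding m_def by (metis add_Suc)
    ultimately show ?thesis using I(2) unfolding n m_def by metis
  qed
  \<comment> \<open>A left multiple of x that kills F kills all of Z, because l(F) lies in l(Z), and
    then all products of length m, whose first factor is in Z.\<close>
  have ess: "\<exists>r\<in>carrier R. r \<otimes> x \<noteq> \<zero> \<and> r \<otimes> x \<in> A m" if x: "x \<in> carrier R" "x \<noteq> \<zero>" for x
  proof -
    obtain F where F: "finite F" "F \<subseteq> Z" "lann R F \<subseteq> lann R Z"
      by (rule finite_lann[OF _ Z]) (use acc in blast)+
    obtain r where r: "r \<in> carrier R" "r \<otimes> x \<noteq> \<zero>" "\<forall>z\<in>F. r \<otimes> x \<otimes> z = \<zero>"
      using left_singular_common[OF F(1) _ x] F(2) unfolding Z_def by blast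
    then have "r \<otimes> x \<in> lann R F" using x by (simp add: lann_def)
    then have rZ: "r \<otimes> x \<otimes> z = \<zero>" if "z \<in> Z" for z using lannD[OF subsetD[OF F(3)] that] by simp
    have "r \<otimes> x \<otimes> q = \<zero>" if q: "q \<in> ideal_products R Z m" for q
    proof -
      obtain z p where p: "q = z \<otimes> p" "z \<in> Z" "p \<in> ideal_products R Z n" using q unfolding m_def by auto
      have "r \<otimes> x \<otimes> q = r \<otimes> x \<otimes> z \<otimes> p" using p r(1) x(1) Z cl[of n] by (simp add: m_assoc subset_iff)
      then show ?thesis using rZ[OF p(2)] p(3) cl[of n] by auto
    qed
    then have "r \<otimes> x \<in> A m" using r(1) x(1) unfolding A_def by (intro lannI m_closed)
    then show ?thesis using r by blast
  qed
  have "A m = carrier R"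
  proof (rule ccontr)
    assume "A m \<noteq> carrier R"
    then obtain a where a: "a \<in> carrier R" "a \<notin> A m" using left_idealD(1)[OF idA] by blast
    obtain F where F: "finite F" "F \<subseteq> ideal_products R Z (m + m)"
      "lann R F \<subseteq> lann R (ideal_products R Z (m + m))"
      by (rule finite_lann[OF _ cl]) (use acc in blast)+
    have FA: "x \<in> A m" if "x \<in> lann R F" for x using F(3) that stable unfolding A_def by blast
    \<comment> \<open>Each element of F, a product of length 2m, is split in the middle. The left
      factors \<open>h q\<close> are the finitely many elements that are moved into
      \<open>A m\<close> simultaneously.\<close>
    have "\<forall>q\<in>F. \<exists>p. p \<in> ideal_products R Z m \<and> (\<exists>p'\<in>ideal_products R Z m. q = p \<otimes> p')"
      using ideal_products_add[OF Z] F(2) by blast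
    then obtain h where h: "\<And>q. q \<in> F \<Longrightarrow> h q \<in> ideal_products R Z m"
      "\<And>q. q \<in> F \<Longrightarrow> \<exists>p'\<in>ideal_products R Z m. q = h q \<otimes> p'" by metis
    have ch: "h q \<in> carrier R" if "q \<in> F" for q using h(1)[OF that] cl by blast
    have "\<exists>q\<in>F. a \<otimes> q \<noteq> \<zero>" using FA[of a] a by (auto simp: lann_def)
    then obtain q where q: "q \<in> F" "a \<otimes> q \<noteq> \<zero>" by blast
    obtain p' where p': "p' \<in> ideal_products R Z m" "q = h q \<otimes> p'" using h(2)[OF q(1)] by blast
    have "a \<otimes> h q \<noteq> \<zero>"
    proof
      assume 0: "a \<otimes> h q = \<zero>"
      have cp: "p' \<in> carrier R" using p'(1) cl by blast
      have "a \<otimes> (h q \<otimes> p') = (a \<otimes> h q) \<otimes> p'" using a(1) ch[OF q(1)] cp by (simp add: m_assoc)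
      also have "\<dots> = \<zero>" unfolding 0 using cp by simp
      finally show False using q(2) p'(2) by simp
    qed
    then obtain r where r: "r \<in> carrier R" "\<forall>y\<in>h ` F. r \<otimes> a \<otimes> y \<in> A m" "\<exists>y\<in>h ` F. r \<otimes> a \<otimes> y \<noteq> \<zero>"
      using essential_simultaneous[OF idA[of m] ess, of "h ` F" a] F(1) ch a(1) q(1) by blast
    have "r \<otimes> a \<otimes> q = \<zero>" if q: "q \<in> F" for q
    proof -
      obtain p' where p': "p' \<in> ideal_products R Z m" "q = h q \<otimes> p'" using h(2)[OF q] by blast
      have cp: "p' \<in> carrier R" using p'(1) cl by blast
      have "r \<otimes> a \<otimes> (h q \<otimes> p') = (r \<otimes> a \<otimes> h q) \<otimes> p'" using r(1) a(1) ch[OF q] cp by (simp add: m_assoc)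
      also have "\<dots> = \<zero>" using r(2) q lannD[OF _ p'(1)] unfolding A_def by blast
      finally show ?thesis using p'(2) by simp
    qed
    then have "r \<otimes> a \<in> lann R F" using r(1) a(1) by (simp add: lann_def)
    then have "r \<otimes> a \<in> A m" by (rule FA)
    moreover obtain q where "q \<in> F" "r \<otimes> a \<otimes> h q \<noteq> \<zero>" using r(3) by blast
    ultimately show False using lannD[OF _ h(1)] unfolding A_def by blast
  qed
  then have "\<one> \<in> A m" by simp
  then have "p = \<zero>" if p: "p \<in> ideal_products R Z m" for p
  proof -
    have "p \<in> carrier R" using p cl by blast
    then have "p = \<one> \<otimes> p" by simp
    also have "\<dots> = \<zero>" using lannD[OF \<open>\<one> \<in> A m\<close>[unfolded A_def] p] .
    finally show ?thesis .
  qed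
  then show ?thesis unfolding Z_def by blast
qed

end

section \<open>Extension of monomorphisms to units\<close>

definition left_baer :: "('a, 'm) ring_scheme \<Rightarrow> bool"
  where "left_baer R \<longleftrightarrow> (\<forall>I f. left_ideal R I \<and> left_linear R I f \<longrightarrow>
    (\<exists>r\<in>carrier R. \<forall>x\<in>I. f x = x \<otimes>\<^bsub>R\<^esub> r))"

lemma (in ring) baer_graph:
  assumes baer: "left_baer R" and G: "linear_graph G" and z: "\<And>v. (\<zero>, v) \<in> G \<Longrightarrow> v = \<zero>"
  shows "\<exists>r. r \<in> carrier R \<and> (\<forall>x v. (x, v) \<in> G \<longrightarrow> x \<otimes> r = v)"
proof -
  obtain f where f: "left_ideal R (Domain G)" "left_linear R (Domain G) f"
    "\<And>x v. (x, v) \<in> G \<Longrightarrow> f x = v" using linear_graph_fun[OF G z] by metis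
  then obtain r where "r \<in> carrier R" "\<forall>x\<in>Domain G. f x = x \<otimes> r"
    using baer unfolding left_baer_def by meson
  then show ?thesis using f(3) by (metis DomainI)
qed

text \<open>The left 1-MacWilliams property, since the automorphisms of the left module \<open>R\<close> are the
  right multiplications by units.\<close>

locale mono_unit_ring = ring R for R (structure) +
  assumes mono_unit: "left_ideal R I \<Longrightarrow> left_linear R I f \<Longrightarrow> inj_on f I \<Longrightarrow>
    \<exists>u\<in>Units R. \<forall>x\<in>I. f x = x \<otimes> u"
begin

lemma graph_unit:
  assumes G: "linear_graph G" and z: "\<And>v. (\<zero>, v) \<in> G \<Longrightarrow> v = \<zero>" and z': "\<And>x. (x, \<zero>) \<in> G \<Longrightarrow> x = \<zero>"
  shows "\<exists>u. u \<in> Units R \<and> (\<forall>x v. (x, v) \<in> G \<longrightarrow> x \<otimes> u = v)"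
proof -
  obtain f where f: "left_ideal R (Domain G)" "left_linear R (Domain G) f"
    and fG: "\<And>x v. (x, v) \<in> G \<Longrightarrow> f x = v" using linear_graph_fun[OF G z] by metis
  note D = left_idealD[OF f(1)] and fD = left_linearD[OF f(2,1)]
  have "inj_on f (Domain G)"
  proof (rule inj_onI)
    fix x y assume xy: "x \<in> Domain G" "y \<in> Domain G" "f x = f y"
    have d: "x \<ominus> y \<in> Domain G" using D(6) xy by blast
    then obtain v where v: "(x \<ominus> y, v) \<in> G" by blast
    have "v = f x \<ominus> f y" using fG[OF v] fD(5) xy by simp
    then have "v = \<zero>" using xy fD(1) by simp
    then have "x \<ominus> y = \<zero>" using z' v by blast
    then show "x = y" using D(1) xy by simp
  qed
  from mono_unit[OF f this] obtain u where u: "u \<in> Units R" "\<forall>x\<in>Domain G. f x = x \<otimes> u" by blast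
  show ?thesis using u fG by (metis DomainI)
qed

text \<open>Equality of the left annihilators makes ax to ay a well-defined monomorphism from Rx to
  R.\<close>

lemma same_annihilator_unit:
  assumes x: "x \<in> carrier R" and y: "y \<in> carrier R"
    and eq: "\<And>a. a \<in> carrier R \<Longrightarrow> a \<otimes> x = \<zero> \<longleftrightarrow> a \<otimes> y = \<zero>"
  obtains u where "u \<in> Units R" "y = x \<otimes> u"
proof -
  let ?G = "{(a \<otimes> x, a \<otimes> y) | a. a \<in> carrier R}"
  have "left_ideal R (carrier R)" by (auto simp: left_ideal_def)
  then have G: "linear_graph ?G" using x y by (rule linear_graph_mult)
  have 1: "v = \<zero>" if v: "(\<zero>, v) \<in> ?G" for v
  proof -
    obtain a where "\<zero> = a \<otimes> x" "v = a \<otimes> y" "a \<in> carrier R" using v by blast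
    then show ?thesis using eq by metis
  qed
  have 2: "p = \<zero>" if p: "(p, \<zero>) \<in> ?G" for p
  proof -
    obtain a where "p = a \<otimes> x" "\<zero> = a \<otimes> y" "a \<in> carrier R" using p by blast
    then show ?thesis using eq by metis
  qed
  have "\<exists>u. u \<in> Units R \<and> (\<forall>p v. (p, v) \<in> ?G \<longrightarrow> p \<otimes> u = v)"
    by (rule graph_unit[OF G]) (erule 1, erule 2)
  then obtain u where u: "u \<in> Units R" "\<forall>p v. (p, v) \<in> ?G \<longrightarrow> p \<otimes> u = v"
    by (elim exE conjE) (rule that)
  have "(\<one> \<otimes> x, \<one> \<otimes> y) \<in> ?G" by blast
  from u(2)[rule_format, OF this] have "x \<otimes> u = y" using x y by simp
  then show thesis using that u(1) by blast
qed

text \<open>This places Z in the Jacobson radical. The left annihilators of z and 1 - z intersect in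
  zero, and that of z is essential; hence 1 - z has the same left annihilator as 1.\<close>

lemma one_minus_singular_Units:
  assumes "z \<in> left_singular R"
  shows "\<one> \<ominus> z \<in> Units R"
proof -
  have cz: "z \<in> carrier R" using assms by (rule left_singular_closed)
  have "a = \<zero>" if a: "a \<in> carrier R" "a \<otimes> (\<one> \<ominus> z) = \<zero>" for a
  proof (rule ccontr)
    assume "a \<noteq> \<zero>"
    then obtain r where r: "r \<in> carrier R" "r \<otimes> a \<noteq> \<zero>" "r \<otimes> a \<otimes> z = \<zero>"
      using left_singularE[OF assms a(1)] by blast
    have "r \<otimes> a = r \<otimes> (a \<otimes> (\<one> \<ominus> z)) \<oplus> r \<otimes> a \<otimes> z"
      using r(1) a(1) cz by (simp add: ring_simprules)
    then show False using r a by simp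
  qed
  then have "a \<otimes> \<one> = \<zero> \<longleftrightarrow> a \<otimes> (\<one> \<ominus> z) = \<zero>" if "a \<in> carrier R" for a
    using that cz by (metis l_null r_one minus_closed one_closed)
  then obtain u where "u \<in> Units R" "\<one> \<ominus> z = \<one> \<otimes> u"
    using same_annihilator_unit[OF one_closed minus_closed[OF one_closed cz]] by metis
  then show ?thesis by (metis Units_closed l_one)
qed

text \<open>If \<open>C\<close> is a complement of \<open>l(a)\<close>, then \<open>a\<close> acts on \<open>C\<close> as a unit \<open>u\<close>, so \<open>au\<^sup>-\<^sup>1a - a\<close>
  vanishes on the essential left ideal \<open>l(a) + C\<close>.\<close>

lemma regular_modulo_singular:
  assumes a: "a \<in> carrier R"
  shows "\<exists>b\<in>carrier R. a \<otimes> b \<otimes> a \<ominus> a \<in> left_singular R"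
proof -
  \<comment> \<open>The left ideals that meet l(a) in zero; right multiplication by a is injective
    on each of them. A maximal one is the complement C.\<close>
  define \<A> where "\<A> = {C. left_ideal R C \<and> (\<forall>x\<in>C. x \<otimes> a = \<zero> \<longrightarrow> x = \<zero>)}"
  have "{\<zero>} \<in> \<A>" by (auto simp: \<A>_def left_ideal_def)
  moreover have "\<Union>\<C> \<in> \<A>" if \<C>: "\<C> \<noteq> {}" "subset.chain \<A> \<C>" for \<C>
  proof -
    have id: "left_ideal R C" if "C \<in> \<C>" for C using \<C>(2) that by (auto simp: subset.chain_def \<A>_def)
    have "left_ideal R (\<Union>\<C>)"
      unfolding left_ideal_def
    proof (intro conjI ballI subsetI)
      obtain C where C: "C \<in> \<C>" using \<C>(1) by blast
      show "\<zero> \<in> \<Union>\<C>" using left_idealD(2)[OF id[OF C]] C by blast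
      show "x \<in> carrier R" if "x \<in> \<Union>\<C>" for x using left_idealD(1)[OF id] that by blast
      show "b \<otimes> x \<in> \<Union>\<C>" if "b \<in> carrier R" "x \<in> \<Union>\<C>" for b x using left_idealD(4)[OF id] that by blast
      fix x y assume "x \<in> \<Union>\<C>" "y \<in> \<Union>\<C>"
      then obtain C D where CD: "C \<in> \<C>" "D \<in> \<C>" "x \<in> C" "y \<in> D" by blast
      then have "C \<subseteq> D \<or> D \<subseteq> C" using \<C>(2) by (auto simp: subset.chain_def)
      then obtain E where E: "E \<in> \<C>" "x \<in> E" "y \<in> E" using CD by blast
      then show "x \<oplus> y \<in> \<Union>\<C>" using left_idealD(3)[OF id[OF E(1)] E(2,3)] by blast
    qed
    then show ?thesis using \<C>(2) unfolding \<A>_def subset.chain_def by blast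
  qed
  ultimately obtain C where C: "C \<in> \<A>" and max: "\<And>D. D \<in> \<A> \<Longrightarrow> C \<subseteq> D \<Longrightarrow> D = C"
    using subset_Zorn_nonempty[of \<A>] by (metis empty_iff)
  have idC: "left_ideal R C" and inj: "\<And>x. x \<in> C \<Longrightarrow> x \<otimes> a = \<zero> \<Longrightarrow> x = \<zero>" using C by (auto simp: \<A>_def)
  note C' = left_idealD[OF idC]
  let ?G = "{(c \<otimes> \<one>, c \<otimes> a) | c. c \<in> C}"
  have G: "linear_graph ?G" using linear_graph_mult[OF idC one_closed a] .
  have 1: "v = \<zero>" if v: "(\<zero>, v) \<in> ?G" for v
  proof -
    obtain c where "\<zero> = c \<otimes> \<one>" "v = c \<otimes> a" "c \<in> C" using v by blast
    then show ?thesis using C'(1) a by (metis l_null r_one)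
  qed
  have 2: "p = \<zero>" if p: "(p, \<zero>) \<in> ?G" for p
  proof -
    obtain c where "p = c \<otimes> \<one>" "\<zero> = c \<otimes> a" "c \<in> C" using p by blast
    then show ?thesis using C'(1) inj by (metis r_one)
  qed
  have "\<exists>u. u \<in> Units R \<and> (\<forall>p v. (p, v) \<in> ?G \<longrightarrow> p \<otimes> u = v)"
    by (rule graph_unit[OF G]) (erule 1, erule 2)
  then obtain u where u: "u \<in> Units R" "\<forall>p v. (p, v) \<in> ?G \<longrightarrow> p \<otimes> u = v"
    by (elim exE conjE) (rule that)
  have cu: "c \<otimes> u = c \<otimes> a" if "c \<in> C" for c
  proof -
    have "(c \<otimes> \<one>, c \<otimes> a) \<in> ?G" using that by blast
    from u(2)[rule_format, OF this] have "(c \<otimes> \<one>) \<otimes> u = c \<otimes> a" .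
    then show ?thesis using C'(1)[OF that] by simp
  qed
  have uc: "u \<in> carrier R" "inv u \<in> carrier R" "u \<otimes> inv u = \<one>" using u(1) by auto
  define d where "d = a \<otimes> inv u \<otimes> a \<ominus> a"
  have dc: "d \<in> carrier R" unfolding d_def using a uc by simp
  have Cd: "c \<otimes> d = \<zero>" if "c \<in> C" for c
  proof -
    note cc = C'(1)[OF that]
    have "c \<otimes> d = (c \<otimes> a) \<otimes> inv u \<otimes> a \<ominus> c \<otimes> a" unfolding d_def using cc a uc by algebra
    also have "\<dots> = (c \<otimes> u) \<otimes> inv u \<otimes> a \<ominus> c \<otimes> a" using cu[OF that] by simp
    also have "(c \<otimes> u) \<otimes> inv u = c" using cc uc by (simp add: m_assoc)
    finally show ?thesis using cc a by simp
  qed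
  have Kd: "k \<otimes> d = \<zero>" if "k \<in> carrier R" "k \<otimes> a = \<zero>" for k
  proof -
    have "k \<otimes> d = (k \<otimes> a) \<otimes> inv u \<otimes> a \<ominus> k \<otimes> a" unfolding d_def using that(1) a uc by algebra
    then show ?thesis using that a uc by simp
  qed
  have "d \<in> left_singular R"
  proof (rule left_singularI[OF dc])
    fix x assume x: "x \<in> carrier R" "x \<noteq> \<zero>"
    show "\<exists>r\<in>carrier R. r \<otimes> x \<noteq> \<zero> \<and> r \<otimes> x \<otimes> d = \<zero>"
    proof (cases "x \<in> C")
      case True
      then show ?thesis using x Cd by (intro bexI[of _ \<one>]) auto
    next
      case False
      define D where "D = {c \<oplus> r \<otimes> x | c r. c \<in> C \<and> r \<in> carrier R}"
      have DI: "c \<oplus> r \<otimes> x \<in> D" if "c \<in> C" "r \<in> carrier R" for c r using that unfolding D_def by blast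
      have idD: "left_ideal R D" unfolding D_def by (rule left_ideal_add_principal[OF idC x(1)])
      have "C \<subseteq> D" using DI[of _ \<zero>] C'(1) x(1) by fastforce
      moreover have "x \<in> D" using DI[of \<zero> \<one>] C'(2) x(1) by simp
      \<comment> \<open>By maximality C + Rx contains a non-zero k = c + rx in l(a). Then rx is
        non-zero, as k is not in C, and d kills it because it kills both k and c.\<close>
      ultimately have "D \<notin> \<A>" using max False by blast
      then obtain k where k: "k \<in> D" "k \<otimes> a = \<zero>" "k \<noteq> \<zero>" using idD unfolding \<A>_def by blast
      then obtain c r where cr: "k = c \<oplus> r \<otimes> x" "c \<in> C" "r \<in> carrier R" unfolding D_def by blast
      note cc = C'(1)[OF cr(2)]
      have ck: "k \<in> carrier R" using cr cc x by simp
      have rx: "r \<otimes> x = k \<ominus> c" unfolding cr(1) using cc cr(3) x(1) by algebra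
      have "r \<otimes> x \<noteq> \<zero>"
      proof
        assume "r \<otimes> x = \<zero>"
        then have "k = c" using cr(1) cc by simp
        then show False using inj[OF cr(2)] k by simp
      qed
      moreover have "r \<otimes> x \<otimes> d = k \<otimes> d \<ominus> c \<otimes> d" unfolding rx using ck cc dc by algebra
      then have "r \<otimes> x \<otimes> d = \<zero>" using Kd[OF ck k(2)] Cd[OF cr(2)] by simp
      ultimately show ?thesis using cr(3) by blast
    qed
  qed
  then show ?thesis using uc unfolding d_def by blast
qed

lemma semiprimary:
  assumes acc: "left_acc R \<or> left_acc (opposite_ring R)"
  obtains es where "semiprimary_ring R (left_singular R) es"
proof -
  obtain es where es: "set es \<subseteq> carrier R - left_singular R" "\<one> \<ominus> foldr (\<oplus>) es \<zero> \<in> left_singular R"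
    "\<And>e. e \<in> set es \<Longrightarrow> e \<otimes> e \<ominus> e \<in> left_singular R"
    "\<And>e x. e \<in> set es \<Longrightarrow> x \<in> carrier R \<Longrightarrow> x \<otimes> e \<notin> left_singular R \<Longrightarrow>
      \<exists>y\<in>carrier R. y \<otimes> x \<otimes> e \<ominus> e \<in> left_singular R"
    "\<And>e x. e \<in> set es \<Longrightarrow> x \<in> carrier R \<Longrightarrow> e \<otimes> x \<notin> left_singular R \<Longrightarrow>
      \<exists>y\<in>carrier R. e \<otimes> x \<otimes> y \<ominus> e \<in> left_singular R"
    using semisimple_modulo_ideal[OF ideal_left_singular acc regular_modulo_singular] by metis
  have "\<exists>n. ideal_products R (left_singular R) n \<subseteq> {\<zero>}"
    using acc left_singular_nilpotent_left_acc left_singular_nilpotent_right_acc by blast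
  then have "semiprimary_ring R (left_singular R) es"
    by (intro semiprimary_ring.intro semiprimary_ring_axioms.intro ring_axioms ideal_left_singular es)
  then show thesis by (rule that)
qed

end

section \<open>Duality between simple left and simple right modules\<close>

locale mono_unit_semiprimary_ring =
  mono_unit_ring R + semiprimary_ring R "left_singular R" es for R (structure) and es
begin

text \<open>\<open>V e\<close> is the right annihilator of the maximal left ideal \<open>{a. ae \<in> Z}\<close>, i.e. the dual of the
  corresponding simple left module; it is a simple right module or zero. Two lifted idempotents are
  linked iff they define isomorphic simple left modules, equivalently isomorphic simple right
  modules. \<open>hits e e'\<close> says that \<open>V e\<close> is the simple right module that belongs to \<open>e'\<close>.\<close>

definition V :: "'a \<Rightarrow> 'a set"
  where "V e = {x \<in> carrier R. \<forall>a\<in>carrier R. a \<otimes> e \<in> left_singular R \<longrightarrow> a \<otimes> x = \<zero>}"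

definition linked :: "'a \<Rightarrow> 'a \<Rightarrow> bool"
  where "linked e e' \<longleftrightarrow> (\<exists>a\<in>carrier R. e \<otimes> a \<otimes> e' \<notin> left_singular R)"

definition hits :: "'a \<Rightarrow> 'a \<Rightarrow> bool"
  where "hits e e' \<longleftrightarrow> (\<exists>x\<in>V e. x \<otimes> e' \<noteq> \<zero>)"

lemma V_closed: "x \<in> V e \<Longrightarrow> x \<in> carrier R"
  by (simp add: V_def)

lemma V_mult:
  assumes x: "x \<in> V e" and r: "r \<in> carrier R"
  shows "x \<otimes> r \<in> V e"
proof -
  have "a \<otimes> (x \<otimes> r) = \<zero>" if a: "a \<in> carrier R" "a \<otimes> e \<in> left_singular R" for a
  proof -
    have "a \<otimes> (x \<otimes> r) = (a \<otimes> x) \<otimes> r" using a V_closed[OF x] r by (simp add: m_assoc)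
    also have "a \<otimes> x = \<zero>" using x a by (simp add: V_def)
    finally show ?thesis using r by simp
  qed
  then show ?thesis using V_closed[OF x] r by (simp add: V_def)
qed

text \<open>The left ideal of all a with ae in Z is maximal, so it is the whole annihilator of any
  non-zero element of \<open>V e\<close>.\<close>

lemma V_annihilator:
  assumes e: "e \<in> set es" and x: "x \<in> V e" "x \<noteq> \<zero>" and a: "a \<in> carrier R"
  shows "a \<otimes> x = \<zero> \<longleftrightarrow> a \<otimes> e \<in> left_singular R"
proof
  assume ax: "a \<otimes> x = \<zero>"
  show "a \<otimes> e \<in> left_singular R"
  proof (rule ccontr)
    assume "a \<otimes> e \<notin> left_singular R"
    then obtain y where y: "y \<in> carrier R" "y \<otimes> a \<otimes> e \<ominus> e \<in> left_singular R" using left_min[OF e a] by blast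
    have "(y \<otimes> a \<ominus> \<one>) \<otimes> e = y \<otimes> a \<otimes> e \<ominus> e" using y(1) a es_carrier[OF e] by algebra
    then have "(y \<otimes> a \<ominus> \<one>) \<otimes> x = \<zero>" using x(1) y a unfolding V_def by auto
    moreover have "(y \<otimes> a \<ominus> \<one>) \<otimes> x = y \<otimes> (a \<otimes> x) \<ominus> x" using y(1) a V_closed[OF x(1)] by algebra
    ultimately have "\<zero> \<ominus> x = \<zero>" using ax y(1) by simp
    then show False using x V_closed[OF x(1)] by auto
  qed
qed (use x a in \<open>simp add: V_def\<close>)

text \<open>The non-zero elements of \<open>V e\<close> share one annihilator, hence form a single
  orbit under units. In particular \<open>V e\<close> has no proper non-zero right
  submodule.\<close>

lemma V_unit:
  assumes e: "e \<in> set es" and x: "x \<in> V e" "x \<noteq> \<zero>" and y: "y \<in> V e" "y \<noteq> \<zero>"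
  obtains u where "u \<in> Units R" "y = x \<otimes> u"
  by (rule same_annihilator_unit[OF V_closed[OF x(1)] V_closed[OF y(1)]])
    (use V_annihilator[OF e x] V_annihilator[OF e y] in auto)

text \<open>A Nakayama argument: a non-zero xz would give x = xzu for a unit u, but 1 - zu is
  invertible.\<close>

lemma V_mult_singular:
  assumes e: "e \<in> set es" and x: "x \<in> V e" and z: "z \<in> left_singular R"
  shows "x \<otimes> z = \<zero>"
proof (rule ccontr)
  assume ne: "x \<otimes> z \<noteq> \<zero>"
  note cx = V_closed[OF x] and cz = left_singular_closed[OF z]
  have x0: "x \<noteq> \<zero>" using ne cz by auto
  obtain u where u: "u \<in> Units R" "x = x \<otimes> z \<otimes> u" by (rule V_unit[OF e V_mult[OF x cz] ne x x0])
  have cu: "u \<in> carrier R" using u by auto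
  have w: "\<one> \<ominus> z \<otimes> u \<in> Units R" using one_minus_singular_Units Z.I_r_closed[OF z cu] by blast
  have "x \<otimes> (\<one> \<ominus> z \<otimes> u) = x \<ominus> x \<otimes> z \<otimes> u" using cx cz cu by (simp add: ring_simprules)
  also have "\<dots> = \<zero>" using u(2) cx by simp
  finally have "x \<otimes> (\<one> \<ominus> z \<otimes> u) \<otimes> inv (\<one> \<ominus> z \<otimes> u) = \<zero>" using w by simp
  then show False using x0 w cx by (simp add: m_assoc Units_closed)
qed

lemma singular_mult_V: "z \<in> left_singular R \<Longrightarrow> e \<in> set es \<Longrightarrow> x \<in> V e \<Longrightarrow> z \<otimes> x = \<zero>"
  using Z.I_r_closed[OF _ es_carrier] left_singular_closed by (simp add: V_def)

lemma idem_not_singular: "e \<in> set es \<Longrightarrow> e \<otimes> e \<notin> left_singular R"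
proof
  assume e: "e \<in> set es" "e \<otimes> e \<in> left_singular R"
  have "e \<otimes> e \<ominus> (e \<otimes> e \<ominus> e) \<in> left_singular R"
    unfolding minus_eq by (intro Z.a_closed Z.a_inv_closed e(2) idem[OF e(1), unfolded minus_eq])
  also have "e \<otimes> e \<ominus> (e \<otimes> e \<ominus> e) = e" using es_carrier[OF e(1)] by algebra
  finally show False using es e(1) by blast
qed

lemma singular_diff:
  "x \<in> carrier R \<Longrightarrow> y \<in> carrier R \<Longrightarrow> x \<ominus> y \<in> left_singular R \<Longrightarrow>
    x \<in> left_singular R \<longleftrightarrow> y \<in> left_singular R"
proof -
  assume c: "x \<in> carrier R" "y \<in> carrier R" and d: "x \<ominus> y \<in> left_singular R"
  have x: "x = (x \<ominus> y) \<oplus> y" and y: "y = \<ominus> (x \<ominus> y) \<oplus> x" using c by algebra+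
  show ?thesis
    using Z.a_closed[OF d, of y] Z.a_closed[OF Z.a_inv_closed[OF d], of x] x y by metis
qed

lemma linked_refl: "e \<in> set es \<Longrightarrow> linked e e"
  unfolding linked_def using idem_not_singular es_carrier by (intro bexI[of _ \<one>]) auto

text \<open>If y inverts ea on the left, in the sense that yeae' is congruent to e' modulo Z, then
  e'ye cannot lie in Z: multiplied by ae' it is congruent to e'e'.\<close>

lemma linked_sym:
  assumes e: "e \<in> set es" "e' \<in> set es" and "linked e e'"
  shows "linked e' e"
proof -
  obtain a where a: "a \<in> carrier R" "e \<otimes> a \<otimes> e' \<notin> left_singular R" using assms(3) by (auto simp: linked_def)
  note c = es_carrier[OF e(1)] es_carrier[OF e(2)]
  obtain y where y: "y \<in> carrier R" "y \<otimes> (e \<otimes> a) \<otimes> e' \<ominus> e' \<in> left_singular R"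
    using left_min[OF e(2), of "e \<otimes> a"] a c by auto
  have "e' \<otimes> y \<otimes> e \<notin> left_singular R"
  proof
    assume "e' \<otimes> y \<otimes> e \<in> left_singular R"
    then have 1: "e' \<otimes> y \<otimes> e \<otimes> (a \<otimes> e') \<in> left_singular R" using Z.I_r_closed a c by blast
    have "e' \<otimes> y \<otimes> e \<otimes> (a \<otimes> e') \<ominus> e' \<otimes> e' = e' \<otimes> (y \<otimes> (e \<otimes> a) \<otimes> e' \<ominus> e')"
      using c a(1) y(1) by algebra
    then have "e' \<otimes> y \<otimes> e \<otimes> (a \<otimes> e') \<ominus> e' \<otimes> e' \<in> left_singular R"
      using Z.I_l_closed[OF y(2) c(2)] by simp
    from singular_diff[OF _ _ this] have "e' \<otimes> e' \<in> left_singular R" using 1 c a y by simp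
    then show False using idem_not_singular[OF e(2)] by simp
  qed
  then show ?thesis using y(1) by (auto simp: linked_def)
qed

lemma linked_trans:
  assumes e: "e1 \<in> set es" "e2 \<in> set es" "e3 \<in> set es" and "linked e1 e2" "linked e2 e3"
  shows "linked e1 e3"
proof -
  obtain a where a: "a \<in> carrier R" "e1 \<otimes> a \<otimes> e2 \<notin> left_singular R" using assms(4) by (auto simp: linked_def)
  obtain b where b: "b \<in> carrier R" "e2 \<otimes> b \<otimes> e3 \<notin> left_singular R" using assms(5) by (auto simp: linked_def)
  note c = e[THEN es_carrier]
  obtain y where y: "y \<in> carrier R" "y \<otimes> (e1 \<otimes> a) \<otimes> e2 \<ominus> e2 \<in> left_singular R"
    using left_min[OF e(2), of "e1 \<otimes> a"] a c by auto
  have "e1 \<otimes> (a \<otimes> e2 \<otimes> b) \<otimes> e3 \<notin> left_singular R"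
  proof
    assume "e1 \<otimes> (a \<otimes> e2 \<otimes> b) \<otimes> e3 \<in> left_singular R"
    then have 1: "y \<otimes> (e1 \<otimes> (a \<otimes> e2 \<otimes> b) \<otimes> e3) \<in> left_singular R" using Z.I_l_closed y(1) by blast
    have "y \<otimes> (e1 \<otimes> (a \<otimes> e2 \<otimes> b) \<otimes> e3) \<ominus> e2 \<otimes> b \<otimes> e3 = (y \<otimes> (e1 \<otimes> a) \<otimes> e2 \<ominus> e2) \<otimes> (b \<otimes> e3)"
      using c a(1) b(1) y(1) by algebra
    then have "y \<otimes> (e1 \<otimes> (a \<otimes> e2 \<otimes> b) \<otimes> e3) \<ominus> e2 \<otimes> b \<otimes> e3 \<in> left_singular R"
      using Z.I_r_closed[OF y(2), of "b \<otimes> e3"] b(1) c by simp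
    from singular_diff[OF _ _ this] show False using 1 b c a(1) y(1) by simp
  qed
  then show ?thesis using a(1) b(1) c by (auto simp: linked_def intro!: bexI[of _ "a \<otimes> e2 \<otimes> b"])
qed

text \<open>Ry is isomorphic to R/l(y), so it contains a simple left ideal. Hence the left socle is
  essential.\<close>

lemma simple_element:
  assumes y: "y \<in> carrier R" "y \<noteq> \<zero>"
  obtains e r where "e \<in> set es" "r \<in> carrier R" "r \<otimes> y \<in> V e" "r \<otimes> y \<noteq> \<zero>"
proof -
  have id: "left_ideal R (lann R {y})" using left_ideal_lann[of "{y}"] y by simp
  have "\<one> \<notin> lann R {y}" using y by (simp add: lann_def)
  then obtain e r where er: "e \<in> set es" "r \<in> carrier R" "r \<notin> lann R {y}"
    "\<And>a. a \<in> carrier R \<Longrightarrow> a \<otimes> e \<in> left_singular R \<Longrightarrow> a \<otimes> r \<in> lann R {y}"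
    using simple_submodule[OF id] by blast
  have "r \<otimes> y \<noteq> \<zero>" using er(2,3) by (simp add: lann_def)
  moreover have "a \<otimes> (r \<otimes> y) = \<zero>" if a: "a \<in> carrier R" "a \<otimes> e \<in> left_singular R" for a
    using lannD[OF er(4)[OF a], of y] a(1) er(2) y(1) by (simp add: m_assoc)
  then have "r \<otimes> y \<in> V e" using er(2) y(1) by (simp add: V_def)
  ultimately show thesis using that er by blast
qed

text \<open>Otherwise e' annihilates the essential socle from the right and is therefore singular,
  against the choice of \<open>es\<close>.\<close>

lemma hits_surj:
  assumes e': "e' \<in> set es"
  shows "\<exists>e\<in>set es. hits e e'"
proof (rule ccontr)
  assume no: "\<not> ?thesis"
  have "e' \<in> left_singular R"
  proof (rule left_singularI[OF es_carrier[OF e']])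
    fix y assume y: "y \<in> carrier R" "y \<noteq> \<zero>"
    obtain e r where er: "e \<in> set es" "r \<in> carrier R" "r \<otimes> y \<in> V e" "r \<otimes> y \<noteq> \<zero>"
      by (rule simple_element[OF y])
    then have "r \<otimes> y \<otimes> e' = \<zero>" using no unfolding hits_def by blast
    then show "\<exists>r\<in>carrier R. r \<otimes> y \<noteq> \<zero> \<and> r \<otimes> y \<otimes> e' = \<zero>" using er by blast
  qed
  then show False using es e' by blast
qed

text \<open>Both x e1 and y generate the right module \<open>V e\<close>, so y = x e1 u. Then x(e1 u
  e2) = y e2 is non-zero, and since Z annihilates \<open>V e\<close>, the factor e1 u e2 is not in
  Z.\<close>

lemma hits_linked:
  assumes e: "e \<in> set es" "e1 \<in> set es" "e2 \<in> set es" and "hits e e1" "hits e e2"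
  shows "linked e1 e2"
proof -
  obtain x where x: "x \<in> V e" "x \<otimes> e1 \<noteq> \<zero>" using assms(4) by (auto simp: hits_def)
  obtain y where y: "y \<in> V e" "y \<otimes> e2 \<noteq> \<zero>" using assms(5) by (auto simp: hits_def)
  note c = e[THEN es_carrier] V_closed[OF x(1)]
  have y0: "y \<noteq> \<zero>" using y c by auto
  obtain u where u: "u \<in> Units R" "y = x \<otimes> e1 \<otimes> u" by (rule V_unit[OF e(1) V_mult[OF x(1) c(2)] x(2) y(1) y0])
  have cu: "u \<in> carrier R" using u by auto
  have "y \<otimes> e2 = x \<otimes> (e1 \<otimes> u \<otimes> e2)" unfolding u(2) using c cu by algebra
  then have "e1 \<otimes> u \<otimes> e2 \<notin> left_singular R" using V_mult_singular[OF e(1) x(1)] y(2) by auto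
  then show ?thesis using cu by (auto simp: linked_def)
qed

lemma linked_V:
  assumes e: "e \<in> set es" "e' \<in> set es" and x: "x \<in> V e'" and b: "b \<in> carrier R"
  shows "e \<otimes> b \<otimes> x \<in> V e"
proof -
  note c = e[THEN es_carrier] V_closed[OF x]
  have "a \<otimes> (e \<otimes> b \<otimes> x) = \<zero>" if a: "a \<in> carrier R" "a \<otimes> e \<in> left_singular R" for a
  proof -
    have "a \<otimes> e \<otimes> b \<in> left_singular R" using Z.I_r_closed[OF a(2) b] .
    then have "a \<otimes> e \<otimes> b \<otimes> x = \<zero>" using singular_mult_V[OF _ e(2) x] by blast
    then show ?thesis using a(1) b c by (simp add: m_assoc)
  qed
  then show ?thesis using b c by (simp add: V_def)
qed

text \<open>Isomorphic simple left modules have isomorphic duals: if e2 b e1 is not in Z, left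
  multiplication by e2 b is an injective homomorphism of right modules from \<open>V e1\<close> to
  \<open>V e2\<close>.\<close>

lemma linked_hits:
  assumes e: "e1 \<in> set es" "e2 \<in> set es" "e' \<in> set es" and "linked e1 e2" "hits e1 e'"
  shows "hits e2 e'"
proof -
  obtain b where b: "b \<in> carrier R" "e2 \<otimes> b \<otimes> e1 \<notin> left_singular R"
    using linked_sym[OF e(1,2) assms(4)] by (auto simp: linked_def)
  obtain x where x: "x \<in> V e1" "x \<otimes> e' \<noteq> \<zero>" using assms(5) by (auto simp: hits_def)
  note c = e[THEN es_carrier] V_closed[OF x(1)]
  have "e2 \<otimes> b \<otimes> (x \<otimes> e') \<noteq> \<zero>"
    using V_annihilator[OF e(1) V_mult[OF x(1) c(3)] x(2), of "e2 \<otimes> b"] b c by simp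
  then have "e2 \<otimes> b \<otimes> x \<otimes> e' \<noteq> \<zero>" using b(1) c by (simp add: m_assoc)
  then show ?thesis using linked_V[OF e(2,1) x(1) b(1)] by (auto simp: hits_def)
qed

text \<open>Up to linking, \<open>hits\<close> is a partial function from a finite set to itself, which is surjective,
  hence total and injective.\<close>

lemma hits_bijective:
  shows "e \<in> set es \<Longrightarrow> \<exists>e'\<in>set es. hits e e'"
    and "e1 \<in> set es \<Longrightarrow> e2 \<in> set es \<Longrightarrow> e' \<in> set es \<Longrightarrow> hits e1 e' \<Longrightarrow> hits e2 e' \<Longrightarrow> linked e1 e2"
proof -
  \<comment> \<open>\<open>c\<close> selects a representative of each class of linked elements;
    below, D is the set of representatives and \<open>p\<close> chooses for each d an element that
    hits it.\<close>
  define c where "c e = (SOME e'. e' \<in> set es \<and> linked e e')" for e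
  have c: "c e \<in> set es" "linked e (c e)" if "e \<in> set es" for e
    using someI[of "\<lambda>e'. e' \<in> set es \<and> linked e e'" e] linked_refl[OF that] that by (auto simp: c_def)
  have c_eq: "c e = c f" if "e \<in> set es" "f \<in> set es" "linked e f" for e f
  proof -
    have "(e' \<in> set es \<and> linked e e') = (e' \<in> set es \<and> linked f e')" for e'
      using linked_trans linked_sym that by blast
    then show ?thesis unfolding c_def by simp
  qed
  have c_linked: "linked e f" if "e \<in> set es" "f \<in> set es" "c e = c f" for e f
    using linked_trans[of e "c e" f] linked_sym[of f "c f"] c that by metis
  have "\<exists>e. e \<in> set es \<and> hits e d" if "d \<in> set es" for d using hits_surj[OF that] by blast
  then obtain p where p: "\<And>d. d \<in> set es \<Longrightarrow> p d \<in> set es" "\<And>d. d \<in> set es \<Longrightarrow> hits (p d) d" by metis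
  define D where "D = c ` set es"
  have D: "d \<in> set es" "c d = d" if d: "d \<in> D" for d
  proof -
    obtain e where e: "e \<in> set es" "d = c e" using d by (auto simp: D_def)
    then show "d \<in> set es" using c by simp
    show "c d = d" using c_eq[of e "c e"] c e by simp
  qed
  \<comment> \<open>The choice \<open>p\<close> separates classes because an element hits at most
    one class. On the finite set D it is then also onto, so every e is linked to some
    \<open>p d\<close>.\<close>
  have "inj_on (\<lambda>d. c (p d)) D"
  proof (rule inj_onI)
    fix d d' assume d: "d \<in> D" "d' \<in> D" and eq: "c (p d) = c (p d')"
    note d1 = D(1)[OF d(1)] and d2 = D(1)[OF d(2)]
    have "linked (p d) (p d')" by (rule c_linked[OF p(1)[OF d1] p(1)[OF d2] eq])
    then have "hits (p d') d" by (rule linked_hits[OF p(1)[OF d1] p(1)[OF d2] d1 _ p(2)[OF d1]])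
    then have "linked d d'" by (rule hits_linked[OF p(1)[OF d2] d1 d2 _ p(2)[OF d2]])
    then have "c d = c d'" by (rule c_eq[OF d1 d2])
    then show "d = d'" unfolding D(2)[OF d(1)] D(2)[OF d(2)] .
  qed
  moreover have "(\<lambda>d. c (p d)) ` D \<subseteq> D" unfolding D_def by (intro image_subsetI imageI p(1) c(1)) (auto intro: c(1))
  moreover have "finite D" by (simp add: D_def)
  ultimately have surj: "(\<lambda>d. c (p d)) ` D = D" by (intro endo_inj_surj)
  have ex: "\<exists>d\<in>D. linked e (p d)" if e: "e \<in> set es" for e
  proof -
    have "c e \<in> (\<lambda>d. c (p d)) ` D" unfolding surj using e by (simp add: D_def)
    then obtain d where d: "d \<in> D" "c e = c (p d)" by (rule imageE)
    have "linked e (p d)" by (rule c_linked[OF e p(1)[OF D(1)[OF d(1)]] d(2)])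
    then show ?thesis using d(1) by blast
  qed
  have hit: "\<exists>d\<in>D. linked e (p d) \<and> hits e d" if e: "e \<in> set es" for e
  proof -
    obtain d where d: "d \<in> D" "linked e (p d)" using ex[OF e] by blast
    note ds = D(1)[OF d(1)]
    have "linked (p d) e" by (rule linked_sym[OF e p(1)[OF ds] d(2)])
    then have "hits e d" by (rule linked_hits[OF p(1)[OF ds] e ds _ p(2)[OF ds]])
    then show ?thesis using d by blast
  qed
  then show "\<exists>e'\<in>set es. hits e e'" if "e \<in> set es" using that D(1) by blast
  \<comment> \<open>Everything that hits e' is linked to one fixed element, the chosen preimage of
    the class of e'.\<close>
  have uniq: "linked e (p (c e'))" if e: "e \<in> set es" "e' \<in> set es" "hits e e'" for e e'
  proof -
    obtain d where d: "d \<in> D" "linked e (p d)" "hits e d" using hit[OF e(1)] by blast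
    have "linked d e'" by (rule hits_linked[OF e(1) D(1)[OF d(1)] e(2) d(3) e(3)])
    then have "d = c e'" using c_eq[OF D(1)[OF d(1)] e(2)] D(2)[OF d(1)] by metis
    then show ?thesis using d(2) by (rule back_subst[of "\<lambda>d. linked e (p d)", rotated])
  qed
  show "linked e1 e2" if e: "e1 \<in> set es" "e2 \<in> set es" "e' \<in> set es" "hits e1 e'" "hits e2 e'"
  proof -
    have pe: "p (c e') \<in> set es" using p(1) c(1) e(3) by blast
    show ?thesis
      by (rule linked_trans[OF e(1) pe e(2) uniq[OF e(1,3,4)] linked_sym[OF e(2) pe uniq[OF e(2,3,5)]]])
  qed
qed

section \<open>Extension of homomorphisms from the socle\<close>

lemma V_separate:
  assumes e: "e \<in> set es" and x: "x \<in> V e" "x \<noteq> \<zero>" and y: "y \<in> V e"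
  obtains r where "r \<in> carrier R" "x \<otimes> r = y"
    "\<And>e' w. e' \<in> set es \<Longrightarrow> \<not> linked e e' \<Longrightarrow> w \<in> V e' \<Longrightarrow> w \<otimes> r = \<zero>"
proof (cases "y = \<zero>")
  case True
  show thesis by (rule that[of \<zero>]) (use True x y V_closed in auto)
next
  case False
  \<comment> \<open>Let f be hit by e. Since duality is injective on classes, f annihilates
    \<open>V e'\<close> for every e' that is not linked to e. Units s and t carry x to v and vf to
    y, so the multiplier sft, which passes through f, does both tasks.\<close>
  obtain f where f: "f \<in> set es" "hits e f" using hits_bijective(1)[OF e] by blast
  then obtain v where v: "v \<in> V e" "v \<otimes> f \<noteq> \<zero>" by (auto simp: hits_def)
  note c = es_carrier[OF e] es_carrier[OF f(1)] V_closed[OF v(1)] V_closed[OF x(1)]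
  have "v \<noteq> \<zero>" using v c by auto
  then obtain s where s: "s \<in> Units R" "v = x \<otimes> s" using V_unit[OF e x v(1)] by blast
  obtain t where t: "t \<in> Units R" "y = v \<otimes> f \<otimes> t"
    by (rule V_unit[OF e V_mult[OF v(1) c(2)] v(2) y False])
  have cs: "s \<in> carrier R" "t \<in> carrier R" using s t by auto
  show thesis
  proof (rule that[of "s \<otimes> f \<otimes> t"])
    show "s \<otimes> f \<otimes> t \<in> carrier R" using cs c by simp
    show "x \<otimes> (s \<otimes> f \<otimes> t) = y" unfolding t(2) s(2) using cs c by algebra
    fix e' w assume e': "e' \<in> set es" "\<not> linked e e'" and w: "w \<in> V e'"
    have "\<not> hits e' f" using hits_bijective(2)[OF e e'(1) f(1) f(2)] e'(2) by blast
    then have "w \<otimes> s \<otimes> f = \<zero>" using V_mult[OF w cs(1)] by (auto simp: hits_def)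
    moreover have "w \<otimes> (s \<otimes> f \<otimes> t) = w \<otimes> s \<otimes> f \<otimes> t" using cs c V_closed[OF w] by (simp add: m_assoc)
    ultimately show "w \<otimes> (s \<otimes> f \<otimes> t) = \<zero>" using cs by simp
  qed
qed

text \<open>The induction step for finitely many simple left ideals: g is the error of the
  multiplier found so far, zero on F, and r corrects it at x without disturbing F.\<close>

lemma extend_on_simple:
  assumes I: "left_ideal R I" and g: "left_linear R I g" and e: "e \<in> set es" and x: "x \<in> V e" "x \<in> I"
    and F: "F \<subseteq> I" "\<And>w. w \<in> F \<Longrightarrow> \<exists>e\<in>set es. w \<in> V e" "\<And>w. w \<in> F \<Longrightarrow> g w = \<zero>"
  shows "\<exists>r\<in>carrier R. g x = x \<otimes> r \<and> (\<forall>w\<in>F. w \<otimes> r = \<zero>)"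
proof (cases "g x = \<zero>")
  case True
  then show ?thesis using I F(1) x V_closed left_idealD(1) by (intro bexI[of _ \<zero>]) auto
next
  case gx: False
  define N where "N = {n \<in> I. g n = \<zero>}"
  have idN: "left_ideal R N" unfolding N_def by (rule left_ideal_kernel[OF g I])
  note I' = left_idealD[OF I] and N' = left_idealD[OF idN] and g' = left_linearD[OF g I]
  have cx: "x \<in> carrier R" using V_closed x by blast
  have x0: "x \<noteq> \<zero>" using gx g'(4) by auto
  have gV: "g x \<in> V e"
  proof -
    have "a \<otimes> g x = \<zero>" if a: "a \<in> carrier R" "a \<otimes> e \<in> left_singular R" for a
    proof -
      have "a \<otimes> x = \<zero>" using a x(1) by (simp add: V_def)
      then show ?thesis using g'(3)[OF a(1) x(2)] g'(4) by simp
    qed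
    then show ?thesis using g'(1)[OF x(2)] by (simp add: V_def)
  qed
  \<comment> \<open>Rx meets the kernel N trivially: x and g x are non-zero elements of
    \<open>V e\<close> and thus have the same left annihilator.\<close>
  have aN: "a \<otimes> x = \<zero>" if a: "a \<in> carrier R" "a \<otimes> x \<in> N" for a
  proof -
    have "a \<otimes> g x = \<zero>" using g'(3)[OF a(1) x(2)] a(2) by (simp add: N_def)
    then show ?thesis using V_annihilator[OF e gV gx a(1)] V_annihilator[OF e x(1) x0 a(1)] by simp
  qed
  show ?thesis
  proof (cases "\<exists>w\<in>N. w \<in> V e \<and> w \<noteq> \<zero>")
    case True
    then obtain w where w: "w \<in> N" "w \<in> V e" "w \<noteq> \<zero>" by blast
    have cw: "w \<in> carrier R" using V_closed w by blast
    have aw: "a \<otimes> w = \<zero>" if "a \<in> carrier R" "a \<otimes> x = \<zero>" for a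
      using V_annihilator[OF e w(2,3) that(1)] V_annihilator[OF e x(1) x0 that(1)] that(2) by simp
    let ?H = "{(n \<otimes> \<one>, n \<otimes> \<one>) | n. n \<in> N}"
    let ?G = "{(m \<oplus> a \<otimes> x, v \<oplus> a \<otimes> (x \<oplus> w)) | m v a. (m, v) \<in> ?H \<and> a \<in> carrier R}"
    have G: "linear_graph ?G"
      using linear_graph_add_principal[OF linear_graph_mult[OF idN one_closed one_closed] cx] cx cw by simp
    have GI: "(n \<oplus> a \<otimes> x, n \<oplus> a \<otimes> (x \<oplus> w)) \<in> ?G" if "n \<in> N" "a \<in> carrier R" for n a
    proof -
      have "(n \<otimes> \<one>, n \<otimes> \<one>) \<in> ?H" using that by blast
      then have "(n, n) \<in> ?H" using N'(1)[OF that(1)] by simp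
      then show ?thesis using that(2) by blast
    qed
    have GE: "\<exists>n a. n \<in> N \<and> a \<in> carrier R \<and> p = n \<oplus> a \<otimes> x \<and> q = n \<oplus> a \<otimes> (x \<oplus> w)" if "(p, q) \<in> ?G" for p q
      using that N'(1) by fastforce
    \<comment> \<open>The map is well defined and injective because Rx meets N trivially and w,
      which lies in N, is killed by the left annihilator of x.\<close>
    have "\<exists>u. u \<in> Units R \<and> (\<forall>p q. (p, q) \<in> ?G \<longrightarrow> p \<otimes> u = q)"
    proof (rule graph_unit[OF G])
      fix q assume "(\<zero>, q) \<in> ?G"
      then obtain n a where na: "n \<in> N" "a \<in> carrier R" "\<zero> = n \<oplus> a \<otimes> x" "q = n \<oplus> a \<otimes> (x \<oplus> w)"
        using GE by blast
      note cn = N'(1)[OF na(1)]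
      have "a \<otimes> x = (n \<oplus> a \<otimes> x) \<ominus> n" using cn na(2) cx by algebra
      also have "\<dots> \<in> N" unfolding na(3)[symmetric] by (rule N'(6)[OF N'(2) na(1)])
      finally have ax: "a \<otimes> x = \<zero>" by (rule aN[OF na(2)])
      have "q = (n \<oplus> a \<otimes> x) \<oplus> a \<otimes> w" unfolding na(4) using cn na(2) cx cw by algebra
      also have "\<dots> = a \<otimes> w" unfolding na(3)[symmetric] using na(2) cw by simp
      finally show "q = \<zero>" using aw[OF na(2) ax] by simp
    next
      fix p assume "(p, \<zero>) \<in> ?G"
      then obtain n a where na: "n \<in> N" "a \<in> carrier R" "p = n \<oplus> a \<otimes> x" "\<zero> = n \<oplus> a \<otimes> (x \<oplus> w)"
        using GE by blast
      note cn = N'(1)[OF na(1)]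
      have "a \<otimes> x = (n \<oplus> a \<otimes> (x \<oplus> w)) \<ominus> (n \<oplus> a \<otimes> w)" using cn na(2) cx cw by algebra
      also have "\<dots> \<in> N" unfolding na(4)[symmetric]
        by (intro N'(6)[OF N'(2)] N'(3) N'(4) na(1,2) w(1))
      finally have ax: "a \<otimes> x = \<zero>" by (rule aN[OF na(2)])
      have "p = (n \<oplus> a \<otimes> (x \<oplus> w)) \<ominus> a \<otimes> w" unfolding na(3) using cn na(2) cx cw by algebra
      also have "\<dots> = \<zero>" unfolding na(4)[symmetric] using aw[OF na(2) ax] by (simp add: minus_eq)
      finally show "p = \<zero>" .
    qed
    then obtain u where u: "u \<in> Units R" "\<forall>p q. (p, q) \<in> ?G \<longrightarrow> p \<otimes> u = q"
      by (elim exE conjE) (rule that)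
    note uG = u(2)[rule_format]
    have cu: "u \<in> carrier R" using u(1) by auto
    have nu: "n \<otimes> u = n" if "n \<in> N" for n
      using uG[OF GI[OF that zero_closed]] N'(1)[OF that] cx cw by simp
    have xu: "x \<otimes> u = x \<oplus> w" using uG[OF GI[OF N'(2) one_closed]] cx cw by simp
    obtain t where t: "t \<in> Units R" "g x = w \<otimes> t" by (rule V_unit[OF e w(2,3) gV gx])
    have ct: "t \<in> carrier R" using t(1) by auto
    \<comment> \<open>Right multiplication by u - 1 kills N and sends x to w; the unit t then moves
      w to g x.\<close>
    have r: "n \<otimes> ((u \<ominus> \<one>) \<otimes> t) = (n \<otimes> u \<ominus> n) \<otimes> t" if "n \<in> carrier R" for n
      using that cu ct by (simp add: ring_simprules)
    have "x \<otimes> ((u \<ominus> \<one>) \<otimes> t) = g x"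
    proof -
      have "x \<oplus> w \<ominus> x = w" using cx cw by algebra
      then show ?thesis unfolding r[OF cx] xu t(2) by simp
    qed
    moreover have "v \<otimes> ((u \<ominus> \<one>) \<otimes> t) = \<zero>" if "v \<in> F" for v
    proof -
      have "v \<in> N" using that F(1,3) by (auto simp: N_def)
      note vN = N'(1)[OF this] and uN = nu[OF this]
      show ?thesis unfolding r[OF vN] uN using vN ct by (simp add: minus_eq r_neg)
    qed
    ultimately show ?thesis using cu ct by (intro bexI[of _ "(u \<ominus> \<one>) \<otimes> t"]) auto
  next
    case no: False
    obtain r where r: "r \<in> carrier R" "x \<otimes> r = g x"
      "\<And>e' w. e' \<in> set es \<Longrightarrow> \<not> linked e e' \<Longrightarrow> w \<in> V e' \<Longrightarrow> w \<otimes> r = \<zero>"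
      by (rule V_separate[OF e x(1) x0 gV]) blast
    have "w \<otimes> r = \<zero>" if w: "w \<in> F" for w
    proof (cases "w = \<zero>")
      case False
      obtain e' where e': "e' \<in> set es" "w \<in> V e'" using F(2)[OF w] by blast
      have wN: "w \<in> N" using w F by (auto simp: N_def)
      \<comment> \<open>A linked w in N would yield a non-zero element ebw of \<open>V e\<close> in
        N, which is the previous case.\<close>
      have "\<not> linked e e'"
      proof
        assume "linked e e'"
        then obtain b where b: "b \<in> carrier R" "e \<otimes> b \<otimes> e' \<notin> left_singular R" by (auto simp: linked_def)
        have ceb: "e \<otimes> b \<in> carrier R" using b(1) es_carrier[OF e] by simp
        have "e \<otimes> b \<otimes> w \<noteq> \<zero>" using V_annihilator[OF e'(1,2) False ceb] b(2) by simp
        moreover have "e \<otimes> b \<otimes> w \<in> V e" by (rule linked_V[OF e e' b(1)])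
        moreover have "e \<otimes> b \<otimes> w \<in> N" by (rule N'(4)[OF ceb wN])
        ultimately show False using no by blast
      qed
      then show ?thesis using r(3) e' by blast
    qed (use r in simp)
    then show ?thesis using r by (intro bexI[of _ r]) auto
  qed
qed

lemma extend_on_simples:
  assumes I: "left_ideal R I" and f: "left_linear R I f" and "finite F"
    and F: "F \<subseteq> I" "\<And>w. w \<in> F \<Longrightarrow> \<exists>e\<in>set es. w \<in> V e"
  shows "\<exists>r\<in>carrier R. \<forall>w\<in>F. f w = w \<otimes> r"
  using assms(3-5)
proof (induction F rule: finite_induct)
  case (insert x F)
  then obtain r where r: "r \<in> carrier R" "\<forall>w\<in>F. f w = w \<otimes> r" by auto
  note I' = left_idealD[OF I]
  let ?g = "\<lambda>w. f w \<ominus> w \<otimes> r"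
  have g: "left_linear R I ?g" by (rule left_linear_diff_mult[OF f I r(1)])
  obtain e where e: "e \<in> set es" "x \<in> V e" using insert.prems by blast
  have x: "x \<in> I" "x \<in> carrier R" and F: "F \<subseteq> I" using insert.prems I'(1) by auto
  have cF: "w \<in> carrier R" if "w \<in> F" for w using that F I'(1) by blast
  have "?g w = \<zero>" if "w \<in> F" for w using r that cF[OF that] by simp
  then obtain s where s: "s \<in> carrier R" "?g x = x \<otimes> s" "\<forall>w\<in>F. w \<otimes> s = \<zero>"
    using extend_on_simple[OF I g e x(1) F] insert.prems by auto
  have fx: "f x \<in> carrier R" using left_linearD(1)[OF f I x(1)] .
  have "f x = ?g x \<oplus> x \<otimes> r" using fx x r(1) by algebra
  also have "\<dots> = x \<otimes> (r \<oplus> s)" unfolding s(2) using x r(1) s(1) by algebra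
  finally have "f x = x \<otimes> (r \<oplus> s)" .
  moreover have "f w = w \<otimes> (r \<oplus> s)" if "w \<in> F" for w
    using r s that cF[OF that] by (simp add: r_distr)
  ultimately show ?case using r(1) s(1) by (intro bexI[of _ "r \<oplus> s"]) auto
qed auto

text \<open>Once \<open>f\<close> is multiplication by \<open>r\<close> on the socle of \<open>I\<close>, the map \<open>x \<mapsto> x + (f x - xr)\<close> is
  injective, as it is the identity on the socle.\<close>

lemma baer:
  assumes fin: "\<And>X. X \<subseteq> carrier R \<Longrightarrow> \<exists>F. finite F \<and> F \<subseteq> X \<and> rann R F \<subseteq> rann R X"
  shows "left_baer R"
  unfolding left_baer_def
proof (intro allI impI, elim conjE)
  fix I f assume I: "left_ideal R I" and f: "left_linear R I f"
  note I' = left_idealD[OF I] and f' = left_linearD[OF f I]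
  define W where "W = {w \<in> I. \<exists>e\<in>set es. w \<in> V e}"
  have "W \<subseteq> carrier R" using I'(1) by (auto simp: W_def)
  then obtain F where F: "finite F" "F \<subseteq> W" "rann R F \<subseteq> rann R W" using fin by blast
  have WI: "w \<in> I" "w \<in> carrier R" if "w \<in> W" for w using that I'(1) by (auto simp: W_def)
  have "F \<subseteq> I" "\<And>w. w \<in> F \<Longrightarrow> \<exists>e\<in>set es. w \<in> V e" using F(2) by (auto simp: W_def)
  from extend_on_simples[OF I f F(1) this]
  obtain r where r: "r \<in> carrier R" "\<forall>w\<in>F. f w = w \<otimes> r" by blast
  \<comment> \<open>F has the same right annihilator as all of W. If s is a multiplier for F
    together with w, then s - r annihilates F, hence w, so r already works at w.\<close>
  have fW: "f w = w \<otimes> r" if w: "w \<in> W" for w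
  proof -
    have "insert w F \<subseteq> I" "\<And>w'. w' \<in> insert w F \<Longrightarrow> \<exists>e\<in>set es. w' \<in> V e" using F(2) w by (auto simp: W_def)
    from extend_on_simples[OF I f finite.insertI[OF F(1)] this]
    obtain s where s: "s \<in> carrier R" "\<forall>w'\<in>insert w F. f w' = w' \<otimes> s" by blast
    have "w' \<otimes> (s \<ominus> r) = \<zero>" if w': "w' \<in> F" for w'
    proof -
      have c: "w' \<in> carrier R" using w' F(2) WI by blast
      have eq: "w' \<otimes> s = w' \<otimes> r" using r(2) s(2) w' by auto
      have "w' \<otimes> (s \<ominus> r) = w' \<otimes> s \<ominus> w' \<otimes> r" using c r(1) s(1) by algebra
      then show ?thesis unfolding eq using c r(1) by simp
    qed
    then have "s \<ominus> r \<in> rann R W" using F(3) r(1) s(1) by (auto simp: rann_def)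
    then have "w \<otimes> (s \<ominus> r) = \<zero>" using w by (simp add: rann_def)
    moreover have "w \<otimes> (s \<ominus> r) = w \<otimes> s \<ominus> w \<otimes> r" using WI[OF w] r(1) s(1) by algebra
    ultimately have "w \<otimes> s = w \<otimes> r" using WI[OF w] r(1) s(1) by simp
    then show ?thesis using s(2) by simp
  qed
  define h where "h x = f x \<ominus> x \<otimes> (r \<ominus> \<one>)" for x
  have h: "left_linear R I h" unfolding h_def by (rule left_linear_diff_mult[OF f I]) (use r in simp)
  note h' = left_linearD[OF h I]
  have hW: "h w = w" if w: "w \<in> W" for w
  proof -
    have "h w = w \<otimes> r \<ominus> w \<otimes> (r \<ominus> \<one>)" unfolding h_def fW[OF w] ..
    also have "\<dots> = w" using WI[OF w] r(1) by (simp add: ring_simprules)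
    finally show ?thesis .
  qed
  have h0: "x = \<zero>" if x: "x \<in> I" "h x = \<zero>" for x
  proof (rule ccontr)
    assume "x \<noteq> \<zero>"
    then obtain e s where es: "e \<in> set es" "s \<in> carrier R" "s \<otimes> x \<in> V e" "s \<otimes> x \<noteq> \<zero>"
      using simple_element[OF I'(1)[OF x(1)]] by blast
    have "s \<otimes> x \<in> W" using es I'(4)[OF es(2) x(1)] by (auto simp: W_def)
    then have "s \<otimes> x = s \<otimes> h x" using hW h'(3)[OF es(2) x(1)] by metis
    then show False using x(2) es by simp
  qed
  have "inj_on h I"
  proof (rule inj_onI)
    fix x y assume xy: "x \<in> I" "y \<in> I" "h x = h y"
    have "h (x \<ominus> y) = h x \<ominus> h y" using h'(5) xy by blast
    also have "\<dots> = \<zero>" unfolding xy(3) using h'(1)[OF xy(2)] by simp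
    finally have "x \<ominus> y = \<zero>" using h0[OF I'(6)[OF xy(1,2)]] by blast
    then show "x = y" using I'(1) xy by simp
  qed
  from mono_unit[OF I h this] obtain u where u: "u \<in> Units R" "\<forall>x\<in>I. h x = x \<otimes> u" by blast
  have cu: "u \<in> carrier R" using u by auto
  have "f x = x \<otimes> (u \<oplus> (r \<ominus> \<one>))" if x: "x \<in> I" for x
  proof -
    have "f x = h x \<oplus> x \<otimes> (r \<ominus> \<one>)" unfolding h_def using f'(1)[OF x] I'(1)[OF x] r(1) by algebra
    also have "h x = x \<otimes> u" using u(2) x by simp
    finally show ?thesis using I'(1)[OF x] cu r(1) by (simp add: r_distr)
  qed
  then show "\<exists>r\<in>carrier R. \<forall>x\<in>I. f x = x \<otimes> r" using cu r(1) by (intro bexI[of _ "u \<oplus> (r \<ominus> \<one>)"]) auto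
qed

text \<open>If a is not in I, the submodule of R/I generated by a contains a simple one, generated
  by the class of x = sa. All the duals are non-zero, so this one embeds into R by x to y. The map
  that is zero on I and sends x to y is multiplication by some r; then r annihilates I from the
  right, but ar is non-zero.\<close>

lemma lann_rann_left_ideal:
  assumes baer: "left_baer R" and I: "left_ideal R I"
  shows "lann R (rann R I) = I"
proof
  note I' = left_idealD[OF I]
  show "I \<subseteq> lann R (rann R I)" using subset_lann_rann[of I R] I'(1) by blast
  show "lann R (rann R I) \<subseteq> I"
  proof (rule ccontr)
    assume "\<not> ?thesis"
    then obtain a where a: "a \<in> lann R (rann R I)" "a \<notin> I" by blast
    have ca: "a \<in> carrier R" using a(1) by (simp add: lann_def)
    let ?K = "{x \<in> carrier R. x \<otimes> a \<in> I}"
    have K: "left_ideal R ?K" by (rule left_ideal_transporter[OF I ca])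
    have "\<one> \<notin> ?K" using a(2) ca by simp
    then obtain e s where e: "e \<in> set es" and s: "s \<in> carrier R" "s \<notin> ?K"
      and es: "\<And>b. b \<in> carrier R \<Longrightarrow> b \<otimes> e \<in> left_singular R \<Longrightarrow> b \<otimes> s \<in> ?K"
      using simple_submodule[OF K] by blast
    obtain y where y: "y \<in> V e" "y \<noteq> \<zero>"
      using hits_bijective(1)[OF e] es_carrier unfolding hits_def by (metis l_null)
    have cy: "y \<in> carrier R" using V_closed y by blast
    define x where "x = s \<otimes> a"
    have x: "x \<in> carrier R" "x \<notin> I" using s ca by (auto simp: x_def)
    \<comment> \<open>This makes the map well defined. If by were non-zero, b would be invertible
      from the left modulo the maximal left ideal that belongs to e, and x would be recovered in I
      from bx.\<close>
    have bx: "b \<otimes> y = \<zero>" if b: "b \<in> carrier R" "b \<otimes> x \<in> I" for b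
    proof (rule ccontr)
      assume "b \<otimes> y \<noteq> \<zero>"
      then have "b \<otimes> e \<notin> left_singular R" using V_annihilator[OF e y b(1)] by simp
      then obtain c where c: "c \<in> carrier R" "c \<otimes> b \<otimes> e \<ominus> e \<in> left_singular R" using left_min[OF e b(1)] by blast
      have "(c \<otimes> b \<ominus> \<one>) \<otimes> e = c \<otimes> b \<otimes> e \<ominus> e" using c(1) b(1) es_carrier[OF e] by algebra
      then have "(c \<otimes> b \<ominus> \<one>) \<otimes> s \<in> ?K" using es[of "c \<otimes> b \<ominus> \<one>"] c b(1) by simp
      then have 1: "(c \<otimes> b \<ominus> \<one>) \<otimes> s \<otimes> a \<in> I" by simp
      have "x = c \<otimes> (b \<otimes> x) \<ominus> (c \<otimes> b \<ominus> \<one>) \<otimes> s \<otimes> a" unfolding x_def using c(1) b(1) s(1) ca by algebra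
      also have "\<dots> \<in> I" by (intro I'(6) I'(4) c(1) b(2) 1)
      finally show False using x(2) by simp
    qed
    let ?H = "{(n \<otimes> \<one>, n \<otimes> \<zero>) | n. n \<in> I}"
    let ?G = "{(m \<oplus> b \<otimes> x, v \<oplus> b \<otimes> y) | m v b. (m, v) \<in> ?H \<and> b \<in> carrier R}"
    have G: "linear_graph ?G"
      by (rule linear_graph_add_principal[OF linear_graph_mult[OF I one_closed zero_closed] x(1) cy])
    have "\<exists>r. r \<in> carrier R \<and> (\<forall>p v. (p, v) \<in> ?G \<longrightarrow> p \<otimes> r = v)"
    proof (rule baer_graph[OF baer G])
      fix v assume "(\<zero>, v) \<in> ?G"
      then obtain n b where n: "n \<in> I" "b \<in> carrier R" "\<zero> = n \<otimes> \<one> \<oplus> b \<otimes> x" "v = n \<otimes> \<zero> \<oplus> b \<otimes> y" by blast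
      note cn = I'(1)[OF n(1)]
      have "b \<otimes> x = (n \<otimes> \<one> \<oplus> b \<otimes> x) \<ominus> n" using cn n(2) x(1) by (simp add: ring_simprules)
      also have "\<dots> \<in> I" unfolding n(3)[symmetric] by (rule I'(6)[OF I'(2) n(1)])
      finally have "b \<otimes> y = \<zero>" by (rule bx[OF n(2)])
      then show "v = \<zero>" using n(4) cn by simp
    qed
    then obtain r where r: "r \<in> carrier R" "\<forall>p v. (p, v) \<in> ?G \<longrightarrow> p \<otimes> r = v"
      by (elim exE conjE) (rule that)
    note rG = r(2)[rule_format]
    have "n \<otimes> r = \<zero>" if n: "n \<in> I" for n
    proof -
      have "(n \<otimes> \<one>, n \<otimes> \<zero>) \<in> ?H" using n by blast
      then have "(n \<otimes> \<one> \<oplus> \<zero> \<otimes> x, n \<otimes> \<zero> \<oplus> \<zero> \<otimes> y) \<in> ?G" using zero_closed by blast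
      from rG[OF this] show ?thesis using I'(1)[OF n] x(1) cy by simp
    qed
    then have "r \<in> rann R I" using r(1) by (simp add: rann_def)
    then have ar: "a \<otimes> r = \<zero>" by (rule lannD[OF a(1)])
    have "(\<zero> \<otimes> \<one>, \<zero> \<otimes> \<zero>) \<in> ?H" using I'(2) by blast
    then have "(\<zero> \<otimes> \<one> \<oplus> \<one> \<otimes> x, \<zero> \<otimes> \<zero> \<oplus> \<one> \<otimes> y) \<in> ?G" using one_closed by blast
    from rG[OF this] have "x \<otimes> r = y" using x(1) cy by simp
    then have "s \<otimes> (a \<otimes> r) = y" unfolding x_def using s(1) ca r(1) by (simp add: m_assoc)
    then show False using ar y(2) s(1) by simp
  qed
qed

end

section \<open>Annihilator duality and self-injectivity\<close>

context ring
begin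

lemma left_ideal_principal_right:
  assumes "left_ideal (opposite_ring R) T" "a \<in> carrier R"
  shows "left_ideal (opposite_ring R) {a \<otimes> d | d. d \<in> T}"
proof -
  interpret op: ring "opposite_ring R" by (rule ring_opposite_ring)
  note T = op.left_idealD[OF assms(1), simplified]
  have eq: "a \<otimes> d \<oplus> a \<otimes> d' = a \<otimes> (d \<oplus> d')" "(a \<otimes> d) \<otimes> b = a \<otimes> (d \<otimes> b)"
    if "d \<in> T" "d' \<in> T" "b \<in> carrier R" for d d' b
    using T(1)[OF that(1)] T(1)[OF that(2)] that(3) assms(2) by (simp_all add: r_distr m_assoc)
  show ?thesis
    unfolding left_ideal_def
  proof (intro conjI ballI subsetI; simp)
    show "\<exists>d. \<zero> = a \<otimes> d \<and> d \<in> T" using T(2) assms(2) by (intro exI[of _ \<zero>]) simp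
    show "x \<in> carrier R" if "\<exists>d. x = a \<otimes> d \<and> d \<in> T" for x using that T(1) assms(2) by auto
    fix x assume "\<exists>d. x = a \<otimes> d \<and> d \<in> T"
    then obtain d where d: "x = a \<otimes> d" "d \<in> T" by blast
    show "\<exists>e. x \<otimes> b = a \<otimes> e \<and> e \<in> T" if "b \<in> carrier R" for b
      using eq(2)[OF d(2) d(2) that] T(4)[OF that d(2)] d(1) by blast
    show "\<exists>e. x \<oplus> y = a \<otimes> e \<and> e \<in> T" if y: "\<exists>d. y = a \<otimes> d \<and> d \<in> T" for y
    proof -
      obtain d' where d': "y = a \<otimes> d'" "d' \<in> T" using y by blast
      show ?thesis unfolding d(1) d'(1) using eq(1)[OF d(2) d'(2) one_closed] T(3)[OF d(2) d'(2)] by blast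
    qed
  qed
qed

text \<open>For \<open>c\<close> in the right annihilator of \<open>l(F) \<inter> l(a)\<close>, the map \<open>ya \<mapsto> yc\<close> on \<open>l(F)a\<close> is
  well defined.\<close>

lemma baer_rann_lann_finite:
  assumes baer: "left_baer R" and T: "left_ideal (opposite_ring R) T" and "finite F" "F \<subseteq> T"
  shows "rann R (lann R F) \<subseteq> T"
  using assms(3,4)
proof (induction F rule: finite_induct)
  interpret op: ring "opposite_ring R" by (rule ring_opposite_ring)
  note T' = op.left_idealD[OF T, simplified]
  case empty
  have "r = \<zero>" if "r \<in> rann R (lann R {})" for r
  proof -
    have "r \<in> carrier R" "\<one> \<otimes> r = \<zero>" using that by (auto simp: rann_def lann_def)
    then show ?thesis by simp
  qed
  then show ?case using T'(2) by auto
next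
  interpret op: ring "opposite_ring R" by (rule ring_opposite_ring)
  note T' = op.left_idealD[OF T, simplified]
  case (insert a F)
  have a: "a \<in> carrier R" "a \<in> T" and FT: "F \<subseteq> T" "F \<subseteq> carrier R" using insert.prems T'(1) by auto
  have N: "left_ideal R (lann R F)" by (rule left_ideal_lann[OF FT(2)])
  show ?case
  proof
    fix c assume c: "c \<in> rann R (lann R (insert a F))"
    have cc: "c \<in> carrier R" using c by (simp add: rann_def)
    let ?G = "{(y \<otimes> a, y \<otimes> c) | y. y \<in> lann R F}"
    have "\<exists>s. s \<in> carrier R \<and> (\<forall>p v. (p, v) \<in> ?G \<longrightarrow> p \<otimes> s = v)"
    proof (rule baer_graph[OF baer linear_graph_mult[OF N a(1) cc]])
      fix v assume "(\<zero>, v) \<in> ?G"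
      then obtain y where y: "\<zero> = y \<otimes> a" "v = y \<otimes> c" "y \<in> lann R F" by blast
      then have "y \<in> lann R (insert a F)" by (auto simp: lann_def)
      then show "v = \<zero>" using c y(2) by (simp add: rann_def)
    qed
    then obtain s where s: "s \<in> carrier R" "\<forall>p v. (p, v) \<in> ?G \<longrightarrow> p \<otimes> s = v"
      by (elim exE conjE) (rule that)
    \<comment> \<open>Thus c - as lies in r(l(F)), which the induction hypothesis places in
      T.\<close>
    have "y \<otimes> (c \<ominus> a \<otimes> s) = \<zero>" if y: "y \<in> lann R F" for y
    proof -
      have cy: "y \<in> carrier R" using y by (simp add: lann_def)
      have "(y \<otimes> a, y \<otimes> c) \<in> ?G" using y by blast
      from s(2)[rule_format, OF this] have "y \<otimes> a \<otimes> s = y \<otimes> c" .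
      moreover have "y \<otimes> (c \<ominus> a \<otimes> s) = y \<otimes> c \<ominus> y \<otimes> a \<otimes> s" using cy cc a(1) s(1) by algebra
      ultimately show ?thesis using cy cc by simp
    qed
    then have "c \<ominus> a \<otimes> s \<in> rann R (lann R F)" using cc a(1) s(1) by (simp add: rann_def)
    then have "c \<ominus> a \<otimes> s \<in> T" using insert.IH FT(1) by blast
    then have "(c \<ominus> a \<otimes> s) \<oplus> a \<otimes> s \<in> T" using T'(3) T'(4)[OF s(1) a(2)] by blast
    moreover have "(c \<ominus> a \<otimes> s) \<oplus> a \<otimes> s = c" using cc a(1) s(1) by algebra
    ultimately show "c \<in> T" by simp
  qed
qed

section \<open>Exchange of chain conditions between the two sides\<close>

lemma left_artinian_imp_dcc: "left_artinian R \<Longrightarrow> left_dcc R"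
  unfolding left_dcc_def
proof (intro allI impI, elim conjE)
  fix \<S> assume art: "left_artinian R" and ne: "\<S> \<noteq> {}" and id: "\<forall>I\<in>\<S>. left_ideal R I"
  let ?r = "{(K, I). K \<in> \<S> \<and> I \<in> \<S> \<and> K \<subset> I}"
  have "wf ?r"
    unfolding wf_iff_no_infinite_down_chain
  proof clarify
    fix N assume N: "\<forall>i. (N (Suc i), N i) \<in> ?r"
    then have "(\<forall>i. submodule (N i) R (regular_module R)) \<and> (\<forall>i. N (Suc i) \<subseteq> N i)"
      using id by (auto simp: left_ideal_iff_submodule)
    then obtain k where k: "\<forall>i\<ge>k. N i = N k"
      using art unfolding left_artinian_def artinian_module_def by meson
    have "N (Suc k) = N k" by (rule k[rule_format]) simp
    moreover have "N (Suc k) \<subset> N k" using N by simp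
    ultimately show False by simp
  qed
  then obtain I where "I \<in> \<S>" "\<And>K. (K, I) \<in> ?r \<Longrightarrow> K \<notin> \<S>"
    by (rule wfE_min'[OF _ ne]) blast
  then show "\<exists>I\<in>\<S>. \<forall>K\<in>\<S>. K \<subseteq> I \<longrightarrow> K = I" by blast
qed

text \<open>Taking left annihilators is order-reversing and, by \<open>dual\<close>, injective on
  right ideals, so a maximal annihilator comes from a minimal right ideal.\<close>

lemma annihilator_duality_acc_imp_dcc:
  assumes acc: "left_acc R" and dual: "\<And>T. left_ideal (opposite_ring R) T \<Longrightarrow> rann R (lann R T) = T"
  shows "left_dcc (opposite_ring R)"
  unfolding left_dcc_def
proof (intro allI impI, elim conjE)
  fix \<S> assume ne: "\<S> \<noteq> {}" and id: "\<forall>I\<in>\<S>. left_ideal (opposite_ring R) I"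
  let ?P = "\<lambda>K. K \<in> lann R ` \<S>"
  obtain T0 where "T0 \<in> \<S>" using ne by blast
  then have "?P (lann R T0)" by blast
  moreover have "left_ideal R K" if K: "?P K" for K
  proof -
    obtain T where T: "T \<in> \<S>" "K = lann R T" using K by blast
    have "T \<subseteq> carrier R" using id[rule_format, OF T(1)] by (simp add: left_ideal_def)
    then show ?thesis unfolding T(2) by (rule left_ideal_lann)
  qed
  ultimately obtain K where K: "?P K" "\<And>L. ?P L \<Longrightarrow> K \<subseteq> L \<Longrightarrow> L = K"
    using left_accE[where P = ?P, OF acc] by metis
  then obtain T where T: "T \<in> \<S>" "K = lann R T" by blast
  have "T' = T" if T': "T' \<in> \<S>" "T' \<subseteq> T" for T'
  proof -
    have "lann R T' = lann R T" using K(2)[OF imageI[OF T'(1)]] lann_antimono[OF T'(2)] unfolding T(2) by blast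
    then show ?thesis using dual[OF id[rule_format, OF T'(1)]] dual[OF id[rule_format, OF T(1)]] by metis
  qed
  then show "\<exists>I\<in>\<S>. \<forall>K\<in>\<S>. K \<subseteq> I \<longrightarrow> K = I" using T(1) by blast
qed

lemma annihilator_duality_dcc_imp_acc:
  assumes dcc: "left_dcc R" and dual: "\<And>T. left_ideal (opposite_ring R) T \<Longrightarrow> rann R (lann R T) = T"
  shows "left_acc (opposite_ring R)"
  unfolding left_acc_def
proof (intro allI impI, elim conjE)
  fix \<S> assume ne: "\<S> \<noteq> {}" and id: "\<forall>I\<in>\<S>. left_ideal (opposite_ring R) I"
  let ?P = "\<lambda>K. K \<in> lann R ` \<S>"
  obtain T0 where "T0 \<in> \<S>" using ne by blast
  then have "?P (lann R T0)" by blast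
  moreover have "left_ideal R K" if K: "?P K" for K
  proof -
    obtain T where T: "T \<in> \<S>" "K = lann R T" using K by blast
    have "T \<subseteq> carrier R" using id[rule_format, OF T(1)] by (simp add: left_ideal_def)
    then show ?thesis unfolding T(2) by (rule left_ideal_lann)
  qed
  ultimately obtain K where K: "?P K" "\<And>L. ?P L \<Longrightarrow> L \<subseteq> K \<Longrightarrow> L = K"
    using left_dccE[where P = ?P, OF dcc] by metis
  then obtain T where T: "T \<in> \<S>" "K = lann R T" by blast
  have "T' = T" if T': "T' \<in> \<S>" "T \<subseteq> T'" for T'
  proof -
    have "lann R T' = lann R T" using K(2)[OF imageI[OF T'(1)]] lann_antimono[OF T'(2)] unfolding T(2) by blast
    then show ?thesis using dual[OF id[rule_format, OF T'(1)]] dual[OF id[rule_format, OF T(1)]] by metis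
  qed
  then show "\<exists>I\<in>\<S>. \<forall>K\<in>\<S>. I \<subseteq> K \<longrightarrow> K = I" using T(1) by blast
qed

text \<open>If \<open>g\<close> vanishes on \<open>N\<close>, then the solutions \<open>d\<close> of \<open>Nd = 0\<close> and \<open>ad = g a\<close> exist because
  \<open>g a\<close> lies in the right ideal \<open>a r(N)\<close>, which is an annihilator.\<close>

lemma annihilator_duality_baer:
  assumes acc: "left_acc R"
    and left: "\<And>I. left_ideal R I \<Longrightarrow> lann R (rann R I) = I"
    and right: "\<And>T. left_ideal (opposite_ring R) T \<Longrightarrow> rann R (lann R T) = T"
  shows "left_baer R"
  unfolding left_baer_def
proof (intro allI impI, elim conjE)
  fix I f assume I: "left_ideal R I" and f: "left_linear R I f"
  note I' = left_idealD[OF I] and f' = left_linearD[OF f I]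
  have fin: "\<exists>c\<in>carrier R. \<forall>x\<in>F. f x = x \<otimes> c" if "finite F" "F \<subseteq> I" for F
    using that
  proof (induction F rule: finite_induct)
    case (insert a F)
    then obtain c where c: "c \<in> carrier R" "\<forall>x\<in>F. f x = x \<otimes> c" by auto
    have F: "F \<subseteq> I" and a: "a \<in> I" "a \<in> carrier R" using insert.prems I'(1) by auto
    define g where "g x = f x \<ominus> x \<otimes> c" for x
    have g: "left_linear R I g" unfolding g_def by (rule left_linear_diff_mult[OF f I c(1)])
    note g' = left_linearD[OF g I]
    define N where "N = {n \<in> I. g n = \<zero>}"
    have idN: "left_ideal R N" unfolding N_def by (rule left_ideal_kernel[OF g I])
    have NI: "N \<subseteq> carrier R" using I'(1) by (auto simp: N_def)
    have FN: "x \<in> N" if x: "x \<in> F" for x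
    proof -
      have "x \<in> I" using x F by blast
      then show ?thesis using c x I'(1) by (simp add: N_def g_def)
    qed
    define T where "T = {a \<otimes> d | d. d \<in> rann R N}"
    have T: "left_ideal (opposite_ring R) T"
      unfolding T_def by (rule left_ideal_principal_right[OF left_ideal_opposite_rann[OF NI] a(2)])
    have "r \<otimes> g a = \<zero>" if r: "r \<in> lann R T" for r
    proof -
      have cr: "r \<in> carrier R" using r by (simp add: lann_def)
      have "r \<otimes> a \<otimes> d = \<zero>" if d: "d \<in> rann R N" for d
      proof -
        have "a \<otimes> d \<in> T" using d unfolding T_def by blast
        then have "r \<otimes> (a \<otimes> d) = \<zero>" by (rule lannD[OF r])
        moreover have "d \<in> carrier R" using d by (simp add: rann_def)
        ultimately show ?thesis using cr a(2) by (simp add: m_assoc)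
      qed
      \<comment> \<open>As N equals its double annihilator, ra lies in the kernel of g, hence r
        annihilates g a.\<close>
      then have "r \<otimes> a \<in> lann R (rann R N)" using cr a(2) by (intro lannI m_closed)
      then have "g (r \<otimes> a) = \<zero>" unfolding left[OF idN] by (simp add: N_def)
      then show ?thesis using g'(3)[OF cr a(1)] by simp
    qed
    then have "g a \<in> rann R (lann R T)" using g'(1)[OF a(1)] by (simp add: rann_def)
    then have "g a \<in> T" unfolding right[OF T] .
    then obtain d where d: "g a = a \<otimes> d" "d \<in> rann R N" unfolding T_def by blast
    have cd: "d \<in> carrier R" using d(2) by (simp add: rann_def)
    have "f a = g a \<oplus> a \<otimes> c" unfolding g_def using f'(1)[OF a(1)] a(2) c(1) by algebra
    then have "f a = a \<otimes> (c \<oplus> d)" unfolding d(1) using a(2) c(1) cd by (simp add: r_distr a_comm)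
    moreover have "f x = x \<otimes> (c \<oplus> d)" if x: "x \<in> F" for x
    proof -
      have "x \<otimes> d = \<zero>" using d(2) FN[OF x] by (simp add: rann_def)
      moreover have "x \<in> carrier R" using FN[OF x] NI by blast
      ultimately show ?thesis using c x cd by (simp add: r_distr)
    qed
    ultimately show ?case using c(1) cd by (intro bexI[of _ "c \<oplus> d"]) auto
  qed auto
  interpret op: ring "opposite_ring R" by (rule ring_opposite_ring)
  have IR: "I \<subseteq> carrier R" using I'(1) by blast
  obtain F where F: "finite F" "F \<subseteq> I" "rann R F \<subseteq> rann R I"
    using op.finite_lann[of I, simplified] acc IR by blast
  obtain c where c: "c \<in> carrier R" "\<forall>x\<in>F. f x = x \<otimes> c" using fin[OF F(1,2)] by blast
  let ?g = "\<lambda>x. f x \<ominus> x \<otimes> c"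
  have g: "left_linear R I ?g" by (rule left_linear_diff_mult[OF f I c(1)])
  let ?N = "{n \<in> I. ?g n = \<zero>}"
  have idN: "left_ideal R ?N" by (rule left_ideal_kernel[OF g I])
  have "x \<in> ?N" if x: "x \<in> F" for x
  proof -
    have "x \<in> I" using x F by blast
    then show ?thesis using c x I'(1) by simp
  qed
  \<comment> \<open>The multiplier c was chosen for F only. The set where it agrees with f contains
    F, so its right annihilator kills I; since both are double annihilators, I is contained in that
    set.\<close>
  then have "rann R ?N \<subseteq> rann R F" by (intro rann_antimono subsetI)
  then have "rann R ?N \<subseteq> rann R I" using F(3) by (rule order_trans)
  then have "lann R (rann R I) \<subseteq> lann R (rann R ?N)" by (rule lann_antimono)
  then have "I \<subseteq> ?N" unfolding left[OF I] left[OF idN] .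
  then have "f x = x \<otimes> c" if "x \<in> I" for x
    using that f'(1)[OF that] I'(1)[OF that] c(1) by auto
  then show "\<exists>r\<in>carrier R. \<forall>x\<in>I. f x = x \<otimes> r" using c(1) by blast
qed

end

section \<open>From Baer's condition to injectivity\<close>

context left_module
begin

lemma smult_zero_left: "x \<in> carrier M \<Longrightarrow> \<zero> \<odot>\<^bsub>M\<^esub> x = \<zero>\<^bsub>M\<^esub>"
  using smult_l_distr[of \<zero> \<zero> x] by simp

lemma smult_uminus_one: "x \<in> carrier M \<Longrightarrow> x \<oplus>\<^bsub>M\<^esub> (\<ominus> \<one>) \<odot>\<^bsub>M\<^esub> x = \<zero>\<^bsub>M\<^esub>"
  using smult_l_distr[of \<one> "\<ominus> \<one>" x] by (simp add: R.r_neg smult_zero_left)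

end

text \<open>Zorn's lemma is applied to the graphs of the partial extensions, which are the
  single-valued submodules of \<open>B \<times> R\<close> that contain the graph of \<open>f\<close>.\<close>

lemma (in ring) baer_imp_self_injective:
  assumes baer: "left_baer R"
  shows "left_self_injective TYPE('p) TYPE('q) R"
  unfolding left_self_injective_def injective_module_def
proof (intro conjI allI impI; (elim conjE)?)
  show "left_module R (regular_module R)" by (rule left_module_regular_module)
  fix A :: "('a, 'p) module" and B :: "('a, 'q) module" and j f
  assume A: "left_module R A" and B: "left_module R B" and j: "j \<in> lmodule_hom R A B"
    and inj: "inj_on j (carrier A)" and f: "f \<in> lmodule_hom R A (regular_module R)"
  interpret A: left_module R A by fact
  interpret B: left_module R B by fact
  have jc: "j x \<in> carrier B" "f x \<in> carrier R" if "x \<in> carrier A" for x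
    using j f that by (auto simp: lmodule_hom_def)
  have ja: "j (x \<oplus>\<^bsub>A\<^esub> y) = j x \<oplus>\<^bsub>B\<^esub> j y" "f (x \<oplus>\<^bsub>A\<^esub> y) = f x \<oplus> f y"
    if "x \<in> carrier A" "y \<in> carrier A" for x y
    using j f that by (auto simp: lmodule_hom_def)
  have jm: "j (a \<odot>\<^bsub>A\<^esub> x) = a \<odot>\<^bsub>B\<^esub> j x" "f (a \<odot>\<^bsub>A\<^esub> x) = a \<otimes> f x"
    if "a \<in> carrier R" "x \<in> carrier A" for a x
    using j f that by (auto simp: lmodule_hom_def)
  have j0: "j \<zero>\<^bsub>A\<^esub> = \<zero>\<^bsub>B\<^esub>" "f \<zero>\<^bsub>A\<^esub> = \<zero>"
    using jm[of \<zero> "\<zero>\<^bsub>A\<^esub>"] jc[of "\<zero>\<^bsub>A\<^esub>"] A.smult_zero_left B.smult_zero_left by simp_all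
  define \<G> where "\<G> = {G. G \<subseteq> carrier B \<times> carrier R \<and> (\<forall>x\<in>carrier A. (j x, f x) \<in> G) \<and>
    (\<forall>p q. p \<in> G \<longrightarrow> q \<in> G \<longrightarrow> (fst p \<oplus>\<^bsub>B\<^esub> fst q, snd p \<oplus> snd q) \<in> G) \<and>
    (\<forall>a\<in>carrier R. \<forall>p\<in>G. (a \<odot>\<^bsub>B\<^esub> fst p, a \<otimes> snd p) \<in> G) \<and>
    (\<forall>v. (\<zero>\<^bsub>B\<^esub>, v) \<in> G \<longrightarrow> v = \<zero>)}"
  have graph_f: "(\<lambda>x. (j x, f x)) ` carrier A \<in> \<G>"
  proof -
    have "v = \<zero>" if v: "(\<zero>\<^bsub>B\<^esub>, v) \<in> (\<lambda>x. (j x, f x)) ` carrier A" for v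
    proof -
      obtain x where x: "x \<in> carrier A" "j x = \<zero>\<^bsub>B\<^esub>" "v = f x" using v by auto
      then have "x = \<zero>\<^bsub>A\<^esub>" using inj j0(1) by (metis inj_onD A.M.zero_closed)
      then show ?thesis using x j0 by simp
    qed
    moreover have "(j x \<oplus>\<^bsub>B\<^esub> j y, f x \<oplus> f y) \<in> (\<lambda>x. (j x, f x)) ` carrier A"
      if "x \<in> carrier A" "y \<in> carrier A" for x y
      using ja[OF that, symmetric] that by auto
    moreover have "(a \<odot>\<^bsub>B\<^esub> j x, a \<otimes> f x) \<in> (\<lambda>x. (j x, f x)) ` carrier A"
      if "a \<in> carrier R" "x \<in> carrier A" for a x
      using jm[OF that, symmetric] that by auto
    ultimately show ?thesis unfolding \<G>_def using jc by auto
  qed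
  have union: "\<Union>\<C> \<in> \<G>" if \<C>: "\<C> \<noteq> {}" "subset.chain \<G> \<C>" for \<C>
  proof -
    have mem: "C \<in> \<G>" if "C \<in> \<C>" for C using \<C>(2) that by (auto simp: subset.chain_def)
    have "(fst p \<oplus>\<^bsub>B\<^esub> fst q, snd p \<oplus> snd q) \<in> \<Union>\<C>" if pq: "p \<in> \<Union>\<C>" "q \<in> \<Union>\<C>" for p q
    proof -
      obtain C D where CD: "C \<in> \<C>" "D \<in> \<C>" "p \<in> C" "q \<in> D" using pq by blast
      then have "C \<subseteq> D \<or> D \<subseteq> C" using \<C>(2) by (auto simp: subset.chain_def)
      then obtain E where E: "E \<in> \<C>" "p \<in> E" "q \<in> E" using CD by blast
      then have "(fst p \<oplus>\<^bsub>B\<^esub> fst q, snd p \<oplus> snd q) \<in> E" using mem[OF E(1)] unfolding \<G>_def by blast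
      then show ?thesis using E(1) by blast
    qed
    moreover have "\<Union>\<C> \<subseteq> carrier B \<times> carrier R" using mem unfolding \<G>_def by blast
    moreover have "(j x, f x) \<in> \<Union>\<C>" if "x \<in> carrier A" for x
    proof -
      obtain C where "C \<in> \<C>" using \<C>(1) by blast
      then show ?thesis using mem[of C] that unfolding \<G>_def by blast
    qed
    moreover have "(a \<odot>\<^bsub>B\<^esub> fst p, a \<otimes> snd p) \<in> \<Union>\<C>" if "a \<in> carrier R" "p \<in> \<Union>\<C>" for a p
      using mem that unfolding \<G>_def by blast
    moreover have "v = \<zero>" if "(\<zero>\<^bsub>B\<^esub>, v) \<in> \<Union>\<C>" for v using mem that unfolding \<G>_def by blast
    ultimately show ?thesis unfolding \<G>_def by blast
  qed
  have "\<G> \<noteq> {}" by (rule notI) (use graph_f in simp)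
  then have "\<exists>M\<in>\<G>. \<forall>X\<in>\<G>. M \<subseteq> X \<longrightarrow> X = M"
    by (rule subset_Zorn_nonempty) (rule union)
  then obtain G where G: "G \<in> \<G>" and max': "\<forall>X\<in>\<G>. G \<subseteq> X \<longrightarrow> X = G" by (rule bexE)
  have car: "b \<in> carrier B" "v \<in> carrier R" if "(b, v) \<in> G" for b v
    using G that by (auto simp: \<G>_def)
  have Gj: "(j x, f x) \<in> G" if "x \<in> carrier A" for x using G that by (auto simp: \<G>_def)
  have add: "(b \<oplus>\<^bsub>B\<^esub> c, v \<oplus> w) \<in> G" if "(b, v) \<in> G" "(c, w) \<in> G" for b v c w
    using G that unfolding \<G>_def by force
  have smult: "(a \<odot>\<^bsub>B\<^esub> b, a \<otimes> v) \<in> G" if "a \<in> carrier R" "(b, v) \<in> G" for a b v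
    using G that unfolding \<G>_def by force
  have single: "v = \<zero>" if "(\<zero>\<^bsub>B\<^esub>, v) \<in> G" for v using G that by (auto simp: \<G>_def)
  have G0: "(\<zero>\<^bsub>B\<^esub>, \<zero>) \<in> G" using Gj[of "\<zero>\<^bsub>A\<^esub>"] j0 by simp
  have uniq: "v = w" if "(b, v) \<in> G" "(b, w) \<in> G" for b v w
  proof -
    have "(b \<oplus>\<^bsub>B\<^esub> (\<ominus> \<one>) \<odot>\<^bsub>B\<^esub> b, v \<oplus> (\<ominus> \<one>) \<otimes> w) \<in> G" using add smult that by simp
    then have "v \<oplus> (\<ominus> \<one>) \<otimes> w = \<zero>" using single B.smult_uminus_one car that by metis
    then have "v \<ominus> w = \<zero>" using car that by (simp add: l_minus minus_eq)
    then show ?thesis using car that by simp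
  qed
  have total: "\<exists>v. (b, v) \<in> G" if b: "b \<in> carrier B" for b
  proof (rule ccontr)
    assume no: "\<nexists>v. (b, v) \<in> G"
    \<comment> \<open>The graph of the homomorphism that sends a to the value already assigned to
      ab, on the left ideal where ab has such a value. Its multiplier r is a consistent value for b,
      and H below is G + R(b, r).\<close>
    let ?K = "{(a, v). a \<in> carrier R \<and> (a \<odot>\<^bsub>B\<^esub> b, v) \<in> G}"
    have "\<exists>r. r \<in> carrier R \<and> (\<forall>a v. (a, v) \<in> ?K \<longrightarrow> a \<otimes> r = v)"
    proof (rule baer_graph[OF baer])
      show "linear_graph ?K"
        unfolding linear_graph_def
        using car add smult G0 b by (auto simp: B.smult_zero_left B.smult_l_distr B.smult_assoc1)
      show "v = \<zero>" if "(\<zero>, v) \<in> ?K" for v using that single b by (simp add: B.smult_zero_left)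
    qed
    then obtain r where r: "r \<in> carrier R" "\<forall>a v. (a, v) \<in> ?K \<longrightarrow> a \<otimes> r = v"
      by (elim exE conjE) (rule that)
    define H where "H = {(d \<oplus>\<^bsub>B\<^esub> a \<odot>\<^bsub>B\<^esub> b, v \<oplus> a \<otimes> r) | d v a. (d, v) \<in> G \<and> a \<in> carrier R}"
    have HI: "(d \<oplus>\<^bsub>B\<^esub> a \<odot>\<^bsub>B\<^esub> b, v \<oplus> a \<otimes> r) \<in> H" if "(d, v) \<in> G" "a \<in> carrier R" for d v a
      using that unfolding H_def by blast
    have GH: "G \<subseteq> H"
    proof (rule subrelI)
      fix d v assume dv: "(d, v) \<in> G"
      show "(d, v) \<in> H" using HI[OF dv zero_closed] car[OF dv] b r(1) by (simp add: B.smult_zero_left)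
    qed
    have "H \<in> \<G>"
      unfolding \<G>_def
    proof (intro CollectI conjI allI impI ballI)
      show "H \<subseteq> carrier B \<times> carrier R" unfolding H_def using car b r(1) by auto
      show "(j x, f x) \<in> H" if "x \<in> carrier A" for x using Gj[OF that] GH by blast
      show "v = \<zero>" if v: "(\<zero>\<^bsub>B\<^esub>, v) \<in> H" for v
      proof -
        obtain d w a where d: "\<zero>\<^bsub>B\<^esub> = d \<oplus>\<^bsub>B\<^esub> a \<odot>\<^bsub>B\<^esub> b" "v = w \<oplus> a \<otimes> r" "(d, w) \<in> G" "a \<in> carrier R"
          using v unfolding H_def by blast
        note c = car[OF d(3)]
        have md: "((\<ominus> \<one>) \<odot>\<^bsub>B\<^esub> d, (\<ominus> \<one>) \<otimes> w) \<in> G" using smult[OF _ d(3)] by simp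
        have "a \<odot>\<^bsub>B\<^esub> b = (\<ominus> \<one>) \<odot>\<^bsub>B\<^esub> d"
        proof -
          have "a \<odot>\<^bsub>B\<^esub> b \<oplus>\<^bsub>B\<^esub> d = (\<ominus> \<one>) \<odot>\<^bsub>B\<^esub> d \<oplus>\<^bsub>B\<^esub> d"
            using d(1) B.smult_uminus_one[OF c(1)] c(1) d(4) b by (simp add: B.M.a_comm)
          then show ?thesis using B.M.add.right_cancel[OF c(1)] c(1) d(4) b by simp
        qed
        then have "(a, (\<ominus> \<one>) \<otimes> w) \<in> ?K" using md d(4) by simp
        then have "a \<otimes> r = (\<ominus> \<one>) \<otimes> w" using r(2) by blast
        then show ?thesis unfolding d(2) using c(2) by (simp add: l_minus r_neg)
      qed
      show "(fst p \<oplus>\<^bsub>B\<^esub> fst q, snd p \<oplus> snd q) \<in> H" if pq: "p \<in> H" "q \<in> H" for p q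
      proof -
        obtain d v a where p: "p = (d \<oplus>\<^bsub>B\<^esub> a \<odot>\<^bsub>B\<^esub> b, v \<oplus> a \<otimes> r)" "(d, v) \<in> G" "a \<in> carrier R"
          using pq(1) unfolding H_def by blast
        obtain d' v' a' where q: "q = (d' \<oplus>\<^bsub>B\<^esub> a' \<odot>\<^bsub>B\<^esub> b, v' \<oplus> a' \<otimes> r)" "(d', v') \<in> G" "a' \<in> carrier R"
          using pq(2) unfolding H_def by blast
        note c = car[OF p(2)] car[OF q(2)]
        have "(d \<oplus>\<^bsub>B\<^esub> a \<odot>\<^bsub>B\<^esub> b) \<oplus>\<^bsub>B\<^esub> (d' \<oplus>\<^bsub>B\<^esub> a' \<odot>\<^bsub>B\<^esub> b) = (d \<oplus>\<^bsub>B\<^esub> d') \<oplus>\<^bsub>B\<^esub> (a \<oplus> a') \<odot>\<^bsub>B\<^esub> b"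
          using c p(3) q(3) b by (simp add: B.smult_l_distr B.M.a_ac)
        moreover have "(v \<oplus> a \<otimes> r) \<oplus> (v' \<oplus> a' \<otimes> r) = (v \<oplus> v') \<oplus> (a \<oplus> a') \<otimes> r"
          using c p(3) q(3) r(1) by algebra
        ultimately show ?thesis
          unfolding p(1) q(1) fst_conv snd_conv
          using HI[OF add[OF p(2) q(2)] a_closed[OF p(3) q(3)]] by simp
      qed
      show "(s \<odot>\<^bsub>B\<^esub> fst p, s \<otimes> snd p) \<in> H" if s: "s \<in> carrier R" and p: "p \<in> H" for s p
      proof -
        obtain d v a where p: "p = (d \<oplus>\<^bsub>B\<^esub> a \<odot>\<^bsub>B\<^esub> b, v \<oplus> a \<otimes> r)" "(d, v) \<in> G" "a \<in> carrier R"
          using p unfolding H_def by blast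
        note c = car[OF p(2)]
        have "s \<odot>\<^bsub>B\<^esub> (d \<oplus>\<^bsub>B\<^esub> a \<odot>\<^bsub>B\<^esub> b) = s \<odot>\<^bsub>B\<^esub> d \<oplus>\<^bsub>B\<^esub> (s \<otimes> a) \<odot>\<^bsub>B\<^esub> b"
          using c p(3) s b by (simp add: B.smult_r_distr B.smult_assoc1)
        moreover have "s \<otimes> (v \<oplus> a \<otimes> r) = s \<otimes> v \<oplus> (s \<otimes> a) \<otimes> r" using c p(3) s r(1) by algebra
        ultimately show ?thesis
          unfolding p(1) fst_conv snd_conv
          using HI[OF smult[OF s p(2)] m_closed[OF s p(3)]] by simp
      qed
    qed
    then have "H = G" using max'[rule_format, OF _ GH] by simp
    moreover have "(\<zero>\<^bsub>B\<^esub> \<oplus>\<^bsub>B\<^esub> \<one> \<odot>\<^bsub>B\<^esub> b, \<zero> \<oplus> \<one> \<otimes> r) \<in> H" by (rule HI[OF G0 one_closed])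
    ultimately show False using no b by auto
  qed
  define h where "h b = (THE v. (b, v) \<in> G)" for b
  have h: "h b = v" if "(b, v) \<in> G" for b v
    unfolding h_def using that uniq by blast
  have hG: "(b, h b) \<in> G" if "b \<in> carrier B" for b
    using total[OF that] h by metis
  have "h \<in> lmodule_hom R B (regular_module R)"
    unfolding lmodule_hom_def
    using car(2)[OF hG] h[OF add[OF hG hG]] h[OF smult[OF _ hG]] by auto
  moreover have "h (j x) = f x" if "x \<in> carrier A" for x using h[OF Gj[OF that]] .
  ultimately show "\<exists>h\<in>lmodule_hom R B (regular_module R). \<forall>x\<in>carrier A. h (j x) = f x" by blast
qed

text \<open>Elements \<open>x\<close> of \<open>R\<close> are identified with the 1-tuples \<open>\<lambda>i\<in>{..<1}. x\<close>.\<close>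

lemma left_macwilliams_one_imp_mono_unit:
  fixes R (structure)
  assumes "ring R" and mac: "left_macwilliams 1 R"
  shows "mono_unit_ring R"
proof (intro mono_unit_ring.intro mono_unit_ring_axioms.intro)
  show "ring R" by fact
  interpret ring R by fact
  fix I f assume I: "left_ideal R I" and f: "left_linear R I f" and inj: "inj_on f I"
  note I' = left_idealD[OF I] and f' = left_linearD[OF f I]
  define t :: "'a \<Rightarrow> nat \<Rightarrow> 'a" where "t x = (\<lambda>i\<in>{..<1}. x)" for x
  define M where "M = power_module R 1"
  have carrier_M: "carrier M = {..<1} \<rightarrow>\<^sub>E carrier R" by (simp add: M_def)
  have t0 [simp]: "t x 0 = x" for x by (simp add: t_def)
  have t_eq: "v = t (v 0)" if "v \<in> {..<1::nat} \<rightarrow>\<^sub>E carrier R" for v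
    using that by (intro ext) (auto simp: t_def PiE_iff extensional_def)
  have tc: "t x \<in> carrier (M)" if "x \<in> carrier R" for x using that by (auto simp: t_def carrier_M)
  have t_add: "t x \<oplus>\<^bsub>M\<^esub> t y = t (x \<oplus> y)" for x y
    by (simp add: t_def M_def cong: restrict_cong)
  have t_smult: "a \<odot>\<^bsub>M\<^esub> t x = t (a \<otimes> x)" for a x
    by (simp add: t_def M_def cong: restrict_cong)
  interpret P: left_module R "M" unfolding M_def by (rule left_module_power_module)
  have t_zero: "\<zero>\<^bsub>M\<^esub> = t \<zero>" by (simp add: t_def M_def)
  have wt: "hamming_weight R 1 (t x) = (if x = \<zero> then 0 else 1)" for x
  proof -
    have "{i \<in> {..<1::nat}. t x i \<noteq> \<zero>} = (if x = \<zero> then {} else {0})" by (auto simp: t_def)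
    then show ?thesis by (simp add: hamming_weight_def)
  qed
  have t_inj: "t x = t y \<Longrightarrow> x = y" for x y by (metis t0)
  have t_neg: "\<ominus>\<^bsub>M\<^esub> t x = t (\<ominus> x)" if "x \<in> carrier R" for x
    by (rule P.M.minus_equality) (use that tc in \<open>simp_all add: t_add t_zero l_neg\<close>)
  let ?L = "t ` I" and ?F = "\<lambda>v. t (f (v 0))"
  have L: "submodule ?L R (M)"
  proof (intro submodule.intro submodule_axioms.intro P.M.add.subgroupI)
    show "?L \<subseteq> carrier (M)" using tc I'(1) by blast
    show "?L \<noteq> {}" using I'(2) by blast
    show "\<ominus>\<^bsub>M\<^esub> v \<in> ?L" if "v \<in> ?L" for v using that t_neg I'(1,5) by auto
    show "v \<oplus>\<^bsub>M\<^esub> w \<in> ?L" if "v \<in> ?L" "w \<in> ?L" for v w using that t_add I'(3) by auto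
    show "a \<odot>\<^bsub>M\<^esub> v \<in> ?L" if "a \<in> carrier R" "v \<in> ?L" for a v using that t_smult I'(4) by auto
  qed
  have F: "?F \<in> lmodule_hom R ((M)\<lparr>carrier := ?L\<rparr>) (M)"
    unfolding lmodule_hom_def
  proof (intro CollectI conjI ballI Pi_I;simp)
    show "t (f (v 0)) \<in> carrier (M)" if "v \<in> ?L" for v using that tc f'(1) by auto
    show "t (f ((v \<oplus>\<^bsub>M\<^esub> w) 0)) = t (f (v 0)) \<oplus>\<^bsub>M\<^esub> t (f (w 0))"
      if vw: "v \<in> ?L" "w \<in> ?L" for v w
    proof -
      obtain x y where xy: "v = t x" "w = t y" "x \<in> I" "y \<in> I" using vw by blast
      show ?thesis unfolding xy(1,2) t_add t0 f'(2)[OF xy(3,4)] ..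
    qed
    show "t (f ((a \<odot>\<^bsub>M\<^esub> v) 0)) = a \<odot>\<^bsub>M\<^esub> t (f (v 0))"
      if av: "a \<in> carrier R" "v \<in> ?L" for a v
    proof -
      obtain x where x: "v = t x" "x \<in> I" using av(2) by blast
      show ?thesis unfolding x(1) t_smult t0 f'(3)[OF av(1) x(2)] ..
    qed
  qed
  have weight: "hamming_weight R 1 (?F v) = hamming_weight R 1 v" if v: "v \<in> ?L" for v
  proof -
    obtain x where x: "v = t x" "x \<in> I" using v by blast
    \<comment> \<open>Weights of 1-tuples are 0 or 1, so preserving them means having zero
      kernel.\<close>
    have "f x = \<zero> \<longleftrightarrow> x = \<zero>" using inj_onD[OF inj, of x \<zero>] x(2) I'(2) f'(4) by auto
    then show ?thesis unfolding x(1) t0 wt by simp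
  qed
  have "\<exists>g \<in> lmodule_auto R (M). \<forall>v\<in>?L. g v = ?F v"
    by (rule mac[unfolded left_macwilliams_def, folded M_def, rule_format]) (use L F weight in blast)
  then obtain g where gh: "g \<in> lmodule_hom R (M) (M)"
    and bij: "bij_betw g (carrier (M)) (carrier (M))"
    and gL: "\<forall>v\<in>?L. g v = ?F v"
    unfolding lmodule_auto_def by blast
  define u where "u = g (t \<one>) 0"
  have gc: "g v \<in> carrier (M)" if "v \<in> carrier (M)" for v
    using gh that unfolding lmodule_hom_def by blast
  have gu: "g (t \<one>) = t u" unfolding u_def using gc[OF tc[OF one_closed]] by (intro t_eq) (simp add: carrier_M)
  have uc: "u \<in> carrier R" unfolding u_def using gc[OF tc[OF one_closed]] by (auto simp: carrier_M PiE_iff)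
  have gx: "g (t x) = t (x \<otimes> u)" if x: "x \<in> carrier R" for x
  proof -
    have "g (x \<odot>\<^bsub>M\<^esub> t \<one>) = x \<odot>\<^bsub>M\<^esub> g (t \<one>)"
      using gh x tc[OF one_closed] unfolding lmodule_hom_def by blast
    then show ?thesis unfolding gu t_smult using x by simp
  qed
  have "t \<one> \<in> g ` carrier (M)"
    using bij tc[OF one_closed] unfolding bij_betw_def by blast
  then obtain v where v: "v \<in> carrier (M)" "t \<one> = g v" by blast
  define w where "w = v 0"
  have wc: "w \<in> carrier R" unfolding w_def using v(1) by (auto simp: carrier_M PiE_iff)
  have vw: "v = t w" unfolding w_def using v(1) by (intro t_eq) (simp add: carrier_M)
  have "t \<one> = t (w \<otimes> u)" using v(2) unfolding vw gx[OF wc] .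
  then have wu: "w \<otimes> u = \<one>" using t_inj by metis
  \<comment> \<open>Surjectivity of g gave wu = 1. Now (uw)u = u, and injectivity of g turns this
    into uw = 1.\<close>
  have "g (t (u \<otimes> w)) = g (t \<one>)"
    using gx[of "u \<otimes> w"] gx[OF one_closed] uc wc wu by (simp add: m_assoc)
  then have "t (u \<otimes> w) = t \<one>"
    using bij_betw_imp_inj_on[OF bij] tc uc wc by (meson inj_onD m_closed one_closed)
  then have "u \<otimes> w = \<one>" by (rule t_inj)
  then have "u \<in> Units R" using uc wc wu unfolding Units_def by blast
  moreover have "f x = x \<otimes> u" if x: "x \<in> I" for x
  proof -
    have "t (x \<otimes> u) = t (f x)" using gL x gx[OF I'(1)[OF x]] by auto
    then show ?thesis using t_inj by metis
  qed
  ultimately show "\<exists>u\<in>Units R. \<forall>x\<in>I. f x = x \<otimes> u" by blast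
qed

theorem corollary2p10:
  fixes R :: "('a, 'm) ring_scheme"
  assumes "ring R"
    and "left_macwilliams 1 R"
    and "left_noetherian R \<or> right_noetherian R"
  shows "quasi_frobenius TYPE('b) TYPE('c) R"
proof -
  interpret ring R by fact
  interpret op: ring "opposite_ring R" by (rule ring_opposite_ring)
  interpret mono_unit_ring R by (rule left_macwilliams_one_imp_mono_unit[OF assms(1,2)])
  have acc: "left_acc R \<or> left_acc (opposite_ring R)"
    using assms(3) left_noetherian_imp_acc op.left_noetherian_imp_acc unfolding right_noetherian_def by blast
  obtain es where es: "semiprimary_ring R (left_singular R) es" by (rule semiprimary[OF acc])
  interpret semiprimary_ring R "left_singular R" es by (rule es)
  interpret mono_unit_semiprimary_ring R es ..
  interpret sop: semiprimary_ring "opposite_ring R" "left_singular R" es by (rule semiprimary_opposite)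
  \<comment> \<open>The Hopkins-Levitzki argument stays on the side of the hypothesis; the other
    side is reached only after the annihilator identities.\<close>
  have chain: "left_acc R \<and> left_dcc R \<or> left_acc (opposite_ring R) \<and> left_dcc (opposite_ring R)"
    using acc
  proof
    assume 1: "left_acc R"
    show ?thesis using 1 left_artinian_imp_dcc[OF acc_imp_left_artinian[OF 1]] by (intro disjI1 conjI)
  next
    assume 1: "left_acc (opposite_ring R)"
    show ?thesis using 1 op.left_artinian_imp_dcc[OF sop.acc_imp_left_artinian[OF 1]]
      by (intro disjI2 conjI)
  qed
  \<comment> \<open>Either case of \<open>chain\<close> supplies one disjunct of each statement, so
    right and left annihilators both reduce to those of finite subsets.\<close>
  then have c1: "left_dcc (opposite_ring R) \<or> left_acc R" and c2: "left_dcc R \<or> left_acc (opposite_ring R)"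
    by auto
  have fin_r: "\<exists>F. finite F \<and> F \<subseteq> X \<and> rann R F \<subseteq> rann R X" if X: "X \<subseteq> carrier R" for X
  proof -
    obtain F where "finite F" "F \<subseteq> X" "rann R F \<subseteq> rann R X"
      using op.finite_lann[of X, simplified, OF c1 X] .
    then show ?thesis by blast
  qed
  have baer: "left_baer R" by (rule baer[OF fin_r])
  have left: "lann R (rann R I) = I" if "left_ideal R I" for I
    by (rule lann_rann_left_ideal[OF baer that])
  have right: "rann R (lann R T) = T" if T: "left_ideal (opposite_ring R) T" for T
  proof
    have TR: "T \<subseteq> carrier R" using op.left_idealD(1)[OF T] by auto
    then show "T \<subseteq> rann R (lann R T)" by (rule subset_rann_lann)
    \<comment> \<open>The Baer condition yields the double annihilator inclusion for finite subsets
      of T only; the choice of F removes the restriction.\<close>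
    obtain F where F: "finite F" "F \<subseteq> T" "lann R F \<subseteq> lann R T"
      using finite_lann[OF c2 TR] .
    have "rann R (lann R T) \<subseteq> rann R (lann R F)" by (rule rann_antimono[OF F(3)])
    also have "\<dots> \<subseteq> T" by (rule baer_rann_lann_finite[OF baer T F(1,2)])
    finally show "rann R (lann R T) \<subseteq> T" .
  qed
  have all: "left_dcc R \<and> left_acc (opposite_ring R) \<and> left_dcc (opposite_ring R)"
    using chain
  proof
    assume 1: "left_acc R \<and> left_dcc R"
    then show ?thesis
      using annihilator_duality_acc_imp_dcc[OF conjunct1[OF 1] right]
        annihilator_duality_dcc_imp_acc[OF conjunct2[OF 1] right] by blast
  next
    assume 1: "left_acc (opposite_ring R) \<and> left_dcc (opposite_ring R)"
    then show ?thesis using op.annihilator_duality_acc_imp_dcc[simplified, OF conjunct1[OF 1] left] by blast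
  qed
  \<comment> \<open>Over the opposite ring the two annihilator identities exchange their roles, and
    the maximum condition on right ideals comes from \<open>all\<close>.\<close>
  have rbaer: "left_baer (opposite_ring R)"
    by (rule op.annihilator_duality_baer[simplified, OF conjunct1[OF conjunct2[OF all]] right left])
  show ?thesis
    unfolding quasi_frobenius_def right_artinian_def right_self_injective_def
    using left_dcc_imp_artinian op.left_dcc_imp_artinian all
      baer_imp_self_injective[OF baer] op.baer_imp_self_injective[OF rbaer] by blast
qed

end
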